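(* Let $p\ge2$ and let $(x^i,f^i,h^i,g,l,r)$, $i=1,2$, be two sets of parameters such that $x^i\in\mathbb{R}$, $(l,r)$ is a $p$-admissible constraint pair and $(f^i,h^i,g)$ are $p$-admissible coefficients. Suppose: (1) $x^1\leq x^2$; (2) for each $x\in\mathbb{R}$, $f^1(t,x)\leq f^2(t,x)$, $h^1(t,x)\leq h^2(t,x)$, $t\in[0,T]$, q.s.; (3) there exists a constant $c>0$ such that for $t\in[0,T]$ and $x,y\in\mathbb{R}$, q.s., $$c|x-y|\leq |r(t,\omega,x)-r(t,\omega,y)|\vee |l(t,\omega,x)-l(t,\omega,y)|;$$ (4) for each $n\in\mathbb{N}$ and $i=1,2$, there exists a $p$-admissible constraint pair $(l^{i,n},r^{i,n})$ satisfying the inequality in (3) (with $(l^{i,n},r^{i,n})$ in place of $(l,r)$), such that $(l^{i,n})^{-1}(\cdot,0)$ and $(r^{i,n})^{-1}(\cdot,0)$ are bounded, $l^{2,n}(t,x)\leq l^{1,n}(t,x)$, $r^{2,n}(t,x)\leq r^{1,n}(t,x)$ for any $n\in\mathbb{N}$, $t\in[0,T]$ and $x\in\mathbb{R}$, q.s., and $$\lim_{n\rightarrow \infty}\hat{\mathbb{E}}\left[\sup_{t\in[0,T]}|l^{-1}(t,0)-(l^{i,n})^{-1}(t,0)|^p\right]=\lim_{n\rightarrow \infty}\hat{\mathbb{E}}\left[\sup_{t\in[0,T]}|r^{-1}(t,0)-(r^{i,n})^{-1}(t,0)|^p\right]=0;$$ (5) for each $t\in[0,T]$, $g$ does not depend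 on $x$, and either $f^1(t,\cdot),h^1(t,\cdot)$ or $f^2(t,\cdot),h^2(t,\cdot)$ are nondecreasing. Let $(X^i,A^i)$ be the solution to the doubly reflected $G$-SDE with parameters $(x^i,f^i,h^i,g,l,r)$ and let $(A^{i,l},A^{i,r})$ be the associated constraining processes, $i=1,2$. Then, for $t\in[0,T]$, q.s., (a) $A^{1,l}_t\leq A^{2,l}_t\leq A^{1,l}_t+\hat{X}_t+(x^2-x^1)$; (b) $A^{2,r}_t\leq A^{1,r}_t\leq A^{2,r}_t+\hat{X}_t+(x^2-x^1)$, where $$\hat{X}_t=\int_0^t \big(f^2(s,X^2_s)-f^1(s,X^1_s)\big)ds+\int_0^t \big(h^2(s,X^2_s)-h^1(s,X^1_s)\big)d\langle B\rangle_s.$$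
   Context: $a\vee b=\max(a,b)$. Fix $T>0$. $\Omega_T=C_0([0,T];\mathbb{R})$ is the space of real continuous functions on $[0,T]$ vanishing at $0$, with the supremum norm; $B$ is the canonical process. Fix $0\le\underline{\sigma}^2<\bar{\sigma}^2$ and set $G(a)=\frac12(\bar{\sigma}^2a^+-\underline{\sigma}^2a^-)$. $C_{l,Lip}(\mathbb{R}^n)$ is the set of functions $\varphi$ with $|\varphi(x)-\varphi(y)|\le C(1+|x|^k+|y|^k)|x-y|$ for some $C,k$; $C_{b,Lip}(\mathbb{R}^n)$ is the set of bounded Lipschitz functions. $L_{ip}(\Omega_t)=\{\varphi(B_{t_1},\dots,B_{t_n}): n\in\mathbb{N},\ t_1,\dots,t_n\in[0,t],\ \varphi\in C_{l,Lip}(\mathbb{R}^n)\}$. $\hat{\mathbb{E}}:L_{ip}(\Omega_T)\to\mathbb{R}$ is the $G$-expectation, i.e. the sublinear expectation under which $B$ is a $G$-Brownian motion: for $0\le s\le t\le T$ and $\varphi\in C_{l,Lip}(\mathbb{R})$, $\hat{\mathbb{E}}[\varphi(x+B_t-B_s)]=u(t-s,x)$ where $u$ is the viscosity solution of $\partial_tu-G(\partial_x^2u)=0$, $u(0,\cdot)=\varphi$, and for $0\le t_1\le\dots\le t_n\le T$, $\varphi\in C_{l,Lip}(\mathbb{R}^n)$, $\hat{\mathbb{E}}[\varphi(B_{t_1},\dots,B_{t_{n-1}},B_{t_n}-B_{t_{n-1}})]=\hat{\mathbb{E}}[\psi(B_{t_1},\dots,B_{t_{n-1}})]$ with $\psi(x_1,\dots,x_{n-1})=\hat{\mathbb{E}}[\varphi(x_1,\dots,x_{n-1},B_{t_n}-B_{t_{n-1}})]$.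 For $p\ge1$, $L_G^p(\Omega_T)$ is the completion of $L_{ip}(\Omega_T)$ under $(\hat{\mathbb{E}}[|\xi|^p])^{1/p}$, to which $\hat{\mathbb E}$ extends. There is a weakly compact set $\mathcal{P}$ of probability measures on $(\Omega_T,\mathcal{B}(\Omega_T))$ (fixed) with $\hat{\mathbb{E}}[\xi]=\sup_{P\in\mathcal{P}}E_P[\xi]$ for $\xi\in L_G^1(\Omega_T)$. A Borel set $A$ is polar if $\sup_{P\in\mathcal{P}}P(A)=0$; a property holds quasi-surely (q.s.) if it holds outside a polar set; random variables equal q.s. are identified. Process spaces. $M_G^0(0,T)$ is the set of processes $\eta_t=\sum_{j=0}^{N-1}\xi_j\mathbf{1}_{[t_j,t_{j+1})}(t)$ with $\{t_0,\dots,t_N\}$ a partition of $[0,T]$ and $\xi_j\in L_{ip}(\Omega_{t_j})$; $M_G^p(0,T)$ and $H_G^p(0,T)$ are its completions under $(\hat{\mathbb{E}}[\int_0^T|\eta_s|^pds])^{1/p}$ and $(\hat{\mathbb{E}}[(\int_0^T|\eta_s|^2ds)^{p/2}])^{1/p}$. $S_G^0(0,T)=\{\theta(t,B_{t_1\wedge t},\dots,B_{t_n\wedge t}): t_1,\dots,t_n\in[0,T],\ \theta\in C_{b,Lip}(\mathbb{R}^{n+1})\}$; $S_G^p(0,T)$ is its completion under $(\hat{\mathbb{E}}[\sup_{t\in[0,T]}|\eta_t|^p])^{1/p}$. $\langle B\rangle$ is the quadratic variation of $B$; $\int\eta\,dB$ and $\int\xi\,d\langle B\rangle$ are the $G$-Itô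 integrals (continuous extensions from simple processes). $M_I(0,T)$ (resp. $M_{BV}(0,T)$) is the collection of processes whose paths on $[0,T]$ are, outside a polar set, continuous and increasing (resp. continuous and of bounded variation); integrals against them are pathwise Stieltjes integrals. $p$-admissible constraint pair ($p\ge2$): functions $r,l:[0,T]\times\Omega_T\times\mathbb{R}\to\mathbb{R}$ ($\omega$ suppressed) such that (i) for each fixed $x\in\mathbb{R}$, $r(\cdot,x),l(\cdot,x)$ are continuous on $[0,T]$, q.s.; (ii) for any fixed $t\in[0,T]$, $r(t,\cdot)$, $l(t,\cdot)$ are strictly increasing, and $r(t,x)>l(t,x)$ for any $(t,x)\in[0,T]\times\mathbb{R}$, q.s.; (iii) for any $t\in[0,T]$ the inverses $r^{-1}(t,0)$ and $l^{-1}(t,0)$ (the points at which $r(t,\cdot)$, respectively $l(t,\cdot)$, vanish) exist, q.s., the processes $\{r^{-1}(t,0)\}_{t\in[0,T]}$, $\{l^{-1}(t,0)\}_{t\in[0,T]}$ belong to $S_G^p(0,T)$, and $\inf_{(t,\omega)\in[0,T]\times\Omega_T}(l^{-1}(t,\omega,0)-r^{-1}(t,\omega,0))>0$. $p$-admissible coefficients: functions $f,h,g:[0,T]\times\Omega_T\times\mathbb{R}\to\mathbb{R}$ such that (A1) for each $x\in\mathbb{R}$, $f(\cdot,\cdot,x),h(\cdot,\cdot,x)\in M_G^p(0,T)$ and $g(\cdot,\cdot,x)\in H_G^p(0,T)$; (A2) there is a constant $L>0$ such that for all $(t,\omega)\in[0,T]\times\Omega_T$ and $x,x'\in\mathbb{R}$,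 $|f(t,\omega,x)-f(t,\omega,x')|+|g(t,\omega,x)-g(t,\omega,x')|+|h(t,\omega,x)-h(t,\omega,x')|\le L|x-x'|$. Solution of the doubly reflected $G$-SDE with parameters $(x_0,f,h,g,l,r)$: a pair $(X,A)$ with (1) $X\in S_G^p(0,T)$, $A\in S_G^p(0,T)\cap M_{BV}(0,T)$ and $X_t=x_0+\int_0^tf(s,X_s)ds+\int_0^th(s,X_s)d\langle B\rangle_s+\int_0^tg(s,X_s)dB_s+A_t$, $t\in[0,T]$; (2) $l(t,X_t)\le0\le r(t,X_t)$, $t\in[0,T]$, q.s.; (3) $A_{0-}=0$ and $A=A^r-A^l$ with $A^r,A^l\in M_I(0,T)\cap S_G^p(0,T)$ and $\int_0^Tl(s,X_s)dA^l_s=\int_0^Tr(s,X_s)dA^r_s=0$, q.s. The pair $(A^l,A^r)$ is called the pair of constraining processes. Conventions: $A_{0-}=A^r_{0-}=A^l_{0-}=0$, and the integrals in (3) include the possible atoms at time $0$ of sizes $A^l_0,A^r_0$. Under the admissibility assumptions the solution exists and is unique. *)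

theory Defs
  imports "HOL-Probability.Probability"
begin

section \<open>Path space\<close>

(* The bounded continuous functions on the line that vanish on the left of 0 and are constant on
   the right of T form an isometric copy of C_0([0,T];R) with the supremum norm (extend every path
   by constants).  Thus the metric, topology and Borel sets of the path space are the library's,
   and the canonical process is evaluation. *)
type_synonym path = "real \<Rightarrow>\<^sub>C real"
type_synonym rvar = "path \<Rightarrow> real"
type_synonym process = "real \<Rightarrow> path \<Rightarrow> real"
type_synonym field = "real \<Rightarrow> path \<Rightarrow> real \<Rightarrow> real"

definition Omega :: "real \<Rightarrow> path set" where
  "Omega T = {\<omega>. (\<forall>t\<le>0. apply_bcontfun \<omega> t = 0) \<and> (\<forall>t\<ge>T. apply_bcontfun \<omega> t = apply_bcontfun \<omega> T)}"

definition path_space :: "real \<Rightarrow> path measure" where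
  "path_space T = restrict_space borel (Omega T)"

definition canonical :: process where
  "canonical t \<omega> = apply_bcontfun \<omega> t"

section \<open>Test functions and cylinder random variables\<close>

(* Points of R^n are lists of length n; functions on R^n are only ever looked at on such lists. *)
definition eucl_norm :: "real list \<Rightarrow> real" where
  "eucl_norm x = L2_set (\<lambda>i. x ! i) {..<length x}"

definition eucl_dist :: "real list \<Rightarrow> real list \<Rightarrow> real" where
  "eucl_dist x y = L2_set (\<lambda>i. x ! i - y ! i) {..<length x}"

definition C_l_Lip :: "nat \<Rightarrow> (real list \<Rightarrow> real) set" where
  "C_l_Lip n = {\<phi>. \<exists>C. \<exists>k::nat. \<forall>x y. length x = n \<longrightarrow> length y = n \<longrightarrow>
     \<bar>\<phi> x - \<phi> y\<bar> \<le> C * (1 + eucl_norm x ^ k + eucl_norm y ^ k) * eucl_dist x y}"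

definition C_b_Lip :: "nat \<Rightarrow> (real list \<Rightarrow> real) set" where
  "C_b_Lip n = {\<phi>. (\<exists>K. \<forall>x. length x = n \<longrightarrow> \<bar>\<phi> x\<bar> \<le> K) \<and>
     (\<exists>L. \<forall>x y. length x = n \<longrightarrow> length y = n \<longrightarrow> \<bar>\<phi> x - \<phi> y\<bar> \<le> L * eucl_dist x y)}"

definition L_ip :: "real \<Rightarrow> rvar set" where
  "L_ip t = {(\<lambda>\<omega>. \<phi> (map (\<lambda>s. canonical s \<omega>) ts)) | \<phi> ts. set ts \<subseteq> {0..t} \<and> \<phi> \<in> C_l_Lip (length ts)}"

section \<open>G-expectation\<close>

definition G_fun :: "real \<Rightarrow> real \<Rightarrow> real \<Rightarrow> real" where
  "G_fun slow shigh a = (shigh\<^sup>2 * max a 0 - slow\<^sup>2 * max (- a) 0) / 2"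

definition C12_test ::
  "real \<Rightarrow> (real \<Rightarrow> real \<Rightarrow> real) \<Rightarrow> (real \<Rightarrow> real \<Rightarrow> real) \<Rightarrow> (real \<Rightarrow> real \<Rightarrow> real) \<Rightarrow> bool" where
  "C12_test T \<psi> \<psi>t \<psi>xx \<longleftrightarrow> (\<exists>\<psi>x.
     (\<forall>t\<in>{0<..<T}. \<forall>x.
        ((\<lambda>s. \<psi> s x) has_real_derivative \<psi>t t x) (at t) \<and>
        ((\<lambda>y. \<psi> t y) has_real_derivative \<psi>x t x) (at x) \<and>
        ((\<lambda>y. \<psi>x t y) has_real_derivative \<psi>xx t x) (at x)) \<and>
     (\<forall>v\<in>{\<psi>, \<psi>t, \<psi>x, \<psi>xx}. continuous_on ({0<..<T} \<times> UNIV) (\<lambda>(t, x). v t x)))"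

(* Viscosity solution of u_t - G(u_xx) = 0 on (0,T) x R with u(0,.) = phi.  Polynomial growth in x
   is the class in which this Cauchy problem is well posed. *)
definition viscosity_solution ::
  "real \<Rightarrow> (real \<Rightarrow> real) \<Rightarrow> (real \<Rightarrow> real) \<Rightarrow> (real \<Rightarrow> real \<Rightarrow> real) \<Rightarrow> bool" where
  "viscosity_solution T G \<phi> u \<longleftrightarrow>
     continuous_on ({0..T} \<times> UNIV) (\<lambda>(t, x). u t x) \<and>
     (\<exists>C. \<exists>k::nat. \<forall>t\<in>{0..T}. \<forall>x. \<bar>u t x\<bar> \<le> C * (1 + \<bar>x\<bar> ^ k)) \<and>
     (\<forall>x. u 0 x = \<phi> x) \<and>
     (\<forall>\<psi> \<psi>t \<psi>xx. C12_test T \<psi> \<psi>t \<psi>xx \<longrightarrow> (\<forall>t\<in>{0<..<T}. \<forall>x.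
        ((\<forall>\<^sub>F z in nhds (t, x). u (fst z) (snd z) - \<psi> (fst z) (snd z) \<le> u t x - \<psi> t x)
           \<longrightarrow> \<psi>t t x - G (\<psi>xx t x) \<le> 0) \<and>
        ((\<forall>\<^sub>F z in nhds (t, x). u (fst z) (snd z) - \<psi> (fst z) (snd z) \<ge> u t x - \<psi> t x)
           \<longrightarrow> \<psi>t t x - G (\<psi>xx t x) \<ge> 0)))"

definition sublinear_expectation :: "real \<Rightarrow> (rvar \<Rightarrow> real) \<Rightarrow> bool" where
  "sublinear_expectation T E \<longleftrightarrow>
     (\<forall>\<xi>\<in>L_ip T. \<forall>\<zeta>\<in>L_ip T. (\<forall>\<omega>\<in>Omega T. \<xi> \<omega> \<le> \<zeta> \<omega>) \<longrightarrow> E \<xi> \<le> E \<zeta>) \<and>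
     (\<forall>c. E (\<lambda>_. c) = c) \<and>
     (\<forall>\<xi>\<in>L_ip T. \<forall>\<zeta>\<in>L_ip T. E (\<lambda>\<omega>. \<xi> \<omega> + \<zeta> \<omega>) \<le> E \<xi> + E \<zeta>) \<and>
     (\<forall>\<xi>\<in>L_ip T. \<forall>a\<ge>0. E (\<lambda>\<omega>. a * \<xi> \<omega>) = a * E \<xi>)"

definition G_expectation :: "real \<Rightarrow> real \<Rightarrow> real \<Rightarrow> (rvar \<Rightarrow> real) \<Rightarrow> bool" where
  "G_expectation T slow shigh E \<longleftrightarrow>
     sublinear_expectation T E \<and>
     (\<forall>\<phi>\<in>C_l_Lip 1. \<exists>u. viscosity_solution T (G_fun slow shigh) (\<lambda>x. \<phi> [x]) u \<and>
        (\<forall>s t x. 0 \<le> s \<longrightarrow> s \<le> t \<longrightarrow> t \<le> T \<longrightarrow>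
           E (\<lambda>\<omega>. \<phi> [x + canonical t \<omega> - canonical s \<omega>]) = u (t - s) x)) \<and>
     (\<forall>ts t. \<forall>\<phi>\<in>C_l_Lip (Suc (length ts)).
        ts \<noteq> [] \<longrightarrow> sorted ts \<longrightarrow> set ts \<subseteq> {0..t} \<longrightarrow> t \<le> T \<longrightarrow>
        E (\<lambda>\<omega>. \<phi> (map (\<lambda>s. canonical s \<omega>) ts @ [canonical t \<omega> - canonical (last ts) \<omega>])) =
        E (\<lambda>\<omega>. (\<lambda>xs. E (\<lambda>\<omega>'. \<phi> (xs @ [canonical t \<omega>' - canonical (last ts) \<omega>'])))
                  (map (\<lambda>s. canonical s \<omega>) ts)))"

section \<open>Upper expectation, polar sets and the spaces \<open>L\<^sub>G\<^sup>p\<close>\<close>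

definition upper_integral :: "'a measure \<Rightarrow> ('a \<Rightarrow> ennreal) \<Rightarrow> ennreal" where
  "upper_integral M X =
     (INF Y\<in>{Y \<in> borel_measurable M. \<forall>z\<in>space M. X z \<le> Y z}. \<integral>\<^sup>+z. Y z \<partial>M)"

(* The supremum over PP of the expectations, for nonnegative variables.  On variables that agree
   q.s. with a Borel one this is sup_P E_P; the Borel majorants only serve to make it meaningful
   before measurability is known, so that members of the completions below automatically have Borel
   versions and q.s. equal variables are not distinguished. *)
definition upper_expectation :: "real \<Rightarrow> path measure set \<Rightarrow> (path \<Rightarrow> ennreal) \<Rightarrow> ennreal" where
  "upper_expectation T PP X =
     (INF Y\<in>{Y \<in> borel_measurable (path_space T). \<forall>\<omega>\<in>Omega T. X \<omega> \<le> Y \<omega>}.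
        SUP P\<in>PP. \<integral>\<^sup>+\<omega>. Y \<omega> \<partial>P)"

definition polar :: "real \<Rightarrow> path measure set \<Rightarrow> path set \<Rightarrow> bool" where
  "polar T PP N \<longleftrightarrow> N \<in> sets (path_space T) \<and> (SUP P\<in>PP. emeasure P N) = 0"

definition quasi_surely :: "real \<Rightarrow> path measure set \<Rightarrow> (path \<Rightarrow> bool) \<Rightarrow> bool" where
  "quasi_surely T PP Q \<longleftrightarrow> (\<exists>N. polar T PP N \<and> (\<forall>\<omega>\<in>Omega T - N. Q \<omega>))"

definition L_G :: "real \<Rightarrow> path measure set \<Rightarrow> real \<Rightarrow> rvar set" where
  "L_G T PP p = {\<xi>. \<exists>\<zeta>. (\<forall>n. \<zeta> n \<in> L_ip T) \<and>
     (\<lambda>n::nat. upper_expectation T PP (\<lambda>\<omega>. ennreal (\<bar>\<xi> \<omega> - \<zeta> n \<omega>\<bar> powr p))) \<longlonglongrightarrow> 0}"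

definition weak_topology :: "real \<Rightarrow> path measure topology" where
  "weak_topology T = topology_generated_by
     {{P. prob_space P \<and> sets P = sets (path_space T) \<and> (\<integral>\<omega>. f \<omega> \<partial>P) \<in> U} | f U.
        continuous_on (Omega T) f \<and> bounded (f ` Omega T) \<and> open (U :: real set)}"

definition represents :: "real \<Rightarrow> path measure set \<Rightarrow> (rvar \<Rightarrow> real) \<Rightarrow> bool" where
  "represents T PP E \<longleftrightarrow> PP \<noteq> {} \<and> compactin (weak_topology T) PP \<and>
     (\<forall>\<xi>\<in>L_G T PP 1. E \<xi> = (SUP P\<in>PP. \<integral>\<omega>. \<xi> \<omega> \<partial>(completion P)))"

section \<open>Process spaces\<close>

definition is_partition :: "real \<Rightarrow> nat \<Rightarrow> (nat \<Rightarrow> real) \<Rightarrow> bool" where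
  "is_partition T N ts \<longleftrightarrow> ts 0 = 0 \<and> ts N = T \<and> (\<forall>j<N. ts j < ts (Suc j))"

definition simple_data :: "real \<Rightarrow> nat \<Rightarrow> (nat \<Rightarrow> real) \<Rightarrow> (nat \<Rightarrow> rvar) \<Rightarrow> bool" where
  "simple_data T N ts \<xi> \<longleftrightarrow> is_partition T N ts \<and> (\<forall>j<N. \<xi> j \<in> L_ip (ts j))"

definition simple_process :: "nat \<Rightarrow> (nat \<Rightarrow> real) \<Rightarrow> (nat \<Rightarrow> rvar) \<Rightarrow> process" where
  "simple_process N ts \<xi> t \<omega> = (\<Sum>j<N. \<xi> j \<omega> * indicator {ts j..<ts (Suc j)} t)"

definition M_G0 :: "real \<Rightarrow> process set" where
  "M_G0 T = {simple_process N ts \<xi> | N ts \<xi>. simple_data T N ts \<xi>}"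

definition S_G0 :: "real \<Rightarrow> process set" where
  "S_G0 T = {(\<lambda>t \<omega>. \<theta> (t # map (\<lambda>s. canonical (min s t) \<omega>) ts)) | \<theta> ts.
     set ts \<subseteq> {0..T} \<and> \<theta> \<in> C_b_Lip (Suc (length ts))}"

definition time_integral :: "real \<Rightarrow> (real \<Rightarrow> ennreal) \<Rightarrow> ennreal" where
  "time_integral T \<phi> = upper_integral (restrict_space lborel {0..T}) \<phi>"

definition ennpowr :: "ennreal \<Rightarrow> real \<Rightarrow> ennreal" where
  "ennpowr x a = (if x = top then top else ennreal (enn2real x powr a))"

(* The p-th powers of the three norms. *)
definition M_normp :: "real \<Rightarrow> path measure set \<Rightarrow> real \<Rightarrow> process \<Rightarrow> ennreal" where
  "M_normp T PP p \<eta> =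
     upper_expectation T PP (\<lambda>\<omega>. time_integral T (\<lambda>s. ennreal (\<bar>\<eta> s \<omega>\<bar> powr p)))"

definition H_normp :: "real \<Rightarrow> path measure set \<Rightarrow> real \<Rightarrow> process \<Rightarrow> ennreal" where
  "H_normp T PP p \<eta> =
     upper_expectation T PP (\<lambda>\<omega>. ennpowr (time_integral T (\<lambda>s. ennreal (\<bar>\<eta> s \<omega>\<bar>\<^sup>2))) (p / 2))"

definition S_normp :: "real \<Rightarrow> path measure set \<Rightarrow> real \<Rightarrow> process \<Rightarrow> ennreal" where
  "S_normp T PP p \<eta> =
     upper_expectation T PP (\<lambda>\<omega>. SUP t\<in>{0..T}. ennreal (\<bar>\<eta> t \<omega>\<bar> powr p))"

definition norm_completion :: "(process \<Rightarrow> ennreal) \<Rightarrow> process set \<Rightarrow> process set" where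
  "norm_completion nrm S = {\<eta>. \<exists>\<zeta>. (\<forall>n. \<zeta> n \<in> S) \<and>
     (\<lambda>n::nat. nrm (\<lambda>t \<omega>. \<eta> t \<omega> - \<zeta> n t \<omega>)) \<longlonglongrightarrow> 0}"

definition M_G :: "real \<Rightarrow> path measure set \<Rightarrow> real \<Rightarrow> process set" where
  "M_G T PP p = norm_completion (M_normp T PP p) (M_G0 T)"

definition H_G :: "real \<Rightarrow> path measure set \<Rightarrow> real \<Rightarrow> process set" where
  "H_G T PP p = norm_completion (H_normp T PP p) (M_G0 T)"

definition S_G :: "real \<Rightarrow> path measure set \<Rightarrow> real \<Rightarrow> process set" where
  "S_G T PP p = norm_completion (S_normp T PP p) (S_G0 T)"

definition M_I :: "real \<Rightarrow> path measure set \<Rightarrow> process set" where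
  "M_I T PP = {a. quasi_surely T PP (\<lambda>\<omega>.
     continuous_on {0..T} (\<lambda>t. a t \<omega>) \<and> mono_on {0..T} (\<lambda>t. a t \<omega>))}"

definition M_BV :: "real \<Rightarrow> path measure set \<Rightarrow> process set" where
  "M_BV T PP = {a. quasi_surely T PP (\<lambda>\<omega>.
     continuous_on {0..T} (\<lambda>t. a t \<omega>) \<and>
     (\<exists>V. \<forall>N ts. is_partition T N ts \<longrightarrow> (\<Sum>j<N. \<bar>a (ts (Suc j)) \<omega> - a (ts j) \<omega>\<bar>) \<le> V))}"

section \<open>Stochastic integrals\<close>

(* Q is a continuous version of the quadratic variation process of the canonical process. *)
definition quadratic_variation :: "real \<Rightarrow> path measure set \<Rightarrow> process \<Rightarrow> bool" where
  "quadratic_variation T PP Q \<longleftrightarrow>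
     quasi_surely T PP (\<lambda>\<omega>. continuous_on {0..T} (\<lambda>t. Q t \<omega>)) \<and>
     (\<forall>t\<in>{0..T}. \<forall>N ts.
        (\<forall>n::nat. is_partition t (N n) (ts n)) \<longrightarrow>
        (\<forall>\<epsilon>>0. \<forall>\<^sub>F n in sequentially. \<forall>j<N n. ts n (Suc j) - ts n j < \<epsilon>) \<longrightarrow>
        (\<lambda>n. upper_expectation T PP (\<lambda>\<omega>. ennreal
           (((\<Sum>j<N n. (canonical (ts n (Suc j)) \<omega> - canonical (ts n j) \<omega>)\<^sup>2) - Q t \<omega>)\<^sup>2))) \<longlonglongrightarrow> 0)"

definition simple_integral ::
  "process \<Rightarrow> nat \<Rightarrow> (nat \<Rightarrow> real) \<Rightarrow> (nat \<Rightarrow> rvar) \<Rightarrow> process" where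
  "simple_integral Z N ts \<xi> t \<omega> =
     (\<Sum>j<N. \<xi> j \<omega> * (Z (min (ts (Suc j)) t) \<omega> - Z (min (ts j) t) \<omega>))"

(* J is the integral process of eta against Z: the image of eta under the extension, continuous from
   nrm to the S_G^p norm, of the integral of simple processes. *)
definition is_integral_process ::
  "real \<Rightarrow> path measure set \<Rightarrow> real \<Rightarrow> (process \<Rightarrow> ennreal) \<Rightarrow> process \<Rightarrow> process \<Rightarrow> process \<Rightarrow> bool" where
  "is_integral_process T PP p nrm Z \<eta> J \<longleftrightarrow> (\<exists>N ts \<xi>.
     (\<forall>n::nat. simple_data T (N n) (ts n) (\<xi> n)) \<and>
     (\<lambda>n. nrm (\<lambda>t \<omega>. \<eta> t \<omega> - simple_process (N n) (ts n) (\<xi> n) t \<omega>)) \<longlonglongrightarrow> 0 \<and>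
     (\<lambda>n. S_normp T PP p (\<lambda>t \<omega>. J t \<omega> - simple_integral Z (N n) (ts n) (\<xi> n) t \<omega>)) \<longlonglongrightarrow> 0)"

(* The integral processes exist on H_G^p and on M_G^p, and are unique up to a polar set;
   a version is chosen. *)
definition dB_integral :: "real \<Rightarrow> path measure set \<Rightarrow> real \<Rightarrow> process \<Rightarrow> process" where
  "dB_integral T PP p \<eta> =
     (SOME J. is_integral_process T PP p (H_normp T PP p) canonical \<eta> J)"

definition dQ_integral :: "real \<Rightarrow> path measure set \<Rightarrow> real \<Rightarrow> process \<Rightarrow> process \<Rightarrow> process" where
  "dQ_integral T PP p Q \<eta> =
     (SOME J. is_integral_process T PP p (M_normp T PP p) Q \<eta> J)"

definition dt_integral :: "process \<Rightarrow> process" where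
  "dt_integral \<eta> t \<omega> = (LINT s:{0..t}|lebesgue. \<eta> s \<omega>)"

section \<open>Doubly reflected G-SDEs\<close>

(* The process t |-> l^{-1}(t,0).  The values of l(t,omega,.) are injective in x q.s. *)
definition inv0 :: "field \<Rightarrow> process" where
  "inv0 l t \<omega> = inv (l t \<omega>) 0"

(* Since inverses are only required to exist q.s., the infimum in the last
   condition is taken outside a polar set. *)
definition admissible_pair ::
  "real \<Rightarrow> path measure set \<Rightarrow> real \<Rightarrow> field \<Rightarrow> field \<Rightarrow> bool" where
  "admissible_pair T PP p l r \<longleftrightarrow>
     (\<forall>x. quasi_surely T PP (\<lambda>\<omega>.
        continuous_on {0..T} (\<lambda>t. r t \<omega> x) \<and> continuous_on {0..T} (\<lambda>t. l t \<omega> x))) \<and>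
     quasi_surely T PP (\<lambda>\<omega>. \<forall>t\<in>{0..T}.
        strict_mono (r t \<omega>) \<and> strict_mono (l t \<omega>) \<and> (\<forall>x. r t \<omega> x > l t \<omega> x)) \<and>
     quasi_surely T PP (\<lambda>\<omega>. \<forall>t\<in>{0..T}. 0 \<in> range (r t \<omega>) \<and> 0 \<in> range (l t \<omega>)) \<and>
     inv0 r \<in> S_G T PP p \<and> inv0 l \<in> S_G T PP p \<and>
     (\<exists>\<delta>>0. quasi_surely T PP (\<lambda>\<omega>. \<forall>t\<in>{0..T}. inv0 l t \<omega> - inv0 r t \<omega> \<ge> \<delta>))"

definition admissible_coefficients ::
  "real \<Rightarrow> path measure set \<Rightarrow> real \<Rightarrow> field \<Rightarrow> field \<Rightarrow> field \<Rightarrow> bool" where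
  "admissible_coefficients T PP p f h g \<longleftrightarrow>
     (\<forall>x. (\<lambda>t \<omega>. f t \<omega> x) \<in> M_G T PP p \<and> (\<lambda>t \<omega>. h t \<omega> x) \<in> M_G T PP p \<and>
          (\<lambda>t \<omega>. g t \<omega> x) \<in> H_G T PP p) \<and>
     (\<exists>L>0. \<forall>t\<in>{0..T}. \<forall>\<omega>\<in>Omega T. \<forall>x x'.
        \<bar>f t \<omega> x - f t \<omega> x'\<bar> + \<bar>g t \<omega> x - g t \<omega> x'\<bar> + \<bar>h t \<omega> x - h t \<omega> x'\<bar> \<le> L * \<bar>x - x'\<bar>)"

(* Lebesgue-Stieltjes measure of an increasing continuous path a on [0,T] with a(0-) = 0:
   it has an atom of size a(0) at 0. *)
definition stieltjes_measure :: "real \<Rightarrow> (real \<Rightarrow> real) \<Rightarrow> real measure" where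
  "stieltjes_measure T a = interval_measure (\<lambda>t. if t < 0 then 0 else a (min t T))"

(* A^l and A^r are increasing on [0,T] with A^l(0-) = A^r(0-) = 0, so that their values at 0 are
   nonnegative. *)
definition constraining_processes ::
  "real \<Rightarrow> path measure set \<Rightarrow> real \<Rightarrow> field \<Rightarrow> field \<Rightarrow>
   process \<Rightarrow> process \<Rightarrow> process \<Rightarrow> process \<Rightarrow> bool" where
  "constraining_processes T PP p l r X A Al Ar \<longleftrightarrow>
     Al \<in> M_I T PP \<inter> S_G T PP p \<and> Ar \<in> M_I T PP \<inter> S_G T PP p \<and>
     quasi_surely T PP (\<lambda>\<omega>. 0 \<le> Al 0 \<omega> \<and> 0 \<le> Ar 0 \<omega> \<and> (\<forall>t\<in>{0..T}. A t \<omega> = Ar t \<omega> - Al t \<omega>)) \<and>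
     quasi_surely T PP (\<lambda>\<omega>.
       has_bochner_integral (stieltjes_measure T (\<lambda>s. Al s \<omega>))
         (\<lambda>s. indicator {0..T} s * l s \<omega> (X s \<omega>)) 0 \<and>
       has_bochner_integral (stieltjes_measure T (\<lambda>s. Ar s \<omega>))
         (\<lambda>s. indicator {0..T} s * r s \<omega> (X s \<omega>)) 0)"

definition compose :: "field \<Rightarrow> process \<Rightarrow> process" where
  "compose f X t \<omega> = f t \<omega> (X t \<omega>)"

(* The memberships of f(s,X_s), h(s,X_s) and g(s,X_s) say that the integrands lie in the domains of
   the integrals; for admissible coefficients they follow from X being in S_G^p. *)
definition solution ::
  "real \<Rightarrow> path measure set \<Rightarrow> real \<Rightarrow> process \<Rightarrow>
   real \<Rightarrow> field \<Rightarrow> field \<Rightarrow> field \<Rightarrow> field \<Rightarrow> field \<Rightarrow> process \<Rightarrow> process \<Rightarrow> bool" where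
  "solution T PP p Q x0 f h g l r X A \<longleftrightarrow>
     X \<in> S_G T PP p \<and> A \<in> S_G T PP p \<inter> M_BV T PP \<and>
     compose f X \<in> M_G T PP p \<and> compose h X \<in> M_G T PP p \<and> compose g X \<in> H_G T PP p \<and>
     quasi_surely T PP (\<lambda>\<omega>. \<forall>t\<in>{0..T}.
        X t \<omega> = x0 + dt_integral (compose f X) t \<omega> + dQ_integral T PP p Q (compose h X) t \<omega>
                + dB_integral T PP p (compose g X) t \<omega> + A t \<omega>) \<and>
     quasi_surely T PP (\<lambda>\<omega>. \<forall>t\<in>{0..T}. l t \<omega> (X t \<omega>) \<le> 0 \<and> 0 \<le> r t \<omega> (X t \<omega>)) \<and>
     (\<exists>Al Ar. constraining_processes T PP p l r X A Al Ar)"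

definition lower_Lipschitz_pair ::
  "real \<Rightarrow> path measure set \<Rightarrow> real \<Rightarrow> field \<Rightarrow> field \<Rightarrow> bool" where
  "lower_Lipschitz_pair T PP c l r \<longleftrightarrow>
     quasi_surely T PP (\<lambda>\<omega>. \<forall>t\<in>{0..T}. \<forall>x y.
       c * \<bar>x - y\<bar> \<le> max \<bar>r t \<omega> x - r t \<omega> y\<bar> \<bar>l t \<omega> x - l t \<omega> y\<bar>)"

definition bounded_process :: "real \<Rightarrow> path measure set \<Rightarrow> process \<Rightarrow> bool" where
  "bounded_process T PP \<eta> \<longleftrightarrow>
     (\<exists>K. quasi_surely T PP (\<lambda>\<omega>. \<forall>t\<in>{0..T}. \<bar>\<eta> t \<omega>\<bar> \<le> K))"

definition X_hat :: "real \<Rightarrow> path measure set \<Rightarrow> real \<Rightarrow> process \<Rightarrow>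
   (nat \<Rightarrow> field) \<Rightarrow> (nat \<Rightarrow> field) \<Rightarrow> (nat \<Rightarrow> process) \<Rightarrow> process" where
  "X_hat T PP p Q f h X t \<omega> =
     dt_integral (\<lambda>s \<omega>. f 2 s \<omega> (X 2 s \<omega>) - f 1 s \<omega> (X 1 s \<omega>)) t \<omega> +
     dQ_integral T PP p Q (\<lambda>s \<omega>. h 2 s \<omega> (X 2 s \<omega>) - h 1 s \<omega> (X 1 s \<omega>)) t \<omega>"

end

theory Submission
  imports Defs
begin

text \<open>
Since \<open>g\<close> does not depend on the state, the stochastic integrals of the two equations against \<open>B\<close> are
integrals of the same process and cancel in \<open>X\<^sup>2 - X\<^sup>1\<close>. What remains is, outside a polar set, an
identity between continuous functions of time,
\<open>X\<^sup>2 - X\<^sup>1 = Z - a - b\<close> with \<open>Z\<^sub>t = x\<^sup>2 - x\<^sup>1 + X_hat\<^sub>t\<close>, \<open>a = A\<^sup>2\<^sup>l - A\<^sup>1\<^sup>l\<close> and \<open>b = A\<^sup>1\<^sup>r - A\<^sup>2\<^sup>r\<close>,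
and the comparison is a statement about single paths.

On a path, \<open>X\<^sup>1 \<le> X\<^sup>2\<close>: while \<open>X\<^sup>1 > X\<^sup>2\<close>, the path \<open>X\<^sup>1\<close> is off the lower barrier and \<open>X\<^sup>2\<close> is off
the upper one, so the reflections can only decrease \<open>X\<^sup>1 - X\<^sup>2\<close>, and the drift increases it at most at a
rate proportional to its maximum, which is impossible on a short interval
(\<open>reflected_comparison\<close>). The order of the paths and the monotonicity of one of the two drifts make \<open>Z\<close>
nondecreasing. As \<open>0 \<le> X\<^sup>2 - X\<^sup>1 = Z - a - b\<close>, all four inequalities follow from \<open>a \<ge> 0\<close> and \<open>b \<ge> 0\<close>.
If \<open>a\<close> were negative at some time, then at the last growth time of \<open>A\<^sup>1\<^sup>l\<close> before it both paths would be
at the upper barrier, hence \<open>b = Z - a > 0\<close> there; at the last growth time of \<open>A\<^sup>1\<^sup>r\<close> before that, \<open>X\<^sup>1\<close>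
would be at the lower barrier and \<open>a\<close> at least as negative; and so on. Such a descent between two separated
barriers is impossible by compactness (\<open>upper_push_monotone\<close>). The claim for \<open>b\<close> is the mirror image.

To work on single paths, the integral against the quadratic variation, which is defined as a limit in norm,
has to be identified with a pathwise one. The quadratic variation satisfies
\<open>0 \<le> Q\<^sub>t - Q\<^sub>s \<le> shigh\<^sup>2 (t - s)\<close> quasi-surely (\<open>quadratic_variation_Lipschitz\<close>): comparing the viscosity
solution with explicit polynomials bounds the second and fourth moments of the increments of \<open>B\<close>, and then
the positive part of \<open>\<Sum> (\<Delta>B)\<^sup>2 - shigh\<^sup>2 \<Delta>t\<close> tends to zero in mean square. Hence \<open>Q\<close> has on
quasi every path a bounded density \<open>q\<close>, and \<open>\<integral> \<eta> q ds\<close> is the integral of \<open>\<eta>\<close> against \<open>Q\<close>, for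
simple \<open>\<eta>\<close> by inspection and in general by Jensen's inequality (\<open>dQ_integral_pathwise\<close>). Membership in the
completed process spaces becomes continuity or integrability of the paths by a Borel-Cantelli argument for the
upper expectation.
\<close>

section \<open>Deterministic comparison for the two-sided Skorokhod problem\<close>

text \<open>
  The growth set of an increasing path without reference to its Stieltjes measure. The first clause
  accounts for the atom at time 0, that is, for the jump from \<open>a(0-) = 0\<close> to \<open>a(0)\<close>.
\<close>
definition grows_only_on :: "real \<Rightarrow> (real \<Rightarrow> real) \<Rightarrow> real set \<Rightarrow> bool" where
  "grows_only_on T a S \<longleftrightarrow>
     (\<forall>t\<in>{0..T}. {0..t} \<inter> S = {} \<longrightarrow> a t = 0) \<and>
     (\<forall>s t. 0 \<le> s \<longrightarrow> s \<le> t \<longrightarrow> t \<le> T \<longrightarrow> {s<..t} \<inter> S = {} \<longrightarrow> a t = a s)"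

lemma grows_only_onD:
  assumes "grows_only_on T a S"
  shows "t \<in> {0..T} \<Longrightarrow> {0..t} \<inter> S = {} \<Longrightarrow> a t = 0"
    and "0 \<le> s \<Longrightarrow> s \<le> t \<Longrightarrow> t \<le> T \<Longrightarrow> {s<..t} \<inter> S = {} \<Longrightarrow> a t = a s"
  using assms unfolding grows_only_on_def by blast+

text \<open>
  The last visit to \<open>S\<close> before \<open>t\<close> exists by compactness, and \<open>a\<close> is constant afterwards. If there were no
  visit at all, \<open>a t\<close> would vanish, the atom at time 0 included.
\<close>
lemma last_growth_time:
  assumes a: "grows_only_on T a S" and S: "closed S" and t: "t \<in> {0..T}" and pos: "a t \<noteq> 0"
  obtains u where "u \<in> S" "0 \<le> u" "u \<le> t" "a u = a t"
proof -
  let ?K = "{0..t} \<inter> S"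
  have ne: "?K \<noteq> {}" using a t pos unfolding grows_only_on_def by blast
  have "compact ?K" using S by (intro compact_Int_closed) auto
  then obtain u where u: "u \<in> ?K" and max: "\<And>v. v \<in> ?K \<Longrightarrow> v \<le> u"
    using compact_attains_sup[OF _ ne] by blast
  have "{u<..t} \<inter> S = {}"
  proof (rule ccontr)
    assume "{u<..t} \<inter> S \<noteq> {}"
    then obtain v where "v \<in> S" "u < v" "v \<le> t" by auto
    then show False using max[of v] u by auto
  qed
  then have "a t = a u" using a u t unfolding grows_only_on_def by auto
  then show ?thesis using u that by auto
qed

lemma closed_contact_set:
  fixes X b :: "real \<Rightarrow> real"
  assumes "continuous_on {0..T} X" "continuous_on {0..T} b"
  shows "closed {t \<in> {0..T}. X t = b t}"
proof -
  have "{t \<in> {0..T}. X t = b t} = {0..T} \<inter> (\<lambda>t. X t - b t) -` {0}" by auto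
  moreover have "closed ({0..T} \<inter> (\<lambda>t. X t - b t) -` {0})"
    by (intro continuous_closed_preimage continuous_intros assms closed_atLeastAtMost)
  ultimately show ?thesis by simp
qed

text \<open>
  The descent described at the beginning: \<open>upper\<close> goes back from a time at which \<open>a = Al2 - Al1\<close> is at
  most \<open>e < 0\<close> to such a time at which \<open>X1\<close> is at the upper barrier, and \<open>lower\<close> goes back from there, strictly,
  by way of the lower barrier. The first time in the closed set \<open>K\<close> cannot be preceded in this way.
\<close>
lemma upper_push_monotone:
  assumes cont: "continuous_on {0..T} X1" "continuous_on {0..T} \<alpha>" "continuous_on {0..T} \<beta>"
      "continuous_on {0..T} Al1" "continuous_on {0..T} Al2"
    and mono: "mono_on {0..T} Al2" "mono_on {0..T} Ar2" "mono_on {0..T} Z"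
    and nn: "0 \<le> Al2 0" "0 \<le> Ar2 0" "0 \<le> Z 0"
    and gap: "\<And>t. t \<in> {0..T} \<Longrightarrow> \<alpha> t < \<beta> t"
    and order: "\<And>t. t \<in> {0..T} \<Longrightarrow> X1 t \<le> X2 t \<and> X2 t \<le> \<beta> t"
    and growl: "grows_only_on T Al1 {t \<in> {0..T}. X1 t = \<beta> t}"
    and growr: "grows_only_on T Ar1 {t \<in> {0..T}. X1 t = \<alpha> t}"
    and diff: "\<And>t. t \<in> {0..T} \<Longrightarrow> X2 t - X1 t = Z t - (Ar1 t - Ar2 t) - (Al2 t - Al1 t)"
    and t: "t \<in> {0..T}"
  shows "Al1 t \<le> Al2 t"
proof (rule ccontr)
  assume "\<not> Al1 t \<le> Al2 t"
  define a where "a s = Al2 s - Al1 s" for s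
  define b where "b s = Ar1 s - Ar2 s" for s
  define e where "e = a t"
  have e: "e < 0" using \<open>\<not> _\<close> by (simp add: e_def a_def)
  have nn': "0 \<le> Al2 s" "0 \<le> Ar2 s" "0 \<le> Z s" if "s \<in> {0..T}" for s
    using mono_onD[OF mono(1), of 0 s] mono_onD[OF mono(2), of 0 s] mono_onD[OF mono(3), of 0 s] nn that
    by auto
  have upper: "\<exists>u. u \<in> {0..T} \<and> u \<le> s \<and> X1 u = \<beta> u \<and> a u \<le> e" if s: "s \<in> {0..T}" "a s \<le> e" for s
  proof -
    have "Al1 s \<noteq> 0" using s nn'(1)[of s] e by (auto simp: a_def)
    then obtain u where u: "u \<in> {t \<in> {0..T}. X1 t = \<beta> t}" "0 \<le> u" "u \<le> s" "Al1 u = Al1 s"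
      using last_growth_time[OF growl closed_contact_set[OF cont(1,3)] s(1)] by blast
    have "Al2 u \<le> Al2 s" using mono_onD[OF mono(1), of u s] u s by auto
    then show ?thesis using u s by (intro exI[of _ u]) (auto simp: a_def)
  qed
  have lower: "\<exists>v. v \<in> {0..T} \<and> v < u \<and> a v \<le> e" if u: "u \<in> {0..T}" "X1 u = \<beta> u" "a u \<le> e" for u
  proof -
    have D0: "X2 u = X1 u" using order[OF u(1)] u(2) by simp
    then have bZ: "b u = Z u - a u" using diff[OF u(1)] by (simp add: a_def b_def)
    then have "Ar1 u \<noteq> 0" using nn'[OF u(1)] u(3) e by (auto simp: b_def)
    then obtain v where v: "v \<in> {t \<in> {0..T}. X1 t = \<alpha> t}" "0 \<le> v" "v \<le> u" "Ar1 v = Ar1 u"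
      using last_growth_time[OF growr closed_contact_set[OF cont(1,2)] u(1)] by blast
    have "v \<noteq> u" using v u gap[of u] by auto
    have "Ar2 v \<le> Ar2 u" using mono_onD[OF mono(2), of v u] v u by auto
    then have "b u \<le> b v" using v by (simp add: b_def)
    moreover have "Z v \<le> Z u" using mono_onD[OF mono(3), of v u] v u by auto
    moreover have "a v \<le> Z v - b v" using diff[of v] order[of v] v by (auto simp: a_def b_def)
    ultimately have "a v \<le> a u" using bZ by simp
    then show ?thesis using v u \<open>v \<noteq> u\<close> by (intro exI[of _ v]) auto
  qed
  define K where "K = {u \<in> {0..T}. X1 u = \<beta> u} \<inter> ({0..T} \<inter> a -` {..e})"
  have "continuous_on {0..T} a" unfolding a_def by (intro continuous_intros cont)
  then have "closed ({0..T} \<inter> a -` {..e})"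
    by (intro continuous_closed_preimage) auto
  then have "closed K" unfolding K_def using closed_contact_set[OF cont(1,3)] by blast
  moreover have "K \<subseteq> {0..T}" by (auto simp: K_def)
  ultimately have "compact K" by (metis bounded_closed_interval bounded_subset compact_eq_bounded_closed)
  moreover have "K \<noteq> {}" using upper[OF t] by (auto simp: K_def e_def)
  ultimately obtain u where u: "u \<in> K" and min: "\<And>v. v \<in> K \<Longrightarrow> u \<le> v"
    using compact_attains_inf[of K] by blast
  obtain v where v: "v \<in> {0..T}" "v < u" "a v \<le> e" using lower[of u] u by (auto simp: K_def)
  obtain w where "w \<in> {0..T}" "w \<le> v" "X1 w = \<beta> w" "a w \<le> e" using upper[OF v(1,3)] by auto
  then have "w \<in> K" by (auto simp: K_def)
  then show False using min[of w] v \<open>w \<le> v\<close> by simp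
qed

text \<open>
  The hypothesis \<open>drift\<close> says that \<open>Z\<close> cannot decrease faster than \<open>C\<close> times the excess of \<open>X1\<close> over \<open>X2\<close>.
  After the last time \<open>s\<close> with \<open>X1 \<le> X2\<close>, the pushes that raise \<open>X1\<close> or lower \<open>X2\<close> are switched off, so the
  maximum \<open>M\<close> of the excess over \<open>[s, r]\<close> is at most \<open>C (r - s) M\<close>, which is less than \<open>M\<close> if \<open>r\<close> is close
  to \<open>s\<close>.
\<close>
lemma reflected_comparison:
  assumes cont: "continuous_on {0..T} X1" "continuous_on {0..T} X2"
      "continuous_on {0..T} \<alpha>" "continuous_on {0..T} \<beta>"
    and mono: "mono_on {0..T} Al1" "mono_on {0..T} Ar2"
    and nn: "0 \<le> Al1 0" "0 \<le> Ar2 0" "0 \<le> Z 0"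
    and range1: "\<And>t. t \<in> {0..T} \<Longrightarrow> \<alpha> t \<le> X1 t \<and> X1 t \<le> \<beta> t"
    and range2: "\<And>t. t \<in> {0..T} \<Longrightarrow> \<alpha> t \<le> X2 t \<and> X2 t \<le> \<beta> t"
    and growl: "grows_only_on T Al2 {t \<in> {0..T}. X2 t = \<beta> t}"
    and growr: "grows_only_on T Ar1 {t \<in> {0..T}. X1 t = \<alpha> t}"
    and diff: "\<And>t. t \<in> {0..T} \<Longrightarrow> X2 t - X1 t = Z t - (Ar1 t - Ar2 t) - (Al2 t - Al1 t)"
    and C: "C \<ge> 0"
    and drift: "\<And>s t M. 0 \<le> s \<Longrightarrow> s \<le> t \<Longrightarrow> t \<le> T \<Longrightarrow> 0 \<le> M \<Longrightarrow>
        (\<And>u. u \<in> {s..t} \<Longrightarrow> X1 u - X2 u \<le> M) \<Longrightarrow> Z s - Z t \<le> C * M * (t - s)"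
    and t: "t \<in> {0..T}"
  shows "X1 t \<le> X2 t"
proof (rule ccontr)
  assume neg: "\<not> X1 t \<le> X2 t"
  have t0: "0 \<le> t" "t \<le> T" using t by auto
  have start: "X1 0 \<le> X2 0"
  proof (rule ccontr)
    assume bad: "\<not> X1 0 \<le> X2 0"
    moreover have "0 \<in> {0..T}" using t by auto
    ultimately have "X1 0 \<noteq> \<alpha> 0" "X2 0 \<noteq> \<beta> 0" using range1[of 0] range2[of 0] by auto
    then have "Ar1 0 = 0" "Al2 0 = 0" using t by (auto intro!: grows_only_onD(1)[OF growl] grows_only_onD(1)[OF growr])
    then show False using diff[of 0] nn bad t by auto
  qed
  define D where "D u = X1 u - X2 u" for u
  have contD: "continuous_on {0..T} D" unfolding D_def by (intro continuous_intros cont)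
  define K where "K = {0..t} \<inter> D -` {..0}"
  have "continuous_on {0..t} D" using contD by (rule continuous_on_subset) (use t in auto)
  then have "closed K"
    unfolding K_def by (intro continuous_closed_preimage) auto
  moreover have "K \<subseteq> {0..t}" by (auto simp: K_def)
  ultimately have "compact K" by (metis bounded_closed_interval bounded_subset compact_eq_bounded_closed)
  moreover have "0 \<in> K" using start t by (auto simp: K_def D_def)
  ultimately obtain s where s: "s \<in> K" and smax: "\<And>v. v \<in> K \<Longrightarrow> v \<le> s"
    using compact_attains_sup[of K] by blast
  have s0: "0 \<le> s" "s < t" "D s \<le> 0" using s neg by (auto simp: K_def D_def order_le_less)
  have pos: "D u > 0" if "u \<in> {s<..t}" for u
  proof (rule ccontr)
    assume "\<not> D u > 0"
    then have "u \<in> K" using that s0 by (auto simp: K_def)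
    then show False using smax[of u] that by auto
  qed
  \<comment> \<open>The length of the interval is chosen such that \<open>C (r - s) < 1\<close>.\<close>
  define r where "r = min t (s + 1 / (2 * (C + 1)))"
  have r: "s < r" "r \<le> t" using s0 C by (auto simp: r_def)
  have "r - s \<le> 1 / (2 * (C + 1))" by (auto simp: r_def)
  then have "(C + 1) * (r - s) \<le> (C + 1) * (1 / (2 * (C + 1)))" using C by (intro mult_left_mono) auto
  also have "\<dots> = 1 / 2" using C by (simp add: field_simps)
  finally have "C * (r - s) + (r - s) \<le> 1 / 2" by (simp add: algebra_simps)
  then have Cr: "C * (r - s) < 1" using r by linarith
  have "compact {s..r}" "{s..r} \<noteq> {}" using r by auto
  moreover have "continuous_on {s..r} D" using contD by (rule continuous_on_subset) (use s0 r t0 in auto)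
  ultimately obtain m where m: "m \<in> {s..r}" and mmax: "\<And>v. v \<in> {s..r} \<Longrightarrow> D v \<le> D m"
    using continuous_attains_sup[of "{s..r}" D] by auto
  define M where "M = D m"
  have "D r > 0" using pos[of r] r by auto
  then have M: "M > 0" using mmax[of r] r by (auto simp: M_def)
  then have ms: "s < m" using m s0 by (auto simp: M_def order_le_less)
  have sub: "{s<..m} \<subseteq> {s<..t}" using m r by auto
  have mT: "0 \<le> s" "s \<le> m" "m \<le> T" using m r s0 t0 by auto
  have "Ar1 m = Ar1 s"
  proof -
    have "{s<..m} \<inter> {t \<in> {0..T}. X1 t = \<alpha> t} = {}"
    proof (rule ccontr)
      assume "{s<..m} \<inter> {t \<in> {0..T}. X1 t = \<alpha> t} \<noteq> {}"
      then obtain u where u: "u \<in> {s<..m}" "u \<in> {0..T}" "X1 u = \<alpha> u" by blast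
      then show False using pos[of u] range2[of u] sub by (auto simp: D_def)
    qed
    with mT show ?thesis by (intro grows_only_onD(2)[OF growr])
  qed
  moreover have "Al2 m = Al2 s"
  proof -
    have "{s<..m} \<inter> {t \<in> {0..T}. X2 t = \<beta> t} = {}"
    proof (rule ccontr)
      assume "{s<..m} \<inter> {t \<in> {0..T}. X2 t = \<beta> t} \<noteq> {}"
      then obtain u where u: "u \<in> {s<..m}" "u \<in> {0..T}" "X2 u = \<beta> u" by blast
      then show False using pos[of u] range1[of u] sub by (auto simp: D_def)
    qed
    with mT show ?thesis by (intro grows_only_onD(2)[OF growl])
  qed
  moreover have "Al1 s \<le> Al1 m" "Ar2 s \<le> Ar2 m"
    using mono_onD[OF mono(1), of s m] mono_onD[OF mono(2), of s m] ms m r s0 t0 by auto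
  ultimately have "D m - D s \<le> Z s - Z m"
    using diff[of m] diff[of s] ms m r s0 t0 by (auto simp: D_def)
  also have "\<dots> \<le> C * M * (m - s)"
    using ms m r s0 t0 M mmax by (intro drift) (auto simp: D_def M_def)
  also have "\<dots> \<le> C * M * (r - s)" using m M C by (intro mult_left_mono) auto
  also have "\<dots> = (C * (r - s)) * M" by simp
  also have "\<dots> < 1 * M" using Cr M by (intro mult_strict_right_mono) auto
  finally show False using s0 by (simp add: M_def)
qed

lemma two_sided_Skorokhod_comparison:
  assumes cont: "continuous_on {0..T} X1" "continuous_on {0..T} X2"
      "continuous_on {0..T} \<alpha>" "continuous_on {0..T} \<beta>"
      "continuous_on {0..T} Al1" "continuous_on {0..T} Al2"
      "continuous_on {0..T} Ar1" "continuous_on {0..T} Ar2"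
    and mono: "mono_on {0..T} Al1" "mono_on {0..T} Al2" "mono_on {0..T} Ar1" "mono_on {0..T} Ar2"
    and nn: "0 \<le> Al1 0" "0 \<le> Al2 0" "0 \<le> Ar1 0" "0 \<le> Ar2 0" "0 \<le> Z 0"
    and gap: "\<And>t. t \<in> {0..T} \<Longrightarrow> \<alpha> t < \<beta> t"
    and range1: "\<And>t. t \<in> {0..T} \<Longrightarrow> \<alpha> t \<le> X1 t \<and> X1 t \<le> \<beta> t"
    and range2: "\<And>t. t \<in> {0..T} \<Longrightarrow> \<alpha> t \<le> X2 t \<and> X2 t \<le> \<beta> t"
    and growl1: "grows_only_on T Al1 {t \<in> {0..T}. X1 t = \<beta> t}"
    and growl2: "grows_only_on T Al2 {t \<in> {0..T}. X2 t = \<beta> t}"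
    and growr1: "grows_only_on T Ar1 {t \<in> {0..T}. X1 t = \<alpha> t}"
    and growr2: "grows_only_on T Ar2 {t \<in> {0..T}. X2 t = \<alpha> t}"
    and diff: "\<And>t. t \<in> {0..T} \<Longrightarrow> X2 t - X1 t = Z t - (Ar1 t - Ar2 t) - (Al2 t - Al1 t)"
    and C: "C \<ge> 0"
    and drift: "\<And>s t M. 0 \<le> s \<Longrightarrow> s \<le> t \<Longrightarrow> t \<le> T \<Longrightarrow> 0 \<le> M \<Longrightarrow>
        (\<And>u. u \<in> {s..t} \<Longrightarrow> X1 u - X2 u \<le> M) \<Longrightarrow> Z s - Z t \<le> C * M * (t - s)"
    and t: "t \<in> {0..T}"
  shows "Al1 t \<le> Al2 t \<and> Al2 t \<le> Al1 t + Z t \<and> Ar2 t \<le> Ar1 t \<and> Ar1 t \<le> Ar2 t + Z t"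
proof -
  have order: "X1 s \<le> X2 s" if "s \<in> {0..T}" for s
    by (rule reflected_comparison[OF cont(1-4) mono(1,4) nn(1,4,5) range1 range2 growl2 growr1 diff C drift that])
  have monoZ: "mono_on {0..T} Z"
  proof (rule mono_onI)
    fix s t assume "s \<in> {0..T}" "t \<in> {0..T}" "s \<le> t"
    then show "Z s \<le> Z t" using drift[of s t 0] order by auto
  qed
  have l: "Al1 t \<le> Al2 t"
    by (rule upper_push_monotone[OF cont(1,3,4,5,6) mono(2,4) monoZ nn(2,4,5) gap _ growl1 growr1 diff t])
       (use order range2 in auto)
  \<comment> \<open>The lower barrier is handled by the reflection x to -x, which swaps the two equations.\<close>
  have neg: "{t \<in> {0..T}. - X2 t = - \<alpha> t} = {t \<in> {0..T}. X2 t = \<alpha> t}"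
    "{t \<in> {0..T}. - X2 t = - \<beta> t} = {t \<in> {0..T}. X2 t = \<beta> t}" by auto
  have r: "Ar2 t \<le> Ar1 t"
    by (rule upper_push_monotone[of T "\<lambda>t. - X2 t" "\<lambda>t. - \<beta> t" "\<lambda>t. - \<alpha> t" Ar2 Ar1 Al1 Z "\<lambda>t. - X1 t" Al2])
       (use cont mono nn monoZ gap order range1 growl2 growr2 diff t in
          \<open>auto simp: neg intro!: continuous_intros\<close>)
  have "X1 t \<le> X2 t" using order t by blast
  then show ?thesis using l r diff[OF t] by auto
qed

section \<open>Upper integrals\<close>

text \<open>
  Common generalisation of the upper integral of one measure (on the time axis) and of the upper expectation
  of a family of measures (on the path space), so that both share one calculus.
\<close>
definition upper_sup :: "'a measure \<Rightarrow> 'a measure set \<Rightarrow> ('a \<Rightarrow> ennreal) \<Rightarrow> ennreal" where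
  "upper_sup S PP X = (INF Y\<in>{Y \<in> borel_measurable S. \<forall>z\<in>space S. X z \<le> Y z}.
     SUP P\<in>PP. \<integral>\<^sup>+z. Y z \<partial>P)"

lemma upper_integral_eq_upper_sup: "upper_integral M X = upper_sup M {M} X"
  by (simp add: upper_integral_def upper_sup_def)

lemma space_path_space [simp]: "space (path_space T) = Omega T"
  by (simp add: path_space_def space_restrict_space)

lemma upper_expectation_eq_upper_sup: "upper_expectation T PP X = upper_sup (path_space T) PP X"
  by (simp add: upper_expectation_def upper_sup_def)

lemma upper_sup_le:
  assumes "Y \<in> borel_measurable S" "\<And>z. z \<in> space S \<Longrightarrow> X z \<le> Y z"
  shows "upper_sup S PP X \<le> (SUP P\<in>PP. \<integral>\<^sup>+z. Y z \<partial>P)"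
  unfolding upper_sup_def by (rule INF_lower) (use assms in auto)

lemma upper_sup_greatest:
  assumes "\<And>Y. Y \<in> borel_measurable S \<Longrightarrow> (\<And>z. z \<in> space S \<Longrightarrow> X z \<le> Y z) \<Longrightarrow>
     c \<le> (SUP P\<in>PP. \<integral>\<^sup>+z. Y z \<partial>P)"
  shows "c \<le> upper_sup S PP X"
  unfolding upper_sup_def by (rule INF_greatest) (use assms in auto)

lemma upper_sup_lessD:
  assumes "upper_sup S PP X < c"
  shows "\<exists>Y\<in>borel_measurable S. (\<forall>z\<in>space S. X z \<le> Y z) \<and> (SUP P\<in>PP. \<integral>\<^sup>+z. Y z \<partial>P) < c"
  using assms unfolding upper_sup_def INF_less_iff by auto

lemma borel_measurable_sets_eq:
  assumes "sets P = sets S" "Y \<in> borel_measurable S"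
  shows "Y \<in> borel_measurable P"
  using assms(2) by (simp add: measurable_cong_sets[OF assms(1) refl])

text \<open>
  A measurable majorant of \<open>X'\<close> becomes one of \<open>X\<close> when it is raised to infinity on \<open>N\<close>, which costs
  nothing.
\<close>
lemma upper_sup_mono_off_null:
  assumes sets: "\<And>P. P \<in> PP \<Longrightarrow> sets P = sets S"
    and N: "N \<in> sets S" "\<And>P. P \<in> PP \<Longrightarrow> emeasure P N = 0"
    and le: "\<And>z. z \<in> space S - N \<Longrightarrow> X z \<le> X' z"
  shows "upper_sup S PP X \<le> upper_sup S PP X'"
proof (rule upper_sup_greatest)
  fix Y assume Y: "Y \<in> borel_measurable S" "\<And>z. z \<in> space S \<Longrightarrow> X' z \<le> Y z"
  let ?Y = "\<lambda>z. Y z + top * indicator N z"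
  have Ym: "Y \<in> borel_measurable P" if "P \<in> PP" for P
    by (rule borel_measurable_sets_eq[OF sets[OF that] Y(1)])
  have "(\<integral>\<^sup>+z. ?Y z \<partial>P) = (\<integral>\<^sup>+z. Y z \<partial>P)" if P: "P \<in> PP" for P
    using Ym[OF P] N sets[OF P] P by (subst nn_integral_add) (auto simp: nn_integral_cmult_indicator)
  then have "(SUP P\<in>PP. \<integral>\<^sup>+z. ?Y z \<partial>P) = (SUP P\<in>PP. \<integral>\<^sup>+z. Y z \<partial>P)" by simp
  moreover have "upper_sup S PP X \<le> (SUP P\<in>PP. \<integral>\<^sup>+z. ?Y z \<partial>P)"
  proof (rule upper_sup_le)
    show "?Y \<in> borel_measurable S" using Y N by measurable
    fix z assume "z \<in> space S"
    then show "X z \<le> ?Y z" using le[of z] Y(2)[of z] by (cases "z \<in> N") (auto intro: order_trans)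
  qed
  ultimately show "upper_sup S PP X \<le> (SUP P\<in>PP. \<integral>\<^sup>+z. Y z \<partial>P)" by simp
qed

lemma upper_sup_add:
  assumes sets: "\<And>P. P \<in> PP \<Longrightarrow> sets P = sets S"
  shows "upper_sup S PP (\<lambda>z. X z + X' z) \<le> upper_sup S PP X + upper_sup S PP X'"
proof -
  have "upper_sup S PP (\<lambda>z. X z + X' z) \<le> (SUP P\<in>PP. \<integral>\<^sup>+z. Y z \<partial>P) + (SUP P\<in>PP. \<integral>\<^sup>+z. Y' z \<partial>P)"
    if Y: "Y \<in> borel_measurable S" "\<And>z. z \<in> space S \<Longrightarrow> X z \<le> Y z"
      and Y': "Y' \<in> borel_measurable S" "\<And>z. z \<in> space S \<Longrightarrow> X' z \<le> Y' z" for Y Y'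
  proof -
    have "upper_sup S PP (\<lambda>z. X z + X' z) \<le> (SUP P\<in>PP. \<integral>\<^sup>+z. Y z + Y' z \<partial>P)"
      using Y Y' by (intro upper_sup_le) (auto intro: add_mono)
    also have "\<dots> \<le> (SUP P\<in>PP. \<integral>\<^sup>+z. Y z \<partial>P) + (SUP P\<in>PP. \<integral>\<^sup>+z. Y' z \<partial>P)"
    proof (rule SUP_least)
      fix P assume P: "P \<in> PP"
      have "Y \<in> borel_measurable P" "Y' \<in> borel_measurable P"
        by (rule borel_measurable_sets_eq[OF sets[OF P] Y(1)], rule borel_measurable_sets_eq[OF sets[OF P] Y'(1)])
      then have "(\<integral>\<^sup>+z. Y z + Y' z \<partial>P) = (\<integral>\<^sup>+z. Y z \<partial>P) + (\<integral>\<^sup>+z. Y' z \<partial>P)" by (rule nn_integral_add)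
      also have "\<dots> \<le> (SUP P\<in>PP. \<integral>\<^sup>+z. Y z \<partial>P) + (SUP P\<in>PP. \<integral>\<^sup>+z. Y' z \<partial>P)"
        using P by (intro add_mono SUP_upper)
      finally show "(\<integral>\<^sup>+z. Y z + Y' z \<partial>P) \<le> (SUP P\<in>PP. \<integral>\<^sup>+z. Y z \<partial>P) + (SUP P\<in>PP. \<integral>\<^sup>+z. Y' z \<partial>P)" .
    qed
    finally show ?thesis .
  qed
  note step = this
  show ?thesis
  proof (rule ennreal_le_epsilon)
    fix e :: real assume fin: "upper_sup S PP X + upper_sup S PP X' < top" and e: "0 < e"
    let ?e = "ennreal (e / 2)"
    have "upper_sup S PP X < upper_sup S PP X + ?e" "upper_sup S PP X' < upper_sup S PP X' + ?e"
      using fin e by (auto simp: ennreal_add_left_cancel_less less_top)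
    note lt = this
    obtain Y where Y: "Y \<in> borel_measurable S" "\<And>z. z \<in> space S \<Longrightarrow> X z \<le> Y z"
        "(SUP P\<in>PP. \<integral>\<^sup>+z. Y z \<partial>P) < upper_sup S PP X + ?e"
      using upper_sup_lessD[OF lt(1)] by blast
    obtain Y' where Y': "Y' \<in> borel_measurable S" "\<And>z. z \<in> space S \<Longrightarrow> X' z \<le> Y' z"
        "(SUP P\<in>PP. \<integral>\<^sup>+z. Y' z \<partial>P) < upper_sup S PP X' + ?e"
      using upper_sup_lessD[OF lt(2)] by blast
    have "upper_sup S PP (\<lambda>z. X z + X' z) \<le> (upper_sup S PP X + ?e) + (upper_sup S PP X' + ?e)"
      using step[OF Y(1,2) Y'(1,2)] Y(3) Y'(3) by (blast intro: order_trans add_mono less_imp_le)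
    also have "\<dots> = upper_sup S PP X + upper_sup S PP X' + (?e + ?e)" by (simp add: ac_simps)
    also have "?e + ?e = ennreal e" using e by (simp add: ennreal_plus[symmetric] del: ennreal_plus)
    finally show "upper_sup S PP (\<lambda>z. X z + X' z) \<le> upper_sup S PP X + upper_sup S PP X' + ennreal e" .
  qed
qed

lemma upper_sup_cmult:
  assumes sets: "\<And>P. P \<in> PP \<Longrightarrow> sets P = sets S" and c: "c \<noteq> 0" "c \<noteq> top"
  shows "upper_sup S PP (\<lambda>z. c * X z) \<le> c * upper_sup S PP X"
proof -
  have cc: "c * inverse c = 1"
    using ennreal_divide_self[of c] c by (simp add: divide_ennreal_def less_top)
  have "inverse c * upper_sup S PP (\<lambda>z. c * X z) \<le> upper_sup S PP X"
  proof (rule upper_sup_greatest)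
    fix Y assume Y: "Y \<in> borel_measurable S" "\<And>z. z \<in> space S \<Longrightarrow> X z \<le> Y z"
    have "upper_sup S PP (\<lambda>z. c * X z) \<le> (SUP P\<in>PP. \<integral>\<^sup>+z. c * Y z \<partial>P)"
      using Y by (intro upper_sup_le) (auto intro: mult_left_mono)
    also have "\<dots> = c * (SUP P\<in>PP. \<integral>\<^sup>+z. Y z \<partial>P)"
      unfolding SUP_mult_left_ennreal
      by (intro SUP_cong refl nn_integral_cmult borel_measurable_sets_eq[OF sets Y(1)])
    finally have "inverse c * upper_sup S PP (\<lambda>z. c * X z) \<le> inverse c * (c * (SUP P\<in>PP. \<integral>\<^sup>+z. Y z \<partial>P))"
      by (rule mult_left_mono) simp
    also have "\<dots> = (SUP P\<in>PP. \<integral>\<^sup>+z. Y z \<partial>P)"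
      using cc by (simp add: mult.assoc[symmetric] mult.commute[of "inverse c"])
    finally show "inverse c * upper_sup S PP (\<lambda>z. c * X z) \<le> (SUP P\<in>PP. \<integral>\<^sup>+z. Y z \<partial>P)" .
  qed
  then have "c * (inverse c * upper_sup S PP (\<lambda>z. c * X z)) \<le> c * upper_sup S PP X"
    by (rule mult_left_mono) simp
  then show ?thesis
    using cc by (simp add: mult.assoc[symmetric])
qed

lemma ennreal_suminf_finite_tendsto_0:
  fixes f :: "nat \<Rightarrow> ennreal"
  assumes "(\<Sum>n. f n) \<noteq> top"
  shows "f \<longlonglongrightarrow> 0"
proof -
  have fin: "f n < top" for n using assms ennreal_suminf_lessD[of f top n] by (simp add: less_top)
  define g where "g n = enn2real (f n)" for n
  have f: "f = (\<lambda>n. ennreal (g n))" using fin by (auto simp: g_def)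
  have "summable g" using assms unfolding f by (intro summable_suminf_not_top) (auto simp: g_def)
  then have "g \<longlonglongrightarrow> 0" by (rule summable_LIMSEQ_zero)
  then show ?thesis unfolding f by (subst ennreal_tendsto_0_iff) (auto simp: g_def)
qed

text \<open>
  Along a subsequence whose upper integrals are summable, the sum of near-optimal measurable majorants has
  finite integral uniformly in the family; its terms therefore tend to zero off the set where it is infinite,
  which is null for every measure of the family at once.
\<close>
lemma upper_sup_Borel_Cantelli:
  assumes sets: "\<And>P. P \<in> PP \<Longrightarrow> sets P = sets S"
    and lim: "(\<lambda>n. upper_sup S PP (X n)) \<longlonglongrightarrow> 0"
  obtains k :: "nat \<Rightarrow> nat" and N where "strict_mono k" "N \<in> sets S" "\<And>P. P \<in> PP \<Longrightarrow> emeasure P N = 0"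
    "\<And>z. z \<in> space S - N \<Longrightarrow> (\<lambda>n. X (k n) z) \<longlonglongrightarrow> 0"
proof -
  let ?e = "\<lambda>n. ennreal ((1/2) ^ n)"
  have "\<exists>k>m. upper_sup S PP (X k) < ?e n" for m n
  proof -
    have "\<forall>\<^sub>F k in sequentially. upper_sup S PP (X k) < ?e n"
      using lim by (rule order_tendstoD) (auto simp: ennreal_zero_less_divide)
    then have "\<forall>\<^sub>F k in sequentially. upper_sup S PP (X k) < ?e n \<and> k > m"
      using eventually_gt_at_top by (rule eventually_conj)
    from eventually_happens'[OF sequentially_bot this] show ?thesis by blast
  qed
  then obtain \<kappa> where \<kappa>: "\<And>m n. \<kappa> m n > m" "\<And>m n. upper_sup S PP (X (\<kappa> m n)) < ?e n" by metis
  define k where "k = rec_nat (\<kappa> 0 0) (\<lambda>n m. \<kappa> m (Suc n))"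
  have k0: "k 0 = \<kappa> 0 0" and kS: "k (Suc n) = \<kappa> (k n) (Suc n)" for n by (auto simp: k_def)
  have sm: "strict_mono k" using \<kappa>(1) by (auto simp: strict_mono_Suc_iff kS)
  have small: "upper_sup S PP (X (k n)) < ?e n" for n
    by (cases n) (simp_all only: k0 kS \<kappa>(2))
  have "\<exists>Y. Y \<in> borel_measurable S \<and> (\<forall>z\<in>space S. X (k n) z \<le> Y z) \<and> (SUP P\<in>PP. \<integral>\<^sup>+z. Y z \<partial>P) < ?e n" for n
    using upper_sup_lessD[OF small[of n]] by blast
  then obtain Y where Y: "\<And>n. Y n \<in> borel_measurable S" "\<And>n z. z \<in> space S \<Longrightarrow> X (k n) z \<le> Y n z"
    "\<And>n. (SUP P\<in>PP. \<integral>\<^sup>+z. Y n z \<partial>P) < ?e n" by metis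
  define N where "N = {z \<in> space S. (\<Sum>n. Y n z) = top}"
  have NS: "N \<in> sets S" unfolding N_def using Y(1) by measurable
  moreover have "emeasure P N = 0" if P: "P \<in> PP" for P
  proof -
    have Ym: "Y n \<in> borel_measurable P" for n
      by (rule borel_measurable_sets_eq[OF sets[OF P] Y(1)])
    have "(\<integral>\<^sup>+z. (\<Sum>n. Y n z) \<partial>P) = (\<Sum>n. \<integral>\<^sup>+z. Y n z \<partial>P)" using Ym by (rule nn_integral_suminf)
    also have "\<dots> \<le> (\<Sum>n. ?e n)"
    proof (rule suminf_le)
      fix n
      have "(\<integral>\<^sup>+z. Y n z \<partial>P) \<le> (SUP P\<in>PP. \<integral>\<^sup>+z. Y n z \<partial>P)" using P by (rule SUP_upper)
      with Y(3)[of n] show "(\<integral>\<^sup>+z. Y n z \<partial>P) \<le> ?e n" by simp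
    qed auto
    also have "\<dots> = ennreal (\<Sum>n. (1/2) ^ n)" by (intro suminf_ennreal_eq) (auto simp: summable_sums)
    also have "\<dots> < top" by simp
    finally have "AE z in P. (\<Sum>n. Y n z) \<noteq> \<infinity>" using Ym by (intro nn_integral_noteq_infinite) auto
    then have "AE z in P. z \<notin> N" by (auto simp: N_def)
    then show ?thesis using NS sets[OF P] by (subst (asm) AE_iff_measurable[of N]) (auto simp: N_def sets_eq_imp_space_eq[OF sets[OF P]])
  qed
  moreover have "(\<lambda>n. X (k n) z) \<longlonglongrightarrow> 0" if z: "z \<in> space S - N" for z
  proof (rule tendsto_sandwich[OF always_eventually always_eventually tendsto_const])
    have "(\<Sum>n. Y n z) \<noteq> top" using z by (auto simp: N_def)
    then show "(\<lambda>n. Y n z) \<longlonglongrightarrow> 0" by (rule ennreal_suminf_finite_tendsto_0)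
    show "\<forall>n. 0 \<le> X (k n) z" by simp
    show "\<forall>n. X (k n) z \<le> Y n z" using z Y(2) by auto
  qed
  ultimately show ?thesis using sm that by blast
qed


section \<open>Quasi-sure calculus\<close>

locale path_probabilities =
  fixes T :: real and PP :: "path measure set"
  assumes T_pos: "T > 0" and PP_nonempty: "PP \<noteq> {}"
    and PP_prob: "\<And>P. P \<in> PP \<Longrightarrow> prob_space P"
    and PP_sets: "\<And>P. P \<in> PP \<Longrightarrow> sets P = sets (path_space T)"
begin

abbreviation qs :: "(path \<Rightarrow> bool) \<Rightarrow> bool" where "qs \<equiv> quasi_surely T PP"
abbreviation UE :: "(path \<Rightarrow> ennreal) \<Rightarrow> ennreal" where "UE \<equiv> upper_expectation T PP"

lemma polar_iff: "polar T PP N \<longleftrightarrow> N \<in> sets (path_space T) \<and> (\<forall>P\<in>PP. emeasure P N = 0)"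
  using PP_nonempty unfolding polar_def by (auto simp: SUP_eq_iff bot_ennreal[symmetric])

lemma qs_all: "(\<And>\<omega>. \<omega> \<in> Omega T \<Longrightarrow> Q \<omega>) \<Longrightarrow> qs Q"
  unfolding quasi_surely_def by (intro exI[of _ "{}"]) (auto simp: polar_iff)

lemma qs_mono: "qs Q \<Longrightarrow> (\<And>\<omega>. \<omega> \<in> Omega T \<Longrightarrow> Q \<omega> \<Longrightarrow> R \<omega>) \<Longrightarrow> qs R"
  unfolding quasi_surely_def by blast

lemma qs_countable: "(\<And>n::nat. qs (Q n)) \<Longrightarrow> qs (\<lambda>\<omega>. \<forall>n. Q n \<omega>)"
proof -
  assume "\<And>n::nat. qs (Q n)"
  then obtain N where N: "\<And>n. polar T PP (N n)" "\<And>n \<omega>. \<omega> \<in> Omega T - N n \<Longrightarrow> Q n \<omega>"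
    unfolding quasi_surely_def by metis
  have "polar T PP (\<Union>n. N n)"
    unfolding polar_iff
  proof (intro conjI ballI)
    show "(\<Union>n. N n) \<in> sets (path_space T)" using N(1) by (auto simp: polar_iff)
    fix P assume "P \<in> PP"
    then show "emeasure P (\<Union>n. N n) = 0"
      using N(1) by (intro emeasure_UN_eq_0) (auto simp: polar_iff PP_sets)
  qed
  then show ?thesis unfolding quasi_surely_def using N(2) by (intro exI[of _ "\<Union>n. N n"]) auto
qed

lemma qs_conj: "qs Q \<Longrightarrow> qs R \<Longrightarrow> qs (\<lambda>\<omega>. Q \<omega> \<and> R \<omega>)"
proof -
  assume "qs Q" "qs R"
  then have "qs (\<lambda>\<omega>. \<forall>n. (if n = (0::nat) then Q else R) \<omega>)" by (intro qs_countable) auto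
  then show ?thesis by (rule qs_mono) (metis zero_neq_one)
qed

lemma UE_mono_qs:
  assumes "qs (\<lambda>\<omega>. X \<omega> \<le> Y \<omega>)"
  shows "UE X \<le> UE Y"
  using assms unfolding quasi_surely_def polar_iff upper_expectation_eq_upper_sup
  by (elim exE conjE) (rule upper_sup_mono_off_null, auto simp: PP_sets)

lemma UE_mono: "(\<And>\<omega>. \<omega> \<in> Omega T \<Longrightarrow> X \<omega> \<le> Y \<omega>) \<Longrightarrow> UE X \<le> UE Y"
  by (rule UE_mono_qs) (rule qs_all)

lemma UE_cong_qs: "qs (\<lambda>\<omega>. X \<omega> = Y \<omega>) \<Longrightarrow> UE X = UE Y"
  by (intro antisym UE_mono_qs) (auto elim: qs_mono)

lemma UE_add: "UE (\<lambda>\<omega>. X \<omega> + Y \<omega>) \<le> UE X + UE Y"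
  unfolding upper_expectation_eq_upper_sup by (rule upper_sup_add) (rule PP_sets)

lemma UE_cmult: "c > 0 \<Longrightarrow> UE (\<lambda>\<omega>. ennreal c * X \<omega>) \<le> ennreal c * UE X"
  unfolding upper_expectation_eq_upper_sup by (rule upper_sup_cmult) (auto simp: PP_sets)

lemma UE_zero: "UE (\<lambda>_. 0) = 0"
  using upper_sup_le[of "\<lambda>_. 0" "path_space T" "\<lambda>_. 0" PP] PP_nonempty
  by (simp add: upper_expectation_eq_upper_sup)

lemma UE_Borel_Cantelli:
  assumes "(\<lambda>n. UE (X n)) \<longlonglongrightarrow> 0"
  obtains k :: "nat \<Rightarrow> nat" where "strict_mono k" "qs (\<lambda>\<omega>. (\<lambda>n. X (k n) \<omega>) \<longlonglongrightarrow> 0)"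
proof -
  obtain k :: "nat \<Rightarrow> nat" and N where k: "strict_mono k" "N \<in> sets (path_space T)"
    "\<And>P. P \<in> PP \<Longrightarrow> emeasure P N = 0"
    "\<And>z. z \<in> space (path_space T) - N \<Longrightarrow> (\<lambda>n. X (k n) z) \<longlonglongrightarrow> 0"
    using upper_sup_Borel_Cantelli[of PP "path_space T" X, OF PP_sets] assms
    unfolding upper_expectation_eq_upper_sup by blast
  have "qs (\<lambda>\<omega>. (\<lambda>n. X (k n) \<omega>) \<longlonglongrightarrow> 0)"
    unfolding quasi_surely_def polar_iff using k(2-4) by (intro exI[of _ N]) auto
  with k(1) show ?thesis by (rule that)
qed

lemma UE_eq_0_qs:
  assumes "UE X = 0"
  shows "qs (\<lambda>\<omega>. X \<omega> = 0)"
proof -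
  obtain k :: "nat \<Rightarrow> nat" where "qs (\<lambda>\<omega>. (\<lambda>n. X \<omega>) \<longlonglongrightarrow> 0)"
    using UE_Borel_Cantelli[of "\<lambda>_. X"] assms by auto
  then show ?thesis by (rule qs_mono) (simp add: LIMSEQ_const_iff)
qed

text \<open>
  The form in which norm convergence is turned into quasi-sure statements: a variable dominated by
  sums of two sequences that vanish in the limit is zero.
\<close>
lemma qs_zero_of_vanishing_bounds:
  assumes lim: "(\<lambda>n. UE (X n)) \<longlonglongrightarrow> 0" and lim': "(\<lambda>n. UE (Y n)) \<longlonglongrightarrow> 0"
    and le: "\<And>n. qs (\<lambda>\<omega>. Z \<omega> \<le> ennreal c * (X n \<omega> + Y n \<omega>))" and c: "c > 0"
  shows "qs (\<lambda>\<omega>. Z \<omega> = 0)"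
proof (rule UE_eq_0_qs)
  have "UE Z \<le> ennreal c * (UE (X n) + UE (Y n))" for n
    using UE_mono_qs[OF le] UE_cmult[OF c] UE_add by (meson mult_left_mono order_trans zero_le)
  moreover have "(\<lambda>n. ennreal c * (UE (X n) + UE (Y n))) \<longlonglongrightarrow> ennreal c * (0 + 0)"
    by (intro tendsto_intros ennreal_tendsto_cmult lim lim') auto
  ultimately have "UE Z \<le> ennreal c * (0 + 0)" by (intro LIMSEQ_le_const) auto
  then show "UE Z = 0" by simp
qed

end

section \<open>Functions of polynomial local Lipschitz growth\<close>

lemma eucl_norm_nonneg [simp]: "0 \<le> eucl_norm x" "0 \<le> eucl_dist x y"
  by (auto simp: eucl_norm_def eucl_dist_def)

text \<open>
  The class is the same with the weight \<open>(1 + |x| + |y|)\<^sup>k\<close>, for which closure under products and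
  under maps of the arguments is immediate. Here and in \<open>C_l_Lip_E\<close> the two weights are compared.
\<close>
lemma C_l_Lip_I:
  assumes "0 \<le> C" "\<And>x y. length x = n \<Longrightarrow> length y = n \<Longrightarrow>
     \<bar>\<phi> x - \<phi> y\<bar> \<le> C * (1 + eucl_norm x + eucl_norm y) ^ k * eucl_dist x y"
  shows "\<phi> \<in> C_l_Lip n"
proof -
  have pow: "(1 + a + b) ^ k \<le> 3 ^ k * (1 + a ^ k + b ^ k)" if "0 \<le> a" "0 \<le> b" for a b :: real
  proof -
    let ?m = "max 1 (max a b)"
    have "(1 + a + b) ^ k \<le> (3 * ?m) ^ k" using that by (intro power_mono) auto
    also have "\<dots> = 3 ^ k * ?m ^ k" by (simp add: power_mult_distrib)
    also have "?m ^ k \<le> 1 + a ^ k + b ^ k" using that by (auto simp: max_def)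
    finally show ?thesis by simp
  qed
  have "\<bar>\<phi> x - \<phi> y\<bar> \<le> (C * 3 ^ k) * (1 + eucl_norm x ^ k + eucl_norm y ^ k) * eucl_dist x y"
    if "length x = n" "length y = n" for x y
  proof -
    have "C * (1 + eucl_norm x + eucl_norm y) ^ k \<le> C * (3 ^ k * (1 + eucl_norm x ^ k + eucl_norm y ^ k))"
      using assms(1) by (intro mult_left_mono pow) auto
    then have "C * (1 + eucl_norm x + eucl_norm y) ^ k * eucl_dist x y
        \<le> C * (3 ^ k * (1 + eucl_norm x ^ k + eucl_norm y ^ k)) * eucl_dist x y"
      by (rule mult_right_mono) simp
    with assms(2)[OF that] show ?thesis by (simp add: mult.assoc)
  qed
  then show ?thesis unfolding C_l_Lip_def by blast
qed

lemma C_l_Lip_E: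
  assumes "\<phi> \<in> C_l_Lip n"
  obtains C k where "0 \<le> C" "\<And>x y. length x = n \<Longrightarrow> length y = n \<Longrightarrow>
     \<bar>\<phi> x - \<phi> y\<bar> \<le> C * (1 + eucl_norm x + eucl_norm y) ^ k * eucl_dist x y"
proof -
  obtain C k where C: "\<And>x y. length x = n \<Longrightarrow> length y = n \<Longrightarrow>
     \<bar>\<phi> x - \<phi> y\<bar> \<le> C * (1 + eucl_norm x ^ k + eucl_norm y ^ k) * eucl_dist x y"
    using assms unfolding C_l_Lip_def by blast
  have pow: "1 + a ^ k + b ^ k \<le> 3 * (1 + a + b) ^ k" if "0 \<le> a" "0 \<le> b" for a b :: real
  proof -
    have "1 \<le> (1 + a + b) ^ k" using that by (intro one_le_power) auto
    moreover have "a ^ k \<le> (1 + a + b) ^ k" "b ^ k \<le> (1 + a + b) ^ k"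
      using that by (auto intro!: power_mono)
    ultimately show ?thesis by simp
  qed
  have "\<bar>\<phi> x - \<phi> y\<bar> \<le> (\<bar>C\<bar> * 3) * (1 + eucl_norm x + eucl_norm y) ^ k * eucl_dist x y"
    if l: "length x = n" "length y = n" for x y
  proof -
    have "C * (1 + eucl_norm x ^ k + eucl_norm y ^ k) \<le> \<bar>C\<bar> * (1 + eucl_norm x ^ k + eucl_norm y ^ k)"
      by (rule mult_right_mono) (auto intro!: add_nonneg_nonneg)
    also have "\<dots> \<le> \<bar>C\<bar> * (3 * (1 + eucl_norm x + eucl_norm y) ^ k)"
      by (intro mult_left_mono pow) auto
    finally have "C * (1 + eucl_norm x ^ k + eucl_norm y ^ k) * eucl_dist x y
        \<le> \<bar>C\<bar> * (3 * (1 + eucl_norm x + eucl_norm y) ^ k) * eucl_dist x y"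
      by (rule mult_right_mono) simp
    with C[OF l] show ?thesis by (simp add: mult.assoc)
  qed
  then show ?thesis by (intro that[of "\<bar>C\<bar> * 3" k]) auto
qed

lemma C_l_Lip_add:
  assumes "\<phi> \<in> C_l_Lip n" "\<psi> \<in> C_l_Lip n"
  shows "(\<lambda>x. \<phi> x + \<psi> x) \<in> C_l_Lip n"
proof -
  obtain C k where C: "0 \<le> C" "\<And>x y. length x = n \<Longrightarrow> length y = n \<Longrightarrow>
     \<bar>\<phi> x - \<phi> y\<bar> \<le> C * (1 + eucl_norm x + eucl_norm y) ^ k * eucl_dist x y"
    using C_l_Lip_E[OF assms(1)] by blast
  obtain D m where D: "0 \<le> D" "\<And>x y. length x = n \<Longrightarrow> length y = n \<Longrightarrow>
     \<bar>\<psi> x - \<psi> y\<bar> \<le> D * (1 + eucl_norm x + eucl_norm y) ^ m * eucl_dist x y"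
    using C_l_Lip_E[OF assms(2)] by blast
  show ?thesis
  proof (rule C_l_Lip_I)
    show "0 \<le> C + D" using C D by simp
    fix x y :: "real list" assume l: "length x = n" "length y = n"
    define w where "w = 1 + eucl_norm x + eucl_norm y"
    have w: "1 \<le> w" by (simp add: w_def)
    have "C * w ^ k \<le> C * w ^ (k + m)" "D * w ^ m \<le> D * w ^ (k + m)"
      using w C(1) D(1) by (auto intro!: mult_left_mono power_increasing)
    then have "C * w ^ k + D * w ^ m \<le> (C + D) * w ^ (k + m)" by (simp add: distrib_right)
    then have "(C * w ^ k + D * w ^ m) * eucl_dist x y \<le> (C + D) * w ^ (k + m) * eucl_dist x y"
      by (rule mult_right_mono) simp
    then have "C * w ^ k * eucl_dist x y + D * w ^ m * eucl_dist x y \<le> (C + D) * w ^ (k + m) * eucl_dist x y"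
      by (simp add: distrib_right)
    with C(2)[OF l] D(2)[OF l]
    show "\<bar>\<phi> x + \<psi> x - (\<phi> y + \<psi> y)\<bar> \<le> (C + D) * (1 + eucl_norm x + eucl_norm y) ^ (k + m) * eucl_dist x y"
      unfolding w_def by linarith
  qed
qed

lemma C_l_Lip_growth:
  assumes "\<phi> \<in> C_l_Lip n"
  obtains B j where "0 \<le> B" "\<And>x. length x = n \<Longrightarrow> \<bar>\<phi> x\<bar> \<le> B * (1 + eucl_norm x) ^ j"
proof -
  obtain C k where C: "0 \<le> C" "\<And>x y. length x = n \<Longrightarrow> length y = n \<Longrightarrow>
     \<bar>\<phi> x - \<phi> y\<bar> \<le> C * (1 + eucl_norm x + eucl_norm y) ^ k * eucl_dist x y"
    using C_l_Lip_E[OF assms(1)] by blast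
  define z where "z = replicate n (0::real)"
  have z: "length z = n" "eucl_norm z = 0" by (auto simp: z_def eucl_norm_def L2_set_def)
  have dz: "eucl_dist x z = eucl_norm x" if "length x = n" for x
    using that by (auto simp: eucl_dist_def eucl_norm_def z_def intro!: L2_set_cong)
  have "\<bar>\<phi> x\<bar> \<le> (\<bar>\<phi> z\<bar> + C) * (1 + eucl_norm x) ^ Suc k" if l: "length x = n" for x
  proof -
    have "\<bar>\<phi> x\<bar> \<le> \<bar>\<phi> z\<bar> + C * (1 + eucl_norm x) ^ k * eucl_norm x"
      using C(2)[OF l z(1)] z dz[OF l] by simp
    also have "C * (1 + eucl_norm x) ^ k * eucl_norm x \<le> C * (1 + eucl_norm x) ^ Suc k"
      using C(1) by (simp add: algebra_simps mult_left_mono)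
    also have "\<bar>\<phi> z\<bar> \<le> \<bar>\<phi> z\<bar> * (1 + eucl_norm x) ^ Suc k"
      by (intro mult_right_mono[of 1, simplified] mult_le_cancel_left1[THEN iffD2]) (auto simp del: power_Suc)
    finally show ?thesis by (simp add: algebra_simps)
  qed
  then show ?thesis using C(1) by (intro that[of "\<bar>\<phi> z\<bar> + C" "Suc k"]) auto
qed

lemma C_l_Lip_mult:
  assumes "\<phi> \<in> C_l_Lip n" "\<psi> \<in> C_l_Lip n"
  shows "(\<lambda>x. \<phi> x * \<psi> x) \<in> C_l_Lip n"
proof -
  obtain C k where C: "0 \<le> C" "\<And>x y. length x = n \<Longrightarrow> length y = n \<Longrightarrow>
     \<bar>\<phi> x - \<phi> y\<bar> \<le> C * (1 + eucl_norm x + eucl_norm y) ^ k * eucl_dist x y"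
    using C_l_Lip_E[OF assms(1)] by blast
  obtain D m where D: "0 \<le> D" "\<And>x y. length x = n \<Longrightarrow> length y = n \<Longrightarrow>
     \<bar>\<psi> x - \<psi> y\<bar> \<le> D * (1 + eucl_norm x + eucl_norm y) ^ m * eucl_dist x y"
    using C_l_Lip_E[OF assms(2)] by blast
  obtain B j where B: "0 \<le> B" "\<And>x. length x = n \<Longrightarrow> \<bar>\<phi> x\<bar> \<le> B * (1 + eucl_norm x) ^ j"
    using C_l_Lip_growth[OF assms(1)] by blast
  obtain A i where A: "0 \<le> A" "\<And>x. length x = n \<Longrightarrow> \<bar>\<psi> x\<bar> \<le> A * (1 + eucl_norm x) ^ i"
    using C_l_Lip_growth[OF assms(2)] by blast
  show ?thesis
  proof (rule C_l_Lip_I)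
    show "0 \<le> B * D + A * C" using A B C D by simp
    fix x y :: "real list" assume l: "length x = n" "length y = n"
    define w where "w = 1 + eucl_norm x + eucl_norm y"
    define d where "d = eucl_dist x y"
    have w: "1 \<le> w" by (simp add: w_def)
    have "B * (1 + eucl_norm x) ^ j \<le> B * w ^ j" "A * (1 + eucl_norm y) ^ i \<le> A * w ^ i"
      using A B by (auto intro!: mult_left_mono power_mono simp: w_def)
    then have b: "\<bar>\<phi> x\<bar> \<le> B * w ^ j" "\<bar>\<psi> y\<bar> \<le> A * w ^ i"
      using B(2)[OF l(1)] A(2)[OF l(2)] by auto
    let ?N = "j + m + i + k"
    have "\<bar>\<phi> x * \<psi> x - \<phi> y * \<psi> y\<bar> = \<bar>\<phi> x * (\<psi> x - \<psi> y) + \<psi> y * (\<phi> x - \<phi> y)\<bar>"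
      by (simp add: algebra_simps)
    also have "\<dots> \<le> \<bar>\<phi> x\<bar> * \<bar>\<psi> x - \<psi> y\<bar> + \<bar>\<psi> y\<bar> * \<bar>\<phi> x - \<phi> y\<bar>"
      by (metis abs_mult abs_triangle_ineq)
    also have "\<dots> \<le> (B * w ^ j) * (D * w ^ m * d) + (A * w ^ i) * (C * w ^ k * d)"
      using b C(2)[OF l] D(2)[OF l] A(1) B(1) w unfolding w_def[symmetric] d_def[symmetric]
      by (intro add_mono mult_mono) auto
    also have "\<dots> = (B * D * w ^ (j + m) + A * C * w ^ (i + k)) * d"
      by (simp add: algebra_simps power_add)
    also have "\<dots> \<le> (B * D * w ^ ?N + A * C * w ^ ?N) * d"
    proof -
      have "w ^ (j + m) \<le> w ^ ?N" "w ^ (i + k) \<le> w ^ ?N" using w by (auto intro!: power_increasing)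
      then have "B * D * w ^ (j + m) \<le> B * D * w ^ ?N" "A * C * w ^ (i + k) \<le> A * C * w ^ ?N"
        using A(1) B(1) C(1) D(1) by (auto intro!: mult_left_mono)
      then show ?thesis by (intro mult_right_mono add_mono) (auto simp: d_def)
    qed
    finally show "\<bar>\<phi> x * \<psi> x - \<phi> y * \<psi> y\<bar> \<le> (B * D + A * C) * (1 + eucl_norm x + eucl_norm y) ^ ?N * eucl_dist x y"
      by (simp add: w_def d_def algebra_simps)
  qed
qed

lemma C_l_Lip_const: "(\<lambda>_. a) \<in> C_l_Lip n"
  by (rule C_l_Lip_I[of 0]) auto

lemma C_l_Lip_nth:
  assumes "i < n" shows "(\<lambda>x. x ! i) \<in> C_l_Lip n"
proof (rule C_l_Lip_I[of 1 _ _ 0])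
  fix x y :: "real list" assume l: "length x = n" "length y = n"
  have "\<bar>x ! i - y ! i\<bar> \<le> eucl_dist x y"
    unfolding eucl_dist_def
    using member_le_L2_set[of "{..<length x}" i "\<lambda>i. \<bar>x ! i - y ! i\<bar>"] assms l
    by (simp add: L2_set_def)
  then show "\<bar>x ! i - y ! i\<bar> \<le> 1 * (1 + eucl_norm x + eucl_norm y) ^ 0 * eucl_dist x y" by simp
qed auto

lemma C_l_Lip_contraction:
  assumes "\<phi> \<in> C_l_Lip n" "\<And>a b. \<bar>\<kappa> a - \<kappa> b\<bar> \<le> \<bar>a - b\<bar>"
  shows "(\<lambda>x. \<kappa> (\<phi> x)) \<in> C_l_Lip n"
proof -
  obtain C k where C: "0 \<le> C" "\<And>x y. length x = n \<Longrightarrow> length y = n \<Longrightarrow>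
     \<bar>\<phi> x - \<phi> y\<bar> \<le> C * (1 + eucl_norm x + eucl_norm y) ^ k * eucl_dist x y"
    using C_l_Lip_E[OF assms(1)] by blast
  show ?thesis
    by (rule C_l_Lip_I[OF C(1)]) (rule order_trans[OF assms(2) C(2)])
qed

lemma C_l_Lip_reindex:
  assumes \<phi>: "\<phi> \<in> C_l_Lip (length js)" and js: "set js \<subseteq> {..<n}"
  shows "(\<lambda>x. \<phi> (map ((!) x) js)) \<in> C_l_Lip n"
proof -
  let ?m = "length js"
  obtain C k where C: "0 \<le> C" "\<And>x y. length x = ?m \<Longrightarrow> length y = ?m \<Longrightarrow>
     \<bar>\<phi> x - \<phi> y\<bar> \<le> C * (1 + eucl_norm x + eucl_norm y) ^ k * eucl_dist x y"
    using C_l_Lip_E[OF \<phi>] by blast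
  have sel: "L2_set (\<lambda>i. v (js ! i)) {..<?m} \<le> real ?m * L2_set v {..<n}" for v
  proof -
    have "L2_set (\<lambda>i. v (js ! i)) {..<?m} \<le> (\<Sum>i<?m. \<bar>v (js ! i)\<bar>)" by (rule L2_set_le_sum_abs)
    also have "\<dots> \<le> (\<Sum>i<?m. L2_set v {..<n})"
    proof (rule sum_mono)
      fix i assume "i \<in> {..<?m}"
      then have "js ! i \<in> {..<n}" using js nth_mem by blast
      then show "\<bar>v (js ! i)\<bar> \<le> L2_set v {..<n}"
        using member_le_L2_set[of "{..<n}" "js ! i" "\<lambda>i. \<bar>v i\<bar>"] by (simp add: L2_set_def)
    qed
    finally show ?thesis by simp
  qed
  define M where "M = real ?m + 1"
  have M: "1 \<le> M" by (simp add: M_def)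
  show ?thesis
  proof (rule C_l_Lip_I)
    show "0 \<le> C * M ^ Suc k" using C M by simp
    fix x y :: "real list" assume l: "length x = n" "length y = n"
    have nrm: "eucl_norm (map ((!) z) js) \<le> M * eucl_norm z" if "length z = n" for z
    proof -
      have "eucl_norm (map ((!) z) js) = L2_set (\<lambda>i. z ! (js ! i)) {..<?m}"
        by (auto simp: eucl_norm_def intro!: L2_set_cong)
      also have "\<dots> \<le> real ?m * eucl_norm z" using sel[of "(!) z"] that by (simp add: eucl_norm_def)
      also have "\<dots> \<le> M * eucl_norm z" by (intro mult_right_mono) (auto simp: M_def)
      finally show ?thesis .
    qed
    have dst: "eucl_dist (map ((!) x) js) (map ((!) y) js) \<le> M * eucl_dist x y"
    proof -
      have "eucl_dist (map ((!) x) js) (map ((!) y) js) = L2_set (\<lambda>i. x ! (js ! i) - y ! (js ! i)) {..<?m}"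
        by (auto simp: eucl_dist_def intro!: L2_set_cong)
      also have "\<dots> \<le> real ?m * eucl_dist x y"
        using sel[of "\<lambda>i. x ! i - y ! i"] l by (simp add: eucl_dist_def)
      also have "\<dots> \<le> M * eucl_dist x y" by (intro mult_right_mono) (auto simp: M_def)
      finally show ?thesis .
    qed
    have "1 + eucl_norm (map ((!) x) js) + eucl_norm (map ((!) y) js) \<le> M * (1 + eucl_norm x + eucl_norm y)"
      using nrm[OF l(1)] nrm[OF l(2)] M by (simp add: algebra_simps)
    then have "(1 + eucl_norm (map ((!) x) js) + eucl_norm (map ((!) y) js)) ^ k
        \<le> (M * (1 + eucl_norm x + eucl_norm y)) ^ k" by (intro power_mono) auto
    then have "C * (1 + eucl_norm (map ((!) x) js) + eucl_norm (map ((!) y) js)) ^ k * eucl_dist (map ((!) x) js) (map ((!) y) js)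
        \<le> C * (M * (1 + eucl_norm x + eucl_norm y)) ^ k * (M * eucl_dist x y)"
      using C(1) M dst by (intro mult_mono) auto
    also have "\<dots> = C * M ^ Suc k * (1 + eucl_norm x + eucl_norm y) ^ k * eucl_dist x y"
      by (simp only: power_mult_distrib power_Suc mult_ac)
    finally show "\<bar>\<phi> (map ((!) x) js) - \<phi> (map ((!) y) js)\<bar> \<le> C * M ^ Suc k * (1 + eucl_norm x + eucl_norm y) ^ k * eucl_dist x y"
      using C(2)[of "map ((!) x) js" "map ((!) y) js"] by simp
  qed
qed

lemma C_l_Lip_continuous_comp:
  fixes v :: "'a :: topological_space \<Rightarrow> real list"
  assumes \<phi>: "\<phi> \<in> C_l_Lip n" and len: "\<And>z. length (v z) = n"
    and v: "\<And>i. i < n \<Longrightarrow> continuous_on S (\<lambda>z. v z ! i)"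
  shows "continuous_on S (\<lambda>z. \<phi> (v z))"
  unfolding continuous_on_def
proof
  fix z assume z: "z \<in> S"
  obtain C k where C: "0 \<le> C" "\<And>x y. length x = n \<Longrightarrow> length y = n \<Longrightarrow>
     \<bar>\<phi> x - \<phi> y\<bar> \<le> C * (1 + eucl_norm x + eucl_norm y) ^ k * eucl_dist x y"
    using C_l_Lip_E[OF \<phi>] by blast
  have vz: "((\<lambda>z. v z ! i) \<longlongrightarrow> v z ! i) (at z within S)" if "i < n" for i
    using v[OF that] z unfolding continuous_on_def by blast
  have "((\<lambda>y. C * (1 + eucl_norm (v y) + eucl_norm (v z)) ^ k * eucl_dist (v y) (v z))
      \<longlongrightarrow> C * (1 + eucl_norm (v z) + eucl_norm (v z)) ^ k * eucl_dist (v z) (v z)) (at z within S)"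
    unfolding eucl_norm_def eucl_dist_def L2_set_def len by (intro tendsto_intros vz) auto
  moreover have "eucl_dist (v z) (v z) = 0" by (simp add: eucl_dist_def L2_set_def)
  ultimately have "((\<lambda>y. C * (1 + eucl_norm (v y) + eucl_norm (v z)) ^ k * eucl_dist (v y) (v z)) \<longlongrightarrow> 0)
      (at z within S)" by simp
  moreover have "\<forall>y. norm (\<phi> (v y) - \<phi> (v z)) \<le> C * (1 + eucl_norm (v y) + eucl_norm (v z)) ^ k * eucl_dist (v y) (v z)"
    using C(2)[OF len len] by simp
  ultimately have "((\<lambda>y. \<phi> (v y) - \<phi> (v z)) \<longlongrightarrow> 0) (at z within S)"
    by (rule Lim_null_comparison[OF always_eventually, rotated])
  then show "((\<lambda>z. \<phi> (v z)) \<longlongrightarrow> \<phi> (v z)) (at z within S)" by (simp add: Lim_null[symmetric])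
qed

lemma C_b_Lip_subset: "C_b_Lip n \<subseteq> C_l_Lip n"
proof
  fix \<phi> assume "\<phi> \<in> C_b_Lip n"
  then obtain L where L: "\<And>x y. length x = n \<Longrightarrow> length y = n \<Longrightarrow> \<bar>\<phi> x - \<phi> y\<bar> \<le> L * eucl_dist x y"
    unfolding C_b_Lip_def by blast
  show "\<phi> \<in> C_l_Lip n"
  proof (rule C_l_Lip_I[of "\<bar>L\<bar>" _ _ 0])
    fix x y :: "real list" assume "length x = n" "length y = n"
    note L[OF this]
    also have "L * eucl_dist x y \<le> \<bar>L\<bar> * eucl_dist x y" by (rule mult_right_mono) auto
    finally show "\<bar>\<phi> x - \<phi> y\<bar> \<le> \<bar>L\<bar> * (1 + eucl_norm x + eucl_norm y) ^ 0 * eucl_dist x y" by simp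
  qed auto
qed

section \<open>Cylinder variables\<close>

lemma L_ip_I: "set ts \<subseteq> {0..t} \<Longrightarrow> \<phi> \<in> C_l_Lip (length ts) \<Longrightarrow>
   (\<lambda>\<omega>. \<phi> (map (\<lambda>s. canonical s \<omega>) ts)) \<in> L_ip t"
  unfolding L_ip_def by blast

lemma L_ip_E:
  assumes "\<xi> \<in> L_ip t"
  obtains \<phi> ts where "set ts \<subseteq> {0..t}" "\<phi> \<in> C_l_Lip (length ts)"
    "\<xi> = (\<lambda>\<omega>. \<phi> (map (\<lambda>s. canonical s \<omega>) ts))"
  using assms unfolding L_ip_def by blast

text \<open>
  Two cylinder variables become functions of one vector by concatenating their observation times.
\<close>
lemma L_ip_combine:
  assumes "\<xi> \<in> L_ip t" "\<zeta> \<in> L_ip t"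
    and F: "\<And>n \<phi> \<psi>. \<phi> \<in> C_l_Lip n \<Longrightarrow> \<psi> \<in> C_l_Lip n \<Longrightarrow> (\<lambda>x. F (\<phi> x) (\<psi> x)) \<in> C_l_Lip n"
  shows "(\<lambda>\<omega>. F (\<xi> \<omega>) (\<zeta> \<omega>)) \<in> L_ip t"
proof -
  obtain \<phi> ts where \<phi>: "set ts \<subseteq> {0..t}" "\<phi> \<in> C_l_Lip (length ts)"
    "\<xi> = (\<lambda>\<omega>. \<phi> (map (\<lambda>s. canonical s \<omega>) ts))" using L_ip_E[OF assms(1)] by blast
  obtain \<psi> ss where \<psi>: "set ss \<subseteq> {0..t}" "\<psi> \<in> C_l_Lip (length ss)"
    "\<zeta> = (\<lambda>\<omega>. \<psi> (map (\<lambda>s. canonical s \<omega>) ss))" using L_ip_E[OF assms(2)] by blast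
  let ?n = "length (ts @ ss)"
  let ?i = "[0..<length ts]" and ?j = "[length ts..<length ts + length ss]"
  have "(\<lambda>x. \<phi> (map ((!) x) ?i)) \<in> C_l_Lip ?n" "(\<lambda>x. \<psi> (map ((!) x) ?j)) \<in> C_l_Lip ?n"
    using \<phi>(2) \<psi>(2) by (auto intro!: C_l_Lip_reindex)
  then have "(\<lambda>x. F (\<phi> (map ((!) x) ?i)) (\<psi> (map ((!) x) ?j))) \<in> C_l_Lip ?n" by (rule F)
  then have "(\<lambda>\<omega>. (\<lambda>x. F (\<phi> (map ((!) x) ?i)) (\<psi> (map ((!) x) ?j))) (map (\<lambda>s. canonical s \<omega>) (ts @ ss))) \<in> L_ip t"
    using \<phi>(1) \<psi>(1) by (intro L_ip_I) auto
  moreover have "map ((!) (map (\<lambda>s. canonical s \<omega>) (ts @ ss))) ?i = map (\<lambda>s. canonical s \<omega>) ts"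
    "map ((!) (map (\<lambda>s. canonical s \<omega>) (ts @ ss))) ?j = map (\<lambda>s. canonical s \<omega>) ss" for \<omega>
    by (rule nth_equalityI; simp add: nth_append)+
  ultimately show ?thesis unfolding \<phi>(3) \<psi>(3) by simp
qed

lemma L_ip_const: "(\<lambda>_. a) \<in> L_ip t"
  using L_ip_I[of "[]" t "\<lambda>_. a", OF _ C_l_Lip_const] by simp

lemma L_ip_add: "\<xi> \<in> L_ip t \<Longrightarrow> \<zeta> \<in> L_ip t \<Longrightarrow> (\<lambda>\<omega>. \<xi> \<omega> + \<zeta> \<omega>) \<in> L_ip t"
  by (rule L_ip_combine) (auto intro: C_l_Lip_add)

lemma L_ip_mult: "\<xi> \<in> L_ip t \<Longrightarrow> \<zeta> \<in> L_ip t \<Longrightarrow> (\<lambda>\<omega>. \<xi> \<omega> * \<zeta> \<omega>) \<in> L_ip t"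
  by (rule L_ip_combine) (auto intro: C_l_Lip_mult)

lemma L_ip_diff: "\<xi> \<in> L_ip t \<Longrightarrow> \<zeta> \<in> L_ip t \<Longrightarrow> (\<lambda>\<omega>. \<xi> \<omega> - \<zeta> \<omega>) \<in> L_ip t"
  using L_ip_add[of \<xi> t "\<lambda>\<omega>. (-1) * \<zeta> \<omega>"] L_ip_mult[OF L_ip_const, of \<zeta> t "-1"] by simp

lemma L_ip_contraction:
  assumes "\<xi> \<in> L_ip t" "\<And>a b. \<bar>\<kappa> a - \<kappa> b\<bar> \<le> \<bar>a - b\<bar>"
  shows "(\<lambda>\<omega>. \<kappa> (\<xi> \<omega>)) \<in> L_ip t"
  using L_ip_combine[OF assms(1,1), of "\<lambda>a b. \<kappa> a"] C_l_Lip_contraction[OF _ assms(2)] by simp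

lemma L_ip_sum: "finite I \<Longrightarrow> (\<And>i. i \<in> I \<Longrightarrow> \<xi> i \<in> L_ip t) \<Longrightarrow> (\<lambda>\<omega>. \<Sum>i\<in>I. \<xi> i \<omega>) \<in> L_ip t"
  by (induction I rule: finite_induct) (auto intro: L_ip_const L_ip_add)

lemma L_ip_mono: "s \<le> t \<Longrightarrow> L_ip s \<subseteq> L_ip t"
  unfolding L_ip_def by fastforce

lemma L_ip_canonical: "0 \<le> s \<Longrightarrow> s \<le> t \<Longrightarrow> canonical s \<in> L_ip t"
  using L_ip_I[of "[s]" t "\<lambda>x. x ! 0", OF _ C_l_Lip_nth] by (simp add: eta_contract_eq)

lemma continuous_on_canonical: "continuous_on S (canonical s)"
  unfolding continuous_on_iff canonical_def using dist_fun_lt_imp_dist_val_lt by blast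

lemma L_ip_continuous:
  assumes "\<xi> \<in> L_ip t" shows "continuous_on S \<xi>"
proof -
  obtain \<phi> ts where \<phi>: "set ts \<subseteq> {0..t}" "\<phi> \<in> C_l_Lip (length ts)"
    "\<xi> = (\<lambda>\<omega>. \<phi> (map (\<lambda>s. canonical s \<omega>) ts))" using L_ip_E[OF assms(1)] by blast
  show ?thesis unfolding \<phi>(3)
    by (rule C_l_Lip_continuous_comp[OF \<phi>(2)]) (auto intro: continuous_on_canonical)
qed

lemma L_ip_measurable: "\<xi> \<in> L_ip t \<Longrightarrow> \<xi> \<in> borel_measurable (path_space T)"
  unfolding path_space_def by (intro borel_measurable_continuous_on_restrict L_ip_continuous)

section \<open>Comparison of viscosity solutions with smooth supersolutions\<close>

lemma C12_test_add:
  assumes "C12_test T v vt vxx" "C12_test T w wt wxx"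
  shows "C12_test T (\<lambda>t x. v t x + w t x) (\<lambda>t x. vt t x + wt t x) (\<lambda>t x. vxx t x + wxx t x)"
proof -
  obtain vx where vx: "\<forall>t\<in>{0<..<T}. \<forall>x.
        ((\<lambda>s. v s x) has_real_derivative vt t x) (at t) \<and>
        ((\<lambda>y. v t y) has_real_derivative vx t x) (at x) \<and>
        ((\<lambda>y. vx t y) has_real_derivative vxx t x) (at x)"
      "\<forall>v\<in>{v, vt, vx, vxx}. continuous_on ({0<..<T} \<times> UNIV) (\<lambda>(t, x). v t x)"
    using assms(1) unfolding C12_test_def by blast
  obtain wx where wx: "\<forall>t\<in>{0<..<T}. \<forall>x.
        ((\<lambda>s. w s x) has_real_derivative wt t x) (at t) \<and>
        ((\<lambda>y. w t y) has_real_derivative wx t x) (at x) \<and>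
        ((\<lambda>y. wx t y) has_real_derivative wxx t x) (at x)"
      "\<forall>v\<in>{w, wt, wx, wxx}. continuous_on ({0<..<T} \<times> UNIV) (\<lambda>(t, x). v t x)"
    using assms(2) unfolding C12_test_def by blast
  show ?thesis
    unfolding C12_test_def
  proof (intro exI[of _ "\<lambda>t x. vx t x + wx t x"] conjI ballI allI)
    fix t x assume "t \<in> {0<..<T}"
    then show "((\<lambda>s. v s x + w s x) has_real_derivative vt t x + wt t x) (at t)"
      "((\<lambda>y. v t y + w t y) has_real_derivative vx t x + wx t x) (at x)"
      "((\<lambda>y. vx t y + wx t y) has_real_derivative vxx t x + wxx t x) (at x)"
      using vx(1) wx(1) by (auto intro!: DERIV_add)
  next
    have c: "continuous_on ({0<..<T} \<times> UNIV) (\<lambda>(t, x). a t x + b t x)"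
      if "continuous_on ({0<..<T} \<times> UNIV) (\<lambda>(t, x). a t x)" "continuous_on ({0<..<T} \<times> UNIV) (\<lambda>(t, x). b t x)"
      for a b :: "real \<Rightarrow> real \<Rightarrow> real"
      using continuous_on_add[OF that] by (simp add: case_prod_unfold)
    fix z assume "z \<in> {\<lambda>t x. v t x + w t x, \<lambda>t x. vt t x + wt t x, \<lambda>t x. vx t x + wx t x, \<lambda>t x. vxx t x + wxx t x}"
    then show "continuous_on ({0<..<T} \<times> UNIV) (\<lambda>(t, x). z t x)"
      using vx(2) wx(2) by (elim insertE) (auto intro!: c)
  qed
qed

text \<open>
  The penalisation term of the comparison argument.
\<close>
lemma C12_test_barrier:
  fixes \<epsilon> \<kappa> :: real and k :: nat
  shows "C12_test T (\<lambda>t x. \<epsilon> * exp (\<kappa> * t) * (1 + x ^ (2 * k + 2)) + \<epsilon> / (T - t))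
    (\<lambda>t x. \<epsilon> * \<kappa> * exp (\<kappa> * t) * (1 + x ^ (2 * k + 2)) + \<epsilon> / (T - t)\<^sup>2)
    (\<lambda>t x. \<epsilon> * exp (\<kappa> * t) * (real (2 * k + 2) * real (2 * k + 1) * x ^ (2 * k)))"
  unfolding C12_test_def
proof (intro exI[of _ "\<lambda>t x. \<epsilon> * exp (\<kappa> * t) * (real (2 * k + 2) * x ^ (2 * k + 1))"] conjI ballI allI)
  fix t x :: real assume t: "t \<in> {0<..<T}"
  show "((\<lambda>s. \<epsilon> * exp (\<kappa> * s) * (1 + x ^ (2 * k + 2)) + \<epsilon> / (T - s)) has_real_derivative
      \<epsilon> * \<kappa> * exp (\<kappa> * t) * (1 + x ^ (2 * k + 2)) + \<epsilon> / (T - t)\<^sup>2) (at t)"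
    using t by (auto intro!: derivative_eq_intros simp: power2_eq_square)
  show "((\<lambda>y. \<epsilon> * exp (\<kappa> * t) * (1 + y ^ (2 * k + 2)) + \<epsilon> / (T - t)) has_real_derivative
      \<epsilon> * exp (\<kappa> * t) * (real (2 * k + 2) * x ^ (2 * k + 1))) (at x)"
    by (rule DERIV_cong[OF DERIV_add[OF DERIV_cmult[OF DERIV_add[OF DERIV_const DERIV_pow]] DERIV_const]]) simp
  show "((\<lambda>y. \<epsilon> * exp (\<kappa> * t) * (real (2 * k + 2) * y ^ (2 * k + 1))) has_real_derivative
      \<epsilon> * exp (\<kappa> * t) * (real (2 * k + 2) * real (2 * k + 1) * x ^ (2 * k))) (at x)"
    by (rule DERIV_cong[OF DERIV_cmult[OF DERIV_cmult[OF DERIV_pow]]]) simp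
next
  fix v assume "v \<in> {\<lambda>t x. \<epsilon> * exp (\<kappa> * t) * (1 + x ^ (2 * k + 2)) + \<epsilon> / (T - t),
    \<lambda>t x. \<epsilon> * \<kappa> * exp (\<kappa> * t) * (1 + x ^ (2 * k + 2)) + \<epsilon> / (T - t)\<^sup>2,
    \<lambda>t x. \<epsilon> * exp (\<kappa> * t) * (real (2 * k + 2) * x ^ (2 * k + 1)),
    \<lambda>t x. \<epsilon> * exp (\<kappa> * t) * (real (2 * k + 2) * real (2 * k + 1) * x ^ (2 * k))}"
  then show "continuous_on ({0<..<T} \<times> UNIV) (\<lambda>(t, x). v t x)"
    by (elim insertE) (auto simp: case_prod_unfold intro!: continuous_intros)
qed

lemma G_fun_add_le:
  assumes "slow\<^sup>2 \<le> shigh\<^sup>2" "0 \<le> b"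
  shows "G_fun slow shigh (a + b) \<le> G_fun slow shigh a + shigh\<^sup>2 * b / 2"
proof (cases "a + b \<ge> 0")
  case True
  then have m: "max (a + b) 0 = a + b" "max (- (a + b)) 0 = 0" by auto
  show ?thesis
  proof (cases "a \<ge> 0")
    case True
    then show ?thesis unfolding G_fun_def m by (simp add: field_simps max_def)
  next
    case False
    then have "slow\<^sup>2 * (- a) \<le> shigh\<^sup>2 * (- a)" using assms by (intro mult_right_mono) auto
    then show ?thesis using False unfolding G_fun_def m by (simp add: field_simps max_def)
  qed
next
  case False
  then have "a < 0" using assms by auto
  moreover have "slow\<^sup>2 * b \<le> shigh\<^sup>2 * b" using assms by (intro mult_right_mono) auto
  ultimately show ?thesis using False unfolding G_fun_def by (simp add: field_simps max_def)
qed

text \<open>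
  The classical argument by penalisation: with the strict supersolution
  \<open>v + \<epsilon> e\<^bsup>\<kappa>t\<^esup> (1 + x\<^bsup>2k+2\<^esup>) + \<epsilon> / (T - t)\<close>, whose growth beats that of \<open>u\<close> at infinity and near the final
  time, the difference attains a positive maximum at an interior point, where the sum serves as a test function
  and violates the subsolution inequality.
\<close>
lemma viscosity_solution_le_supersolution:
  assumes u: "viscosity_solution T (G_fun slow shigh) \<phi> u"
    and sig: "slow\<^sup>2 \<le> shigh\<^sup>2"
    and v: "C12_test T v vt vxx" and cv: "continuous_on ({0..T} \<times> UNIV) (\<lambda>(t, x). v t x)"
    and super: "\<And>t x. t \<in> {0<..<T} \<Longrightarrow> G_fun slow shigh (vxx t x) \<le> vt t x"
    and init: "\<And>x. \<phi> x \<le> v 0 x"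
    and nn: "\<And>t x. t \<in> {0..T} \<Longrightarrow> 0 \<le> v t x"
    and t: "t \<in> {0..<T}"
  shows "u t x \<le> v t x"
proof (rule ccontr)
  assume "\<not> u t x \<le> v t x"
  define \<eta> where "\<eta> = u t x - v t x"
  have \<eta>: "\<eta> > 0" using \<open>\<not> u t x \<le> v t x\<close> by (simp add: \<eta>_def)
  have cu: "continuous_on ({0..T} \<times> UNIV) (\<lambda>(t, x). u t x)" and u0: "\<And>x. u 0 x = \<phi> x"
    using u unfolding viscosity_solution_def by auto
  obtain C' and k :: nat where C': "\<And>t x. t \<in> {0..T} \<Longrightarrow> \<bar>u t x\<bar> \<le> C' * (1 + \<bar>x\<bar> ^ k)"
    using u unfolding viscosity_solution_def by blast
  define C where "C = \<bar>C'\<bar>"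
  have C: "0 \<le> C" "\<And>t x. t \<in> {0..T} \<Longrightarrow> u t x \<le> C * (1 + \<bar>x\<bar> ^ k)"
  proof -
    show "0 \<le> C" by (simp add: C_def)
    fix t x assume "t \<in> {0..T}"
    then have "u t x \<le> C' * (1 + \<bar>x\<bar> ^ k)" using C'[of t x] by linarith
    also have "\<dots> \<le> C * (1 + \<bar>x\<bar> ^ k)" unfolding C_def by (intro mult_right_mono) auto
    finally show "u t x \<le> C * (1 + \<bar>x\<bar> ^ k)" .
  qed
  \<comment> \<open>With this rate the penalisation is a strict supersolution, because \<open>x\<^bsup>2k\<^esup> \<le> 1 + x\<^bsup>2k+2\<^esup>\<close>.\<close>
  define \<kappa> where "\<kappa> = shigh\<^sup>2 * real (2 * k + 2) * real (2 * k + 1) / 2 + 1"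
  have \<kappa>: "\<kappa> > 0" unfolding \<kappa>_def by (intro add_nonneg_pos) auto
  define q :: "real \<Rightarrow> real" where "q y = 1 + y ^ (2 * k + 2)" for y
  have q1: "1 \<le> q y" for y using zero_le_even_power[of "2 * k + 2" y] by (simp add: q_def)
  define b where "b = exp (\<kappa> * t) * q x + 1 / (T - t)"
  have b: "b > 0" using q1[of x] t unfolding b_def by (intro add_pos_pos mult_pos_pos) auto
  define \<epsilon> where "\<epsilon> = \<eta> / (2 * b)"
  have \<epsilon>: "\<epsilon> > 0" using \<eta> b by (simp add: \<epsilon>_def)
  have "\<epsilon> * b = \<eta> / 2" using b by (simp add: \<epsilon>_def)
  define s where "s t y = \<epsilon> * exp (\<kappa> * t) * (1 + y ^ (2 * k + 2)) + \<epsilon> / (T - t)" for t y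
  have s_alt: "s t y = \<epsilon> * exp (\<kappa> * t) * q y + \<epsilon> / (T - t)" for t y by (simp add: s_def q_def)
  define D where "D t y = u t y - v t y - s t y" for t y
  have "s t x = \<epsilon> * b" unfolding s_alt b_def by (simp add: algebra_simps)
  then have Dpos: "D t x > 0" using \<eta> \<open>\<epsilon> * b = \<eta> / 2\<close> by (simp add: D_def \<eta>_def)
  \<comment> \<open>Outside \<open>[-R, R]\<close> the penalisation dominates the growth of \<open>u\<close>; the point \<open>x\<close> lies inside.\<close>
  define R where "R = max \<bar>x\<bar> (max 1 (2 * C / \<epsilon>))"
  have far: "D t' y \<le> 0" if t': "t' \<in> {0..<T}" and y: "R \<le> \<bar>y\<bar>" for t' y
  proof -
    have y1: "1 \<le> \<bar>y\<bar>" "2 * C / \<epsilon> \<le> \<bar>y\<bar>" using y by (auto simp: R_def)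
    have k1: "1 \<le> \<bar>y\<bar> ^ k" using y1 by (intro one_le_power)
    have "u t' y \<le> C * (1 + \<bar>y\<bar> ^ k)" using C(2)[of t' y] t' by auto
    also have "\<dots> \<le> C * (2 * \<bar>y\<bar> ^ k)" using C k1 by (intro mult_left_mono) auto
    also have "\<dots> \<le> \<epsilon> * \<bar>y\<bar> * \<bar>y\<bar> ^ k"
    proof -
      have "2 * C \<le> \<epsilon> * \<bar>y\<bar>" using y1(2) \<epsilon> by (simp add: field_simps)
      then have "2 * C * \<bar>y\<bar> ^ k \<le> \<epsilon> * \<bar>y\<bar> * \<bar>y\<bar> ^ k" by (rule mult_right_mono) simp
      then show ?thesis by (simp add: mult_ac)
    qed
    also have "\<dots> = \<epsilon> * \<bar>y\<bar> ^ (k + 1)" by simp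
    also have "\<dots> \<le> \<epsilon> * \<bar>y\<bar> ^ (2 * k + 2)" using \<epsilon> y1 by (intro mult_left_mono power_increasing) auto
    also have "\<dots> = \<epsilon> * y ^ (2 * k + 2)" by (simp add: power_even_abs)
    also have "\<dots> \<le> \<epsilon> * q y" using \<epsilon> by (intro mult_left_mono) (auto simp: q_def)
    also have "\<dots> \<le> \<epsilon> * exp (\<kappa> * t') * q y"
      using \<epsilon> \<kappa> t' q1[of y] by (intro mult_right_mono) auto
    finally have "u t' y \<le> \<epsilon> * exp (\<kappa> * t') * q y" .
    moreover have "0 \<le> \<epsilon> / (T - t')" using \<epsilon> t' by auto
    ultimately show ?thesis using nn[of t' y] t' by (simp add: D_def s_alt)
  qed
  define K where "K = C * (1 + R ^ k) + 1"
  have R: "0 \<le> R" by (auto simp: R_def)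
  have K: "K > 0" using C(1) R unfolding K_def by (intro add_nonneg_pos mult_nonneg_nonneg) auto
  define T1 where "T1 = max t (T - \<epsilon> / K)"
  have T1: "t \<le> T1" "T1 < T" using t \<epsilon> K by (auto simp: T1_def)
  have late: "D t' y \<le> 0" if t': "t' \<in> {0..<T}" "T1 \<le> t'" and y: "\<bar>y\<bar> \<le> R" for t' y
  proof -
    have "u t' y \<le> C * (1 + \<bar>y\<bar> ^ k)" using C(2)[of t' y] t' by auto
    also have "\<dots> \<le> C * (1 + R ^ k)" using C y by (intro mult_left_mono add_left_mono power_mono) auto
    also have "\<dots> \<le> K" by (simp add: K_def)
    also have "K \<le> \<epsilon> / (T - t')"
    proof -
      have "T - t' \<le> \<epsilon> / K" using t' by (auto simp: T1_def)
      then have "K * (T - t') \<le> \<epsilon>" using K by (simp add: field_simps)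
      then show ?thesis using t' by (simp add: field_simps)
    qed
    finally have "u t' y \<le> \<epsilon> / (T - t')" .
    moreover have "0 \<le> \<epsilon> * exp (\<kappa> * t') * q y" using \<epsilon> q1[of y] by auto
    ultimately show ?thesis using nn[of t' y] t' by (simp add: D_def s_alt)
  qed
  let ?K = "{0..T1} \<times> {-R..R}"
  have sub: "?K \<subseteq> {0..T} \<times> UNIV" using T1 by auto
  have "compact ?K" by (intro compact_Times) auto
  moreover have mem: "(t, x) \<in> ?K" using t T1 by (auto simp: R_def)
  moreover have "continuous_on ?K (\<lambda>z. D (fst z) (snd z))"
  proof -
    have "continuous_on ?K (\<lambda>z. s (fst z) (snd z))"
      unfolding s_def using T1 by (intro continuous_intros) auto
    moreover have "continuous_on ?K (\<lambda>z. u (fst z) (snd z))" "continuous_on ?K (\<lambda>z. v (fst z) (snd z))"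
      using continuous_on_subset[OF cu sub] continuous_on_subset[OF cv sub] by (auto simp: case_prod_unfold)
    ultimately show ?thesis unfolding D_def by (intro continuous_intros)
  qed
  ultimately have "\<exists>z\<in>?K. \<forall>w\<in>?K. D (fst w) (snd w) \<le> D (fst z) (snd z)"
    by (intro continuous_attains_sup) auto
  then obtain z where z: "z \<in> ?K" "\<And>w. w \<in> ?K \<Longrightarrow> D (fst w) (snd w) \<le> D (fst z) (snd z)" by blast
  define t0 x0 where "t0 = fst z" and "x0 = snd z"
  have D0: "D t0 x0 > 0" using z(2)[OF mem] Dpos by (simp add: t0_def x0_def)
  have max: "D t' y \<le> D t0 x0" if "t' \<in> {0..<T}" for t' y
  proof (cases "\<bar>y\<bar> \<le> R \<and> t' \<le> T1")
    case True
    then have "(t', y) \<in> ?K" using that by auto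
    from z(2)[OF this] show ?thesis by (simp add: t0_def x0_def)
  next
    case False
    then have "D t' y \<le> 0" using far[OF that, of y] late[OF that, of y] by linarith
    then show ?thesis using D0 by simp
  qed
  have "t0 \<noteq> 0"
  proof
    assume "t0 = 0"
    then have "s t0 x0 > 0" using \<epsilon> q1[of x0] T1 t unfolding s_alt by (intro add_pos_pos) auto
    then show False using D0 u0[of x0] init[of x0] \<open>t0 = 0\<close> by (simp add: D_def)
  qed
  then have t0: "t0 \<in> {0<..<T}" using z(1) T1 by (auto simp: t0_def)
  let ?\<psi> = "\<lambda>t x. v t x + s t x"
  let ?st = "\<lambda>t y. \<epsilon> * \<kappa> * exp (\<kappa> * t) * (1 + y ^ (2 * k + 2)) + \<epsilon> / (T - t)\<^sup>2"
  let ?sxx = "\<lambda>t y. \<epsilon> * exp (\<kappa> * t) * (real (2 * k + 2) * real (2 * k + 1) * y ^ (2 * k))"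
  have "C12_test T s ?st ?sxx" unfolding s_def by (rule C12_test_barrier)
  then have test: "C12_test T ?\<psi> (\<lambda>t x. vt t x + ?st t x) (\<lambda>t x. vxx t x + ?sxx t x)"
    by (rule C12_test_add[OF v])
  have "\<forall>\<^sub>F z in nhds (t0, x0). z \<in> {0<..<T} \<times> UNIV"
    using t0 by (intro eventually_nhds_in_open open_Times) auto
  then have "\<forall>\<^sub>F z in nhds (t0, x0). u (fst z) (snd z) - ?\<psi> (fst z) (snd z) \<le> u t0 x0 - ?\<psi> t0 x0"
  proof (rule eventually_mono)
    fix z :: "real \<times> real" assume "z \<in> {0<..<T} \<times> UNIV"
    then have "fst z \<in> {0..<T}" by auto
    from max[OF this, of "snd z"] show "u (fst z) (snd z) - ?\<psi> (fst z) (snd z) \<le> u t0 x0 - ?\<psi> t0 x0"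
      by (simp add: D_def)
  qed
  then have sub: "(vt t0 x0 + ?st t0 x0) - G_fun slow shigh (vxx t0 x0 + ?sxx t0 x0) \<le> 0"
    using u test t0 unfolding viscosity_solution_def by blast
  have sxx: "0 \<le> ?sxx t0 x0"
    using \<epsilon> by (intro mult_nonneg_nonneg) (auto simp: zero_le_even_power)
  have "G_fun slow shigh (vxx t0 x0 + ?sxx t0 x0) \<le> vt t0 x0 + shigh\<^sup>2 * ?sxx t0 x0 / 2"
    using G_fun_add_le[OF sig sxx, of "vxx t0 x0"] super[OF t0, of x0] by linarith
  with sub have "?st t0 x0 \<le> shigh\<^sup>2 * ?sxx t0 x0 / 2" by linarith
  moreover have "\<epsilon> / (T - t0)\<^sup>2 > 0" using \<epsilon> t0 by auto
  ultimately have le: "\<epsilon> * \<kappa> * exp (\<kappa> * t0) * q x0 < shigh\<^sup>2 * ?sxx t0 x0 / 2" unfolding q_def by linarith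
  have xk: "x0 ^ (2 * k) \<le> q x0"
  proof (cases "\<bar>x0\<bar> \<le> 1")
    case True
    then have "\<bar>x0\<bar> ^ (2 * k) \<le> 1" by (intro power_le_one) auto
    then show ?thesis using q1[of x0] by (simp add: power_even_abs)
  next
    case False
    then have "\<bar>x0\<bar> ^ (2 * k) \<le> \<bar>x0\<bar> ^ (2 * k + 2)" by (intro power_increasing) auto
    then show ?thesis by (simp add: power_even_abs q_def)
  qed
  have "shigh\<^sup>2 * ?sxx t0 x0 / 2 = \<epsilon> * exp (\<kappa> * t0) * ((\<kappa> - 1) * x0 ^ (2 * k))"
    by (simp add: \<kappa>_def field_simps)
  also have "\<dots> \<le> \<epsilon> * exp (\<kappa> * t0) * (\<kappa> * q x0)"
  proof -
    have "(\<kappa> - 1) * x0 ^ (2 * k) \<le> (\<kappa> - 1) * q x0"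
      using xk by (intro mult_left_mono) (auto simp: \<kappa>_def)
    also have "\<dots> \<le> \<kappa> * q x0" using q1[of x0] by (intro mult_right_mono) auto
    finally show ?thesis using \<epsilon> by (intro mult_left_mono) auto
  qed
  finally show False using le by (simp add: mult_ac)
qed

lemma viscosity_second_moment:
  assumes u: "viscosity_solution T (G_fun slow shigh) (\<lambda>x. x\<^sup>2) u"
    and sig: "slow\<^sup>2 \<le> shigh\<^sup>2" and t: "t \<in> {0..<T}"
  shows "u t x \<le> x\<^sup>2 + shigh\<^sup>2 * t"
proof (rule viscosity_solution_le_supersolution[OF u sig _ _ _ _ _ t])
  show "C12_test T (\<lambda>t x. x\<^sup>2 + shigh\<^sup>2 * t) (\<lambda>t x. shigh\<^sup>2) (\<lambda>t x. 2)"
    unfolding C12_test_def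
    by (rule exI[of _ "\<lambda>t x. 2 * x"])
       (auto intro!: derivative_eq_intros continuous_intros simp: case_prod_unfold)
  show "continuous_on ({0..T} \<times> UNIV) (\<lambda>(t, x). x\<^sup>2 + shigh\<^sup>2 * t)"
    by (auto intro!: continuous_intros simp: case_prod_unfold)
qed (auto simp: G_fun_def)

lemma viscosity_fourth_moment:
  assumes u: "viscosity_solution T (G_fun slow shigh) (\<lambda>x. x ^ 4) u"
    and sig: "slow\<^sup>2 \<le> shigh\<^sup>2" and t: "t \<in> {0..<T}"
  shows "u t x \<le> x ^ 4 + 6 * shigh\<^sup>2 * t * x\<^sup>2 + 3 * shigh ^ 4 * t\<^sup>2"
proof (rule viscosity_solution_le_supersolution[OF u sig _ _ _ _ _ t])
  show "C12_test T (\<lambda>t x. x ^ 4 + 6 * shigh\<^sup>2 * t * x\<^sup>2 + 3 * shigh ^ 4 * t\<^sup>2)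
      (\<lambda>t x. 6 * shigh\<^sup>2 * x\<^sup>2 + 6 * shigh ^ 4 * t) (\<lambda>t x. 12 * x\<^sup>2 + 12 * shigh\<^sup>2 * t)"
    unfolding C12_test_def
    by (rule exI[of _ "\<lambda>t x. 4 * x ^ 3 + 12 * shigh\<^sup>2 * t * x"])
       (auto intro!: derivative_eq_intros continuous_intros simp: case_prod_unfold)
  show "continuous_on ({0..T} \<times> UNIV) (\<lambda>(t, x). x ^ 4 + 6 * shigh\<^sup>2 * t * x\<^sup>2 + 3 * shigh ^ 4 * t\<^sup>2)"
    by (auto intro!: continuous_intros simp: case_prod_unfold)
  fix t x :: real assume "t \<in> {0<..<T}"
  then have "0 \<le> 12 * x\<^sup>2 + 12 * shigh\<^sup>2 * t" by auto
  then have "max (12 * x\<^sup>2 + 12 * shigh\<^sup>2 * t) 0 = 12 * x\<^sup>2 + 12 * shigh\<^sup>2 * t"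
    "max (- (12 * x\<^sup>2 + 12 * shigh\<^sup>2 * t)) 0 = 0" by auto
  then show "G_fun slow shigh (12 * x\<^sup>2 + 12 * shigh\<^sup>2 * t) \<le> 6 * shigh\<^sup>2 * x\<^sup>2 + 6 * shigh ^ 4 * t"
    unfolding G_fun_def by (simp add: field_simps power4_eq_xxxx power2_eq_square)
qed auto

section \<open>Moments under the \<open>G\<close>-expectation\<close>

locale G_setting = path_probabilities +
  fixes slow shigh :: real and E :: "rvar \<Rightarrow> real"
  assumes sigma: "slow\<^sup>2 \<le> shigh\<^sup>2"
    and GE: "G_expectation T slow shigh E"
    and rep: "\<And>\<xi>. \<xi> \<in> L_G T PP 1 \<Longrightarrow> E \<xi> = (SUP P\<in>PP. \<integral>\<omega>. \<xi> \<omega> \<partial>(completion P))"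
begin

lemma heat_equation:
  "\<phi> \<in> C_l_Lip 1 \<Longrightarrow> \<exists>u. viscosity_solution T (G_fun slow shigh) (\<lambda>x. \<phi> [x]) u \<and>
    (\<forall>s t x. 0 \<le> s \<longrightarrow> s \<le> t \<longrightarrow> t \<le> T \<longrightarrow> E (\<lambda>\<omega>. \<phi> [x + canonical t \<omega> - canonical s \<omega>]) = u (t - s) x)"
  using GE unfolding G_expectation_def by (elim conjE) (drule bspec, assumption, assumption)

lemma E_mono: "\<xi> \<in> L_ip T \<Longrightarrow> \<zeta> \<in> L_ip T \<Longrightarrow> (\<And>\<omega>. \<omega> \<in> Omega T \<Longrightarrow> \<xi> \<omega> \<le> \<zeta> \<omega>) \<Longrightarrow> E \<xi> \<le> E \<zeta>"
  and E_const: "E (\<lambda>_. c) = c"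
  and E_add: "\<xi> \<in> L_ip T \<Longrightarrow> \<zeta> \<in> L_ip T \<Longrightarrow> E (\<lambda>\<omega>. \<xi> \<omega> + \<zeta> \<omega>) \<le> E \<xi> + E \<zeta>"
  and E_scale: "\<xi> \<in> L_ip T \<Longrightarrow> a \<ge> 0 \<Longrightarrow> E (\<lambda>\<omega>. a * \<xi> \<omega>) = a * E \<xi>"
  using GE unfolding G_expectation_def sublinear_expectation_def by auto

lemma L_ip_subset_L_G: "\<xi> \<in> L_ip T \<Longrightarrow> \<xi> \<in> L_G T PP 1"
  unfolding L_G_def by (auto intro!: exI[of _ "\<lambda>_. \<xi>"] simp: UE_zero)

text \<open>
  The representation of \<open>E\<close> is a supremum of real numbers and of Bochner integrals, hence only informative
  for integrands that are integrable with a common bound. It is applied to the truncations \<open>min \<xi> n\<close>, and monotone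
  convergence does the rest.
\<close>
lemma UE_le_E:
  assumes \<xi>: "\<xi> \<in> L_ip T" and nn: "\<And>\<omega>. \<omega> \<in> Omega T \<Longrightarrow> 0 \<le> \<xi> \<omega>"
  shows "UE (\<lambda>\<omega>. ennreal (\<xi> \<omega>)) \<le> ennreal (E \<xi>)"
proof -
  have "UE (\<lambda>\<omega>. ennreal (\<xi> \<omega>)) \<le> (SUP P\<in>PP. \<integral>\<^sup>+\<omega>. ennreal (\<xi> \<omega>) \<partial>P)"
    unfolding upper_expectation_eq_upper_sup
    using L_ip_measurable[OF \<xi>, of T] by (intro upper_sup_le) auto
  also have "\<dots> \<le> ennreal (E \<xi>)"
  proof (rule SUP_least)
    fix P assume P: "P \<in> PP"
    interpret P: prob_space P using PP_prob[OF P] .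
    have sp: "space P = Omega T" using sets_eq_imp_space_eq[OF PP_sets[OF P]] by simp
    define \<xi>n where "\<xi>n n \<omega> = min (\<xi> \<omega>) (real n)" for n \<omega>
    have \<xi>n: "\<xi>n n \<in> L_ip T" for n
      unfolding \<xi>n_def by (rule L_ip_contraction[OF \<xi>]) (auto simp: min_def abs_if)
    have meas: "\<xi>n n \<in> borel_measurable Q" if "Q \<in> PP" for n Q
      by (rule borel_measurable_sets_eq[OF PP_sets[OF that] L_ip_measurable[OF \<xi>n]])
    have int: "integrable Q (\<xi>n n)" "integral\<^sup>L Q (\<xi>n n) \<le> real n" if Q: "Q \<in> PP" for n Q
    proof -
      interpret Q: prob_space Q using PP_prob[OF Q] .
      have sq: "space Q = Omega T" using sets_eq_imp_space_eq[OF PP_sets[OF Q]] by simp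
      show i: "integrable Q (\<xi>n n)"
        using nn sq by (intro Q.integrable_const_bound[of _ "real n"] meas[OF Q] AE_I2) (auto simp: \<xi>n_def)
      show "integral\<^sup>L Q (\<xi>n n) \<le> real n"
        by (rule Q.integral_le_const[OF i], rule AE_I2) (simp add: \<xi>n_def)
    qed
    have bound: "(\<integral>\<^sup>+\<omega>. ennreal (\<xi>n n \<omega>) \<partial>P) \<le> ennreal (E \<xi>)" for n
    proof -
      have c: "integral\<^sup>L (completion Q) (\<xi>n n) = integral\<^sup>L Q (\<xi>n n)" if "Q \<in> PP" for Q
        by (rule integral_completion[OF meas[OF that]])
      have "integral\<^sup>L P (\<xi>n n) \<le> (SUP Q\<in>PP. \<integral>\<omega>. \<xi>n n \<omega> \<partial>(completion Q))"
      proof (rule cSUP_upper2[OF _ P])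
        show "bdd_above ((\<lambda>Q. \<integral>\<omega>. \<xi>n n \<omega> \<partial>(completion Q)) ` PP)"
          by (rule bdd_aboveI2[of _ _ "real n"]) (simp only: c int(2))
        show "integral\<^sup>L P (\<xi>n n) \<le> (\<integral>\<omega>. \<xi>n n \<omega> \<partial>(completion P))" by (simp only: c[OF P] order_refl)
      qed
      also have "\<dots> = E (\<xi>n n)" by (rule rep[symmetric, OF L_ip_subset_L_G[OF \<xi>n]])
      also have "\<dots> \<le> E \<xi>" by (rule E_mono[OF \<xi>n \<xi>]) (auto simp: \<xi>n_def)
      finally have "integral\<^sup>L P (\<xi>n n) \<le> E \<xi>" .
      moreover have "(\<integral>\<^sup>+\<omega>. ennreal (\<xi>n n \<omega>) \<partial>P) = ennreal (integral\<^sup>L P (\<xi>n n))"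
        using nn sp by (intro nn_integral_eq_integral int(1)[OF P] AE_I2) (auto simp: \<xi>n_def)
      ultimately show ?thesis by (simp add: ennreal_leI)
    qed
    have sup: "ennreal (\<xi> \<omega>) = (SUP n. ennreal (\<xi>n n \<omega>))" for \<omega>
    proof (rule antisym)
      obtain n where "\<xi> \<omega> \<le> real n" using real_arch_simple by blast
      then have "\<xi> \<omega> = \<xi>n n \<omega>" by (simp add: \<xi>n_def)
      then show "ennreal (\<xi> \<omega>) \<le> (SUP n. ennreal (\<xi>n n \<omega>))" by (auto intro: SUP_upper2)
      show "(SUP n. ennreal (\<xi>n n \<omega>)) \<le> ennreal (\<xi> \<omega>)" by (auto intro!: SUP_least ennreal_leI simp: \<xi>n_def)
    qed
    have "(\<integral>\<^sup>+\<omega>. ennreal (\<xi> \<omega>) \<partial>P) = (SUP n. \<integral>\<^sup>+\<omega>. ennreal (\<xi>n n \<omega>) \<partial>P)"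
      unfolding sup
    proof (rule nn_integral_monotone_convergence_SUP)
      show "incseq (\<lambda>n \<omega>. ennreal (\<xi>n n \<omega>))"
        by (auto simp: incseq_def le_fun_def \<xi>n_def intro!: ennreal_leI min.mono)
      show "(\<lambda>\<omega>. ennreal (\<xi>n n \<omega>)) \<in> borel_measurable P" for n
        by (rule measurable_compose[OF meas[OF P] measurable_ennreal])
    qed
    also have "\<dots> \<le> ennreal (E \<xi>)" by (rule SUP_least) (rule bound)
    finally show "(\<integral>\<^sup>+\<omega>. ennreal (\<xi> \<omega>) \<partial>P) \<le> ennreal (E \<xi>)" .
  qed
  finally show ?thesis .
qed

lemma C_l_Lip_power: "\<phi> \<in> C_l_Lip n \<Longrightarrow> (\<lambda>x. \<phi> x ^ k) \<in> C_l_Lip n"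
  by (induction k) (auto intro: C_l_Lip_const C_l_Lip_mult)

text \<open>
  The polynomials \<open>x\<^sup>2 + shigh\<^sup>2 t\<close> and \<open>x\<^sup>4 + 6 shigh\<^sup>2 t x\<^sup>2 + 3 shigh\<^sup>4 t\<^sup>2\<close> solve the heat equation with
  the largest variance and are convex in \<open>x\<close>, so they are solutions of the \<open>G\<close>-heat equation and bound the moments
  at \<open>x = 0\<close>.
\<close>
lemma increment_moments:
  assumes st: "0 \<le> s" "s \<le> t" "t \<le> T" "t - s < T"
  shows "E (\<lambda>\<omega>. (canonical t \<omega> - canonical s \<omega>)\<^sup>2) \<le> shigh\<^sup>2 * (t - s)"
    and "E (\<lambda>\<omega>. (canonical t \<omega> - canonical s \<omega>) ^ 4) \<le> 3 * shigh ^ 4 * (t - s)\<^sup>2"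
proof -
  have pow: "\<exists>u. viscosity_solution T (G_fun slow shigh) (\<lambda>x. x ^ k) u \<and>
      E (\<lambda>\<omega>. (canonical t \<omega> - canonical s \<omega>) ^ k) = u (t - s) 0" for k
  proof -
    have "(\<lambda>x. (x ! 0) ^ k) \<in> C_l_Lip 1" by (intro C_l_Lip_power C_l_Lip_nth) simp
    then obtain u where u: "viscosity_solution T (G_fun slow shigh) (\<lambda>x. [x] ! 0 ^ k) u"
      "\<And>s t x. 0 \<le> s \<Longrightarrow> s \<le> t \<Longrightarrow> t \<le> T \<Longrightarrow> E (\<lambda>\<omega>. [x + canonical t \<omega> - canonical s \<omega>] ! 0 ^ k) = u (t - s) x"
      using heat_equation by force
    show ?thesis using u(1) u(2)[OF st(1-3), of 0] by (intro exI[of _ u]) simp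
  qed
  have d: "t - s \<in> {0..<T}" using st by auto
  show "E (\<lambda>\<omega>. (canonical t \<omega> - canonical s \<omega>)\<^sup>2) \<le> shigh\<^sup>2 * (t - s)"
    using pow[of 2] viscosity_second_moment[OF _ sigma d, of _ 0] by auto
  show "E (\<lambda>\<omega>. (canonical t \<omega> - canonical s \<omega>) ^ 4) \<le> 3 * shigh ^ 4 * (t - s)\<^sup>2"
    using pow[of 4] viscosity_fourth_moment[OF _ sigma d, of _ 0] by auto
qed

text \<open>
  The supermartingale property of \<open>B\<^sup>2 - shigh\<^sup>2 t\<close> against a nonnegative weight from the past. The weight
  is frozen in the inner expectation, where it factors out by positive homogeneity; what remains has a nonpositive
  expectation by the second moment bound.
\<close>
lemma E_nonpositive_excess:
  fixes \<delta> :: real and m i :: nat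
  assumes \<delta>: "0 < \<delta>" "\<delta> < T" and m: "real (Suc m) * \<delta> \<le> T"
  defines "\<xi> \<equiv> \<lambda>j \<omega>. (canonical (real (Suc j) * \<delta>) \<omega> - canonical (real j * \<delta>) \<omega>)\<^sup>2 - shigh\<^sup>2 * \<delta>"
  shows "E (\<lambda>\<omega>. 2 * max (\<Sum>j\<in>{i..<m}. \<xi> j \<omega>) 0 * \<xi> m \<omega>) \<le> 0"
proof -
  define ts where "ts = map (\<lambda>j. real j * \<delta>) [0..<Suc m]"
  define Y where "Y xs = max (\<Sum>j\<in>{i..<m}. (xs ! Suc j - xs ! j)\<^sup>2 - shigh\<^sup>2 * \<delta>) (0::real)" for xs
  define D where "D = (\<lambda>\<omega>. canonical (real (Suc m) * \<delta>) \<omega> - canonical (real m * \<delta>) \<omega>)"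
  define \<phi> where "\<phi> xs = 2 * Y xs * ((xs ! Suc m)\<^sup>2 - shigh\<^sup>2 * \<delta>)" for xs
  have len: "length ts = Suc m" by (simp add: ts_def)
  have last: "last ts = real m * \<delta>" by (simp add: ts_def)
  have diff: "(\<lambda>x. \<alpha> x - \<beta> x) \<in> C_l_Lip n" if "\<alpha> \<in> C_l_Lip n" "\<beta> \<in> C_l_Lip n" for \<alpha> \<beta> n
    using C_l_Lip_add[OF that(1) C_l_Lip_mult[OF C_l_Lip_const that(2), of "-1"]] by simp
  have sum: "(\<lambda>x. \<Sum>j\<in>J. \<alpha> j x) \<in> C_l_Lip n" if "finite J" "\<And>j. j \<in> J \<Longrightarrow> \<alpha> j \<in> C_l_Lip n" for \<alpha> n and J :: "nat set"
    using that by (induction J rule: finite_induct) (auto intro: C_l_Lip_const C_l_Lip_add)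
  have Y: "Y \<in> C_l_Lip n" if "Suc m \<le> n" for n
    unfolding Y_def
    by (rule C_l_Lip_contraction[where \<kappa> = "\<lambda>a. max a 0"], intro sum diff C_l_Lip_power C_l_Lip_nth C_l_Lip_const)
       (use that in \<open>auto simp: max_def abs_if\<close>)
  have \<phi>: "\<phi> \<in> C_l_Lip (Suc (length ts))"
    unfolding \<phi>_def len by (intro C_l_Lip_mult Y diff C_l_Lip_power C_l_Lip_nth C_l_Lip_const) auto
  have DL: "D \<in> L_ip T" unfolding D_def
    using \<delta> m by (intro L_ip_diff L_ip_canonical) (auto simp: algebra_simps)
  have D2: "(\<lambda>\<omega>. (D \<omega>)\<^sup>2) \<in> L_ip T" using L_ip_mult[OF DL DL] by (simp add: power2_eq_square)
  have D2': "(\<lambda>\<omega>. (D \<omega>)\<^sup>2 - shigh\<^sup>2 * \<delta>) \<in> L_ip T" by (intro L_ip_diff D2 L_ip_const)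
  define e where "e = E (\<lambda>\<omega>. (D \<omega>)\<^sup>2 - shigh\<^sup>2 * \<delta>)"
  have e: "e \<le> 0"
  proof -
    have "e \<le> E (\<lambda>\<omega>. (D \<omega>)\<^sup>2) + E (\<lambda>_. - (shigh\<^sup>2 * \<delta>))"
      using E_add[OF D2 L_ip_const, of "- (shigh\<^sup>2 * \<delta>)"] by (simp add: e_def)
    also have "E (\<lambda>\<omega>. (D \<omega>)\<^sup>2) \<le> shigh\<^sup>2 * (real (Suc m) * \<delta> - real m * \<delta>)"
      unfolding D_def using \<delta> m by (intro increment_moments) (auto simp: algebra_simps)
    finally show ?thesis by (simp add: E_const algebra_simps)
  qed
  have eq1: "\<phi> (xs @ [d]) = 2 * Y xs * (d\<^sup>2 - shigh\<^sup>2 * \<delta>)" if "length xs = Suc m" for xs d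
  proof -
    have "Y (xs @ [d]) = Y xs" unfolding Y_def using that by (intro arg_cong[where f = "\<lambda>z. max z 0"] sum.cong) (auto simp: nth_append)
    then show ?thesis using that by (simp add: \<phi>_def nth_append)
  qed
  have inner: "E (\<lambda>\<omega>'. \<phi> (xs @ [D \<omega>'])) = 2 * Y xs * e" if "length xs = Suc m" for xs
  proof -
    have "0 \<le> 2 * Y xs" by (simp add: Y_def)
    then show ?thesis unfolding eq1[OF that] e_def by (rule E_scale[OF D2'])
  qed
  have "E (\<lambda>\<omega>. \<phi> (map (\<lambda>s. canonical s \<omega>) ts @ [canonical (real (Suc m) * \<delta>) \<omega> - canonical (last ts) \<omega>])) =
        E (\<lambda>\<omega>. (\<lambda>xs. E (\<lambda>\<omega>'. \<phi> (xs @ [canonical (real (Suc m) * \<delta>) \<omega>' - canonical (last ts) \<omega>'])))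
                  (map (\<lambda>s. canonical s \<omega>) ts))"
  proof -
    have "set ts \<subseteq> {0..real (Suc m) * \<delta>}" using \<delta> by (auto simp: ts_def intro!: mult_right_mono)
    moreover have "sorted ts" unfolding ts_def sorted_map
      using \<delta> by (intro sorted_wrt_mono_rel[OF _ sorted_upt]) (auto intro: mult_right_mono)
    moreover have "ts \<noteq> []" using len by auto
    ultimately show ?thesis using GE \<phi> m unfolding G_expectation_def by blast
  qed
  also have "\<dots> = E (\<lambda>\<omega>. 2 * Y (map (\<lambda>s. canonical s \<omega>) ts) * e)"
    using inner len by (simp add: last D_def)
  also have "\<dots> \<le> E (\<lambda>_. 0)"
  proof (rule E_mono)
    have "set ts \<subseteq> {0..T}" using \<delta> m
    proof -
      have "real j * \<delta> \<le> T" if "j < Suc m" for j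
      proof -
        have "real j * \<delta> \<le> real (Suc m) * \<delta>" using that \<delta> by (intro mult_right_mono) auto
        then show ?thesis using m by simp
      qed
      then show ?thesis using \<delta> by (auto simp: ts_def)
    qed
    then have "(\<lambda>\<omega>. Y (map (\<lambda>s. canonical s \<omega>) ts)) \<in> L_ip T" using Y len by (intro L_ip_I) auto
    then show "(\<lambda>\<omega>. 2 * Y (map (\<lambda>s. canonical s \<omega>) ts) * e) \<in> L_ip T" by (intro L_ip_mult L_ip_const)
    show "(\<lambda>_. 0) \<in> L_ip T" by (rule L_ip_const)
    fix \<omega>
    show "2 * Y (map (\<lambda>s. canonical s \<omega>) ts) * e \<le> 0"
      using e by (intro mult_nonneg_nonpos) (auto simp: Y_def)
  qed
  also have "\<dots> = 0" by (rule E_const)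
  finally have "E (\<lambda>\<omega>. \<phi> (map (\<lambda>s. canonical s \<omega>) ts @ [D \<omega>])) \<le> 0" by (simp add: D_def last)
  moreover have "\<phi> (map (\<lambda>s. canonical s \<omega>) ts @ [D \<omega>]) = 2 * max (\<Sum>j\<in>{i..<m}. \<xi> j \<omega>) 0 * \<xi> m \<omega>" for \<omega>
  proof -
    have nth: "map (\<lambda>s. canonical s \<omega>) ts ! j = canonical (real j * \<delta>) \<omega>" if "j \<le> m" for j
      using that by (simp add: ts_def del: upt_Suc)
    have "Y (map (\<lambda>s. canonical s \<omega>) ts) = max (\<Sum>j\<in>{i..<m}. \<xi> j \<omega>) 0"
      unfolding Y_def \<xi>_def
      by (intro arg_cong[where f = "\<lambda>z. max z 0"] sum.cong refl) (subst nth, simp, subst nth, simp, simp)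
    then show ?thesis by (subst eq1) (auto simp: len \<xi>_def D_def)
  qed
  ultimately show ?thesis by simp
qed

text \<open>
  Induction on the number of increments by means of
  \<open>((y + \<xi>)\<^sup>+)\<^sup>2 \<le> (y\<^sup>+)\<^sup>2 + 2 y\<^sup>+ \<xi> + \<xi>\<^sup>2\<close>: the middle term contributes at most zero, and the last one at most
  \<open>4 shigh\<^sup>4 \<delta>\<^sup>2\<close>. For a mesh tending to zero the total vanishes.
\<close>
lemma E_excess_square:
  fixes \<delta> :: real and m i :: nat
  assumes \<delta>: "0 < \<delta>" "\<delta> < T" and m: "real m * \<delta> \<le> T" and i: "i \<le> m"
  defines "\<xi> \<equiv> \<lambda>j \<omega>. (canonical (real (Suc j) * \<delta>) \<omega> - canonical (real j * \<delta>) \<omega>)\<^sup>2 - shigh\<^sup>2 * \<delta>"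
  shows "(\<lambda>\<omega>. (max (\<Sum>j\<in>{i..<m}. \<xi> j \<omega>) 0)\<^sup>2) \<in> L_ip T \<and>
    E (\<lambda>\<omega>. (max (\<Sum>j\<in>{i..<m}. \<xi> j \<omega>) 0)\<^sup>2) \<le> real (m - i) * (4 * shigh ^ 4 * \<delta>\<^sup>2)"
  using i m
proof (induction m rule: dec_induct)
  case base
  then show ?case by (simp add: L_ip_const E_const)
next
  case (step m)
  have tm: "real j * \<delta> \<le> T" if "j \<le> Suc m" for j
  proof -
    have "real j * \<delta> \<le> real (Suc m) * \<delta>" using that \<delta> by (intro mult_right_mono) auto
    then show ?thesis using step.prems by simp
  qed
  have inc: "(\<lambda>\<omega>. canonical (real (Suc j) * \<delta>) \<omega> - canonical (real j * \<delta>) \<omega>) \<in> L_ip T" if "j \<le> m" for j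
    using \<delta> tm[of j] tm[of "Suc j"] that by (intro L_ip_diff L_ip_canonical) auto
  have \<xi>L: "\<xi> j \<in> L_ip T" if "j \<le> m" for j
    unfolding \<xi>_def power2_eq_square by (intro L_ip_diff[OF L_ip_mult[OF inc inc] L_ip_const] that)
  have SL: "(\<lambda>\<omega>. \<Sum>j\<in>{i..<m}. \<xi> j \<omega>) \<in> L_ip T" "(\<lambda>\<omega>. \<Sum>j\<in>{i..<Suc m}. \<xi> j \<omega>) \<in> L_ip T"
    by (intro L_ip_sum; auto intro!: \<xi>L)+
  have c: "\<bar>max a 0 - max b 0\<bar> \<le> \<bar>a - b\<bar>" for a b :: real by (auto simp: max_def)
  note PL = L_ip_contraction[OF SL(1) c] L_ip_contraction[OF SL(2) c]
  define P where "P \<omega> = max (\<Sum>j\<in>{i..<m}. \<xi> j \<omega>) 0" for \<omega>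
  have P: "P \<in> L_ip T" using PL(1) unfolding P_def .
  have P2: "(\<lambda>\<omega>. (P \<omega>)\<^sup>2) \<in> L_ip T" using L_ip_mult[OF P P] by (simp add: power2_eq_square)
  have PX: "(\<lambda>\<omega>. 2 * P \<omega> * \<xi> m \<omega>) \<in> L_ip T" by (intro L_ip_mult L_ip_const P \<xi>L) simp
  have X2: "(\<lambda>\<omega>. (\<xi> m \<omega>)\<^sup>2) \<in> L_ip T" using L_ip_mult[OF \<xi>L \<xi>L, of m m] by (simp add: power2_eq_square)
  define D where "D \<omega> = canonical (real (Suc m) * \<delta>) \<omega> - canonical (real m * \<delta>) \<omega>" for \<omega>
  have D: "D \<in> L_ip T" unfolding D_def by (rule inc) simp
  have D4: "(\<lambda>\<omega>. D \<omega> ^ 4) \<in> L_ip T"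
    using L_ip_mult[OF L_ip_mult[OF D D] L_ip_mult[OF D D]] by (simp add: power4_eq_xxxx mult.assoc)
  have "E (\<lambda>\<omega>. (\<xi> m \<omega>)\<^sup>2) \<le> E (\<lambda>\<omega>. D \<omega> ^ 4 + shigh ^ 4 * \<delta>\<^sup>2)"
  proof (rule E_mono[OF X2 L_ip_add[OF D4 L_ip_const]])
    fix \<omega>
    have "(\<xi> m \<omega>)\<^sup>2 = D \<omega> ^ 4 - 2 * (D \<omega>)\<^sup>2 * (shigh\<^sup>2 * \<delta>) + shigh ^ 4 * \<delta>\<^sup>2"
      unfolding \<xi>_def D_def by (simp add: power2_eq_square power4_eq_xxxx algebra_simps)
    moreover have "0 \<le> 2 * (D \<omega>)\<^sup>2 * (shigh\<^sup>2 * \<delta>)" using \<delta> by simp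
    ultimately show "(\<xi> m \<omega>)\<^sup>2 \<le> D \<omega> ^ 4 + shigh ^ 4 * \<delta>\<^sup>2" by linarith
  qed
  also have "\<dots> \<le> E (\<lambda>\<omega>. D \<omega> ^ 4) + shigh ^ 4 * \<delta>\<^sup>2"
    using E_add[OF D4 L_ip_const, of "shigh ^ 4 * \<delta>\<^sup>2"] by (simp add: E_const)
  also have "E (\<lambda>\<omega>. D \<omega> ^ 4) \<le> 3 * shigh ^ 4 * (real (Suc m) * \<delta> - real m * \<delta>)\<^sup>2"
    unfolding D_def using \<delta> step.prems by (intro increment_moments) (auto simp: algebra_simps)
  finally have X2E: "E (\<lambda>\<omega>. (\<xi> m \<omega>)\<^sup>2) \<le> 4 * shigh ^ 4 * \<delta>\<^sup>2" by (simp add: algebra_simps)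
  have PXE: "E (\<lambda>\<omega>. 2 * P \<omega> * \<xi> m \<omega>) \<le> 0"
    unfolding P_def \<xi>_def using E_nonpositive_excess[OF \<delta> step.prems] .
  have IH: "E (\<lambda>\<omega>. (P \<omega>)\<^sup>2) \<le> real (m - i) * (4 * shigh ^ 4 * \<delta>\<^sup>2)"
    using step.IH tm[of m] unfolding P_def by auto
  have sum: "(\<Sum>j\<in>{i..<Suc m}. \<xi> j \<omega>) = (\<Sum>j\<in>{i..<m}. \<xi> j \<omega>) + \<xi> m \<omega>" for \<omega>
    using step.hyps by simp
  have L: "(\<lambda>\<omega>. (max (\<Sum>j\<in>{i..<Suc m}. \<xi> j \<omega>) 0)\<^sup>2) \<in> L_ip T"
    using L_ip_mult[OF PL(2) PL(2)] by (simp add: power2_eq_square)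
  have "E (\<lambda>\<omega>. (max (\<Sum>j\<in>{i..<Suc m}. \<xi> j \<omega>) 0)\<^sup>2) \<le> E (\<lambda>\<omega>. ((P \<omega>)\<^sup>2 + 2 * P \<omega> * \<xi> m \<omega>) + (\<xi> m \<omega>)\<^sup>2)"
  proof (rule E_mono[OF L L_ip_add[OF L_ip_add[OF P2 PX] X2]])
    fix \<omega>
    have "(max (\<Sum>j\<in>{i..<Suc m}. \<xi> j \<omega>) 0)\<^sup>2 \<le> (P \<omega> + \<xi> m \<omega>)\<^sup>2"
      unfolding sum P_def by (rule abs_le_square_iff[THEN iffD1]) (auto simp: max_def abs_if)
    then show "(max (\<Sum>j\<in>{i..<Suc m}. \<xi> j \<omega>) 0)\<^sup>2 \<le> (P \<omega>)\<^sup>2 + 2 * P \<omega> * \<xi> m \<omega> + (\<xi> m \<omega>)\<^sup>2"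
      by (simp add: power2_sum)
  qed
  also have "\<dots> \<le> E (\<lambda>\<omega>. (P \<omega>)\<^sup>2) + E (\<lambda>\<omega>. 2 * P \<omega> * \<xi> m \<omega>) + E (\<lambda>\<omega>. (\<xi> m \<omega>)\<^sup>2)"
    using E_add[OF L_ip_add[OF P2 PX] X2] E_add[OF P2 PX] by linarith
  also have "\<dots> \<le> real (m - i) * (4 * shigh ^ 4 * \<delta>\<^sup>2) + 4 * shigh ^ 4 * \<delta>\<^sup>2"
    using IH PXE X2E by linarith
  also have "\<dots> = real (Suc m - i) * (4 * shigh ^ 4 * \<delta>\<^sup>2)"
    using step.hyps by (simp add: Suc_diff_le algebra_simps)
  finally show ?case using L by blast
qed

end

section \<open>The quadratic variation is Lipschitz\<close>

lemma uniform_grid_partition: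
  assumes "0 < (\<delta>::real)" shows "is_partition (real N * \<delta>) N (\<lambda>j. real j * \<delta>)"
  using assms by (auto simp: is_partition_def)

lemma floor_grid_tendsto:
  fixes T t :: real
  assumes T: "T > 0" and t: "t \<in> {0..T}"
  shows "(\<lambda>M. real (nat \<lfloor>t * real (Suc M) / T\<rfloor>) * (T / real (Suc M))) \<longlonglongrightarrow> t"
proof -
  define g where "g M = real (nat \<lfloor>t * real (Suc M) / T\<rfloor>) * (T / real (Suc M))" for M
  have bound: "norm (g M - t) \<le> T * inverse (real (Suc M))" for M
  proof -
    define x where "x = t * real (Suc M) / T"
    have x: "0 \<le> x" "t = x * (T / real (Suc M))" using T t by (auto simp: x_def)
    have "real (nat \<lfloor>x\<rfloor>) \<le> x" "x \<le> real (nat \<lfloor>x\<rfloor>) + 1" using x(1) by linarith+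
    then have b: "\<bar>real (nat \<lfloor>x\<rfloor>) - x\<bar> \<le> 1" by linarith
    have "\<bar>real (nat \<lfloor>x\<rfloor>) * (T / real (Suc M)) - t\<bar> = \<bar>real (nat \<lfloor>x\<rfloor>) - x\<bar> * (T / real (Suc M))"
    proof -
      have "0 \<le> T / real (Suc M)" using T by simp
      then show ?thesis by (subst x(2)) (metis abs_mult abs_of_nonneg left_diff_distrib)
    qed
    also have "\<dots> \<le> 1 * (T / real (Suc M))" using b T by (intro mult_right_mono) auto
    finally show ?thesis unfolding g_def x_def[symmetric] by (simp add: divide_inverse)
  qed
  have "(\<lambda>M. T * inverse (real (Suc M))) \<longlonglongrightarrow> T * 0"
    by (intro tendsto_intros LIMSEQ_inverse_real_of_nat)
  then have "(\<lambda>M. T * inverse (real (Suc M))) \<longlonglongrightarrow> 0" by simp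
  then have "(\<lambda>M. g M - t) \<longlonglongrightarrow> 0"
    by (rule Lim_null_comparison[OF always_eventually, rotated]) (use bound in blast)
  then have "g \<longlonglongrightarrow> t" by (rule LIM_zero_cancel)
  then show ?thesis unfolding g_def .
qed

text \<open>
  In this and the next lemma, \<open>A\<close> stands for an increment of the quadratic variation, \<open>R\<close> for its
  approximation by squared increments of the path, and \<open>a\<close>, \<open>b\<close> for the errors at the two end points.
\<close>
lemma square_negative_part_le:
  fixes A R a b :: real
  assumes "A - R = b - a" "0 \<le> R"
  shows "(min A 0)\<^sup>2 \<le> 2 * (a\<^sup>2 + b\<^sup>2)"
proof -
  have "(min A 0)\<^sup>2 \<le> (b - a)\<^sup>2" using assms by (intro abs_le_square_iff[THEN iffD1]) (auto simp: min_def)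
  also have "\<dots> \<le> 2 * (a\<^sup>2 + b\<^sup>2)" using zero_le_power2[of "a + b"] by (simp add: power2_eq_square algebra_simps)
  finally show ?thesis .
qed

lemma square_positive_part_le:
  fixes A R a b c :: real
  assumes "A - R = b - a"
  shows "(max (A - c) 0)\<^sup>2 \<le> 4 * ((a\<^sup>2 + b\<^sup>2) + (max (R - c) 0)\<^sup>2)"
proof -
  define w where "w = max (R - c) 0"
  have "(max (A - c) 0)\<^sup>2 \<le> (\<bar>b - a\<bar> + w)\<^sup>2" using assms
    by (intro abs_le_square_iff[THEN iffD1]) (auto simp: max_def w_def abs_if)
  also have "\<dots> \<le> 2 * \<bar>b - a\<bar>\<^sup>2 + 2 * w\<^sup>2"
    using zero_le_power2[of "\<bar>b - a\<bar> - w"] unfolding power2_sum power2_diff by linarith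
  also have "\<bar>b - a\<bar>\<^sup>2 = (b - a)\<^sup>2" by simp
  also have "(b - a)\<^sup>2 \<le> 2 * (a\<^sup>2 + b\<^sup>2)" using zero_le_power2[of "a + b"] by (simp add: power2_eq_square algebra_simps)
  also have "2 * (2 * (a\<^sup>2 + b\<^sup>2)) + 2 * w\<^sup>2 \<le> 4 * ((a\<^sup>2 + b\<^sup>2) + w\<^sup>2)" by simp
  finally show ?thesis unfolding w_def by simp
qed

context G_setting
begin

lemma quadratic_variationD:
  fixes N :: "nat \<Rightarrow> nat"
  assumes "quadratic_variation T PP Q" "t \<in> {0..T}" "\<And>n. is_partition t (N n) (ts n)"
    and "\<And>\<epsilon>. \<epsilon> > 0 \<Longrightarrow> \<forall>\<^sub>F n in sequentially. \<forall>j<N n. ts n (Suc j) - ts n j < \<epsilon>"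
  shows "(\<lambda>n. UE (\<lambda>\<omega>. ennreal
     (((\<Sum>j<N n. (canonical (ts n (Suc j)) \<omega> - canonical (ts n j) \<omega>)\<^sup>2) - Q t \<omega>)\<^sup>2))) \<longlonglongrightarrow> 0"
proof -
  note * = assms(1)[unfolded quadratic_variation_def, THEN conjunct2, rule_format, OF assms(2), of N ts]
  show ?thesis by (rule *) (use assms(3,4) in simp_all)
qed

text \<open>
  Both times lie on the grid of step \<open>h\<close>, so refinements of it approximate \<open>Q\<close> at both of them and the
  increment of \<open>Q\<close> is the limit of \<open>R n\<close>, the sum of the squared increments in between. The lower bound follows
  from \<open>R n \<ge> 0\<close>, the upper bound from the vanishing of the positive part of \<open>R n - c\<close>.
\<close>
lemma quadratic_variation_grid_bounds:
  fixes M i k :: nat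
  assumes Q: "quadratic_variation T PP Q" and ik: "i \<le> k" "k \<le> Suc M"
  defines "h \<equiv> T / real (Suc M)"
  shows "qs (\<lambda>\<omega>. 0 \<le> Q (real k * h) \<omega> - Q (real i * h) \<omega> \<and>
    Q (real k * h) \<omega> - Q (real i * h) \<omega> \<le> shigh\<^sup>2 * (real k * h - real i * h))"
proof -
  have h: "0 < h" "real j * h \<le> T" if "j \<le> Suc M" for j
  proof -
    show "0 < h" using T_pos by (simp add: h_def)
    then have "real j * h \<le> real (Suc M) * h" using that by (intro mult_right_mono) auto
    then show "real j * h \<le> T" by (simp add: h_def)
  qed
  have h0: "0 < h" using h(1)[of 0] by simp
  define \<delta> where "\<delta> n = h / real (Suc n)" for n
  have \<delta>: "0 < \<delta> n" for n using h0 by (simp add: \<delta>_def)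
  define S where "S n j \<omega> = (\<Sum>l<j * Suc n. (canonical (real (Suc l) * \<delta> n) \<omega> - canonical (real l * \<delta> n) \<omega>)\<^sup>2)" for n j \<omega>
  define X where "X n j \<omega> = ennreal ((S n j \<omega> - Q (real j * h) \<omega>)\<^sup>2)" for n j \<omega>
  have grid: "real (j * Suc n) * \<delta> n = real j * h" for j n unfolding \<delta>_def of_nat_mult by (simp del: of_nat_Suc)
  have \<delta>0: "\<delta> \<longlonglongrightarrow> 0"
    unfolding \<delta>_def divide_inverse using tendsto_mult[OF tendsto_const[of h] LIMSEQ_inverse_real_of_nat] by simp
  have X: "(\<lambda>n. UE (X n j)) \<longlonglongrightarrow> 0" if "j \<le> Suc M" for j
  proof -
    have "is_partition (real j * h) (j * Suc n) (\<lambda>l. real l * \<delta> n)" for n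
      using uniform_grid_partition[OF \<delta>, of "j * Suc n" n] unfolding grid .
    moreover have "\<forall>\<^sub>F n in sequentially. \<forall>l<j * Suc n. real (Suc l) * \<delta> n - real l * \<delta> n < \<epsilon>" if "\<epsilon> > 0" for \<epsilon>
      using order_tendstoD(2)[OF \<delta>0 that] by eventually_elim (simp add: algebra_simps)
    moreover have "real j * h \<in> {0..T}" using h[OF that] by auto
    ultimately have "(\<lambda>n. UE (\<lambda>\<omega>. ennreal (((\<Sum>l<j * Suc n. (canonical (real (Suc l) * \<delta> n) \<omega>
        - canonical (real l * \<delta> n) \<omega>)\<^sup>2) - Q (real j * h) \<omega>)\<^sup>2))) \<longlonglongrightarrow> 0"
      by (intro quadratic_variationD[OF Q, of _ "\<lambda>n. j * Suc n" "\<lambda>n l. real l * \<delta> n"])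
    then show ?thesis unfolding X_def[abs_def] S_def .
  qed
  define R where "R n \<omega> = (\<Sum>l\<in>{i * Suc n..<k * Suc n}. (canonical (real (Suc l) * \<delta> n) \<omega> - canonical (real l * \<delta> n) \<omega>)\<^sup>2)" for n \<omega>
  have le: "i * Suc n \<le> k * Suc n" for n using ik by (intro mult_le_mono1)
  have R: "S n k \<omega> - S n i \<omega> = R n \<omega>" for n \<omega>
  proof -
    show ?thesis unfolding S_def R_def lessThan_atLeast0
      by (subst sum.atLeastLessThan_concat[OF zero_le le, symmetric]) (simp only: add_diff_cancel_left')
  qed
  define A where "A \<omega> = Q (real k * h) \<omega> - Q (real i * h) \<omega>" for \<omega>
  define c where "c = shigh\<^sup>2 * (real k * h - real i * h)"
  have AR: "A \<omega> - R n \<omega> = (S n i \<omega> - Q (real i * h) \<omega>) - (S n k \<omega> - Q (real k * h) \<omega>)" for n \<omega>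
    unfolding A_def R[symmetric] by simp
  have i: "i \<le> Suc M" using ik by simp
  have 1: "qs (\<lambda>\<omega>. ennreal ((min (A \<omega>) 0)\<^sup>2) = 0)"
  proof (rule qs_zero_of_vanishing_bounds[OF X[OF ik(2)] X[OF i]])
    show "qs (\<lambda>\<omega>. ennreal ((min (A \<omega>) 0)\<^sup>2) \<le> ennreal 2 * (X n k \<omega> + X n i \<omega>))" for n
    proof (rule qs_all)
      fix \<omega>
      have "0 \<le> R n \<omega>" unfolding R_def by (intro sum_nonneg) auto
      from ennreal_leI[OF square_negative_part_le[OF AR this]]
      show "ennreal ((min (A \<omega>) 0)\<^sup>2) \<le> ennreal 2 * (X n k \<omega> + X n i \<omega>)"
        unfolding X_def by (subst (asm) ennreal_mult) auto
    qed
  qed simp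
  define W where "W n \<omega> = ennreal ((max (R n \<omega> - c) 0)\<^sup>2)" for n \<omega>
  have W: "(\<lambda>n. UE (W n)) \<longlonglongrightarrow> 0"
  proof (rule tendsto_sandwich[OF always_eventually _ tendsto_const])
    let ?b = "\<lambda>n. real (k - i) * (4 * shigh ^ 4) * h * \<delta> n"
    show "\<forall>n. 0 \<le> UE (W n)" by simp
    have "(\<lambda>n. ?b n) \<longlonglongrightarrow> real (k - i) * (4 * shigh ^ 4) * h * 0" by (intro tendsto_intros \<delta>0)
    then show "(\<lambda>n. ennreal (?b n)) \<longlonglongrightarrow> 0"
      using tendsto_ennrealI[of ?b 0] by simp
    show "\<forall>\<^sub>F n in sequentially. UE (W n) \<le> ennreal (?b n)"
      using eventually_ge_at_top[of 1]
    proof eventually_elim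
      case (elim n)
      have "h \<le> T" using h(2)[of 1] by simp
      moreover have "\<delta> n < h" using elim h0 by (simp add: \<delta>_def field_simps)
      ultimately have d: "\<delta> n < T" by simp
      have m: "real (k * Suc n) * \<delta> n \<le> T" unfolding grid using h ik by simp
      let ?\<xi> = "\<lambda>l \<omega>. (canonical (real (Suc l) * \<delta> n) \<omega> - canonical (real l * \<delta> n) \<omega>)\<^sup>2 - shigh\<^sup>2 * \<delta> n"
      have eq: "(\<Sum>l\<in>{i * Suc n..<k * Suc n}. ?\<xi> l \<omega>) = R n \<omega> - c" for \<omega>
      proof -
        have "real (k * Suc n - i * Suc n) * (shigh\<^sup>2 * \<delta> n) = shigh\<^sup>2 * (real (k * Suc n) * \<delta> n - real (i * Suc n) * \<delta> n)"
          by (subst of_nat_diff[OF le]) (simp add: algebra_simps)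
        then show ?thesis unfolding sum_subtractf R_def c_def grid by simp
      qed
      note E = E_excess_square[OF \<delta> d m le, unfolded eq]
      have "UE (W n) \<le> ennreal (E (\<lambda>\<omega>. (max (R n \<omega> - c) 0)\<^sup>2))"
        unfolding W_def by (rule UE_le_E[OF E[THEN conjunct1]]) simp
      also have "\<dots> \<le> ennreal (real (k * Suc n - i * Suc n) * (4 * shigh ^ 4 * (\<delta> n)\<^sup>2))"
        by (rule ennreal_leI[OF E[THEN conjunct2]])
      also have "real (k * Suc n - i * Suc n) * (4 * shigh ^ 4 * (\<delta> n)\<^sup>2) = ?b n"
      proof -
        have "real (k * Suc n - i * Suc n) * \<delta> n = real (k - i) * h"
          using ik grid[of "k - i" n] by (simp only: diff_mult_distrib)
        then have "real (k * Suc n - i * Suc n) * \<delta> n * (4 * shigh ^ 4 * \<delta> n) = real (k - i) * h * (4 * shigh ^ 4 * \<delta> n)"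
          by simp
        then show ?thesis by (simp only: power2_eq_square mult_ac)
      qed
      finally show ?case .
    qed
  qed
  have 2: "qs (\<lambda>\<omega>. ennreal ((max (A \<omega> - c) 0)\<^sup>2) = 0)"
  proof (rule qs_zero_of_vanishing_bounds[OF _ W])
    show "(\<lambda>n. UE (\<lambda>\<omega>. X n k \<omega> + X n i \<omega>)) \<longlonglongrightarrow> 0"
      by (rule tendsto_sandwich[OF always_eventually always_eventually tendsto_const])
         (use UE_add tendsto_add[OF X[OF ik(2)] X[OF i]] in auto)
    show "qs (\<lambda>\<omega>. ennreal ((max (A \<omega> - c) 0)\<^sup>2) \<le> ennreal 4 * (X n k \<omega> + X n i \<omega> + W n \<omega>))" for n
    proof (rule qs_all)
      fix \<omega>
      from ennreal_leI[OF square_positive_part_le[OF AR[of \<omega> n], of c]]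
      show "ennreal ((max (A \<omega> - c) 0)\<^sup>2) \<le> ennreal 4 * (X n k \<omega> + X n i \<omega> + W n \<omega>)"
        unfolding X_def W_def by (subst (asm) ennreal_mult) auto
    qed
  qed simp
  have conv: "0 \<le> a \<and> a \<le> c" if "ennreal ((min a 0)\<^sup>2) = 0 \<and> ennreal ((max (a - c) 0)\<^sup>2) = 0" for a
  proof -
    have "(min a 0)\<^sup>2 = 0" "(max (a - c) 0)\<^sup>2 = 0" using that by (auto simp only: ennreal_eq_0_iff intro: antisym zero_le_power2)
    then show ?thesis by (auto simp: min_def max_def split: if_splits)
  qed
  show ?thesis using qs_conj[OF 1 2] unfolding A_def[symmetric] c_def[symmetric] by (rule qs_mono) (rule conv)
qed

text \<open>
  Countably many polar sets suffice for the grid points, and continuity of the paths of \<open>Q\<close> extends the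
  bounds to all times.
\<close>
lemma quadratic_variation_Lipschitz:
  assumes Q: "quadratic_variation T PP Q"
  shows "qs (\<lambda>\<omega>. \<forall>s t. 0 \<le> s \<longrightarrow> s \<le> t \<longrightarrow> t \<le> T \<longrightarrow> 0 \<le> Q t \<omega> - Q s \<omega> \<and> Q t \<omega> - Q s \<omega> \<le> shigh\<^sup>2 * (t - s))"
proof -
  let ?g = "\<lambda>M i. real i * (T / real (Suc M))"
  let ?P = "\<lambda>s t \<omega>. 0 \<le> Q t \<omega> - Q s \<omega> \<and> Q t \<omega> - Q s \<omega> \<le> shigh\<^sup>2 * (t - s)"
  have "qs (\<lambda>\<omega>. i \<le> k \<longrightarrow> k \<le> Suc M \<longrightarrow> ?P (?g M i) (?g M k) \<omega>)" for M i k
    using quadratic_variation_grid_bounds[OF Q, of i k M]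
    by (cases "i \<le> k \<and> k \<le> Suc M") (auto intro: qs_all)
  then have "qs (\<lambda>\<omega>. \<forall>M i k. i \<le> k \<longrightarrow> k \<le> Suc M \<longrightarrow> ?P (?g M i) (?g M k) \<omega>)"
    by (intro qs_countable)
  moreover have "qs (\<lambda>\<omega>. continuous_on {0..T} (\<lambda>t. Q t \<omega>))" using Q unfolding quadratic_variation_def by blast
  ultimately show ?thesis
  proof (rule qs_mono[OF qs_conj], elim conjE, intro allI impI)
    fix \<omega> s t
    assume grid: "\<forall>M i k. i \<le> k \<longrightarrow> k \<le> Suc M \<longrightarrow> ?P (?g M i) (?g M k) \<omega>"
      and cont: "continuous_on {0..T} (\<lambda>t. Q t \<omega>)" and st: "0 \<le> s" "s \<le> t" "t \<le> T"
    \<comment> \<open>The grid points below \<open>u\<close>; they depend monotonically on \<open>u\<close>.\<close>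
    define i where "i u M = nat \<lfloor>u * real (Suc M) / T\<rfloor>" for u M
    have lim: "(\<lambda>M. ?g M (i u M)) \<longlonglongrightarrow> u" if "u \<in> {0..T}" for u
      unfolding i_def using floor_grid_tendsto[OF T_pos that] .
    have iM: "i u M \<le> Suc M" if "u \<in> {0..T}" for u M
    proof -
      have "u * real (Suc M) \<le> T * real (Suc M)" using that by (intro mult_right_mono) auto
      then have "u * real (Suc M) / T \<le> real (Suc M)" using T_pos by (simp add: pos_divide_le_eq mult.commute)
      then show ?thesis unfolding i_def by linarith
    qed
    have gT: "?g M j \<in> {0..T}" if "j \<le> Suc M" for M j
    proof -
      have "?g M j \<le> real (Suc M) * (T / real (Suc M))" using that T_pos by (intro mult_right_mono) auto
      then show ?thesis using T_pos by auto
    qed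
    have ist: "i s M \<le> i t M" for M
    proof -
      have "s * real (Suc M) / T \<le> t * real (Suc M) / T" using st T_pos by (intro divide_right_mono mult_right_mono) auto
      then show ?thesis unfolding i_def by (intro nat_mono floor_mono)
    qed
    have Qlim: "(\<lambda>M. Q (?g M (i u M)) \<omega>) \<longlonglongrightarrow> Q u \<omega>" if "u \<in> {0..T}" for u
      by (rule continuous_on_tendsto_compose[OF cont lim[OF that] that always_eventually]) (use gT iM[OF that] in blast)
    have T: "s \<in> {0..T}" "t \<in> {0..T}" using st by auto
    have P: "?P (?g M (i s M)) (?g M (i t M)) \<omega>" for M using grid ist iM[OF T(2)] by blast
    have L1: "(\<lambda>M. Q (?g M (i t M)) \<omega> - Q (?g M (i s M)) \<omega>) \<longlonglongrightarrow> Q t \<omega> - Q s \<omega>"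
      by (intro tendsto_intros Qlim T)
    have L2: "(\<lambda>M. shigh\<^sup>2 * (?g M (i t M) - ?g M (i s M))) \<longlonglongrightarrow> shigh\<^sup>2 * (t - s)"
      by (intro tendsto_intros lim T)
    show "?P s t \<omega>"
    proof
      show "0 \<le> Q t \<omega> - Q s \<omega>" by (rule LIMSEQ_le_const[OF L1]) (use P in blast)
      show "Q t \<omega> - Q s \<omega> \<le> shigh\<^sup>2 * (t - s)" by (rule LIMSEQ_le[OF L1 L2]) (use P in blast)
    qed
  qed
qed

end

section \<open>Densities of Lipschitz paths\<close>

text \<open>
  The setwise sum of two measures, used to split Lebesgue measure into two Stieltjes measures.
\<close>
lemma emeasure_measure_sum:
  assumes sets: "sets N = sets M" and A: "A \<in> sets M"
  shows "emeasure (measure_of (space M) (sets M) (\<lambda>A. emeasure M A + emeasure N A)) A = emeasure M A + emeasure N A"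
proof (rule emeasure_measure_of_sigma[OF sets.sigma_algebra_axioms _ _ A])
  show "positive (sets M) (\<lambda>A. emeasure M A + emeasure N A)" by (simp add: positive_def)
  show "countably_additive (sets M) (\<lambda>A. emeasure M A + emeasure N A)"
  proof (rule countably_additiveI)
    fix A :: "nat \<Rightarrow> 'a set"
    assume A: "range A \<subseteq> sets M" "disjoint_family A"
    have "(\<Sum>i. emeasure M (A i) + emeasure N (A i)) = (\<Sum>i. emeasure M (A i)) + (\<Sum>i. emeasure N (A i))"
      by (rule suminf_add[symmetric]) auto
    also have "\<dots> = emeasure M (\<Union>i. A i) + emeasure N (\<Union>i. A i)"
      using A sets by (simp add: suminf_emeasure)
    finally show "(\<Sum>i. emeasure M (A i) + emeasure N (A i)) = emeasure M (\<Union>i. A i) + emeasure N (\<Union>i. A i)" .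
  qed
qed

text \<open>
  For a nondecreasing contraction \<open>F\<close> the function \<open>x - F x\<close> is nondecreasing as well, and the two
  Stieltjes measures add up to Lebesgue measure. Hence both are absolutely continuous, and their Radon-Nikodym
  densities add up to one.
\<close>
lemma nondecreasing_contraction_density:
  fixes F :: "real \<Rightarrow> real"
  assumes mono: "\<And>x y. x \<le> y \<Longrightarrow> F x \<le> F y" and lip: "\<And>x y. x \<le> y \<Longrightarrow> F y - F x \<le> y - x"
  obtains q where "q \<in> borel_measurable borel" "\<And>x. 0 \<le> q x \<and> q x \<le> (1::real)"
    "\<And>a b. a \<le> b \<Longrightarrow> F b - F a = (LINT x|lborel. indicator {a..b} x * q x)"
proof -
  define G where "G x = x - F x" for x
  have mono': "G x \<le> G y" if "x \<le> y" for x y using lip[OF that] by (simp add: G_def)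
  have contF: "continuous_on UNIV F"
  proof (rule lipschitz_on_continuous_on[of 1], rule lipschitz_onI)
    fix x y :: real
    show "dist (F x) (F y) \<le> 1 * dist x y"
      using mono[of x y] mono[of y x] lip[of x y] lip[of y x] by (cases "x \<le> y") (auto simp: dist_real_def)
  qed simp
  have contG: "continuous_on UNIV G" unfolding G_def by (intro continuous_intros contF)
  have right: "continuous (at_right a) F" "continuous (at_right a) G" for a
    using contF contG by (auto simp: continuous_on_eq_continuous_within intro: continuous_within_subset)
  define \<mu> where "\<mu> = interval_measure F"
  define \<nu> where "\<nu> = interval_measure G"
  define \<rho> where "\<rho> = measure_of (space \<mu>) (sets \<mu>) (\<lambda>A. emeasure \<mu> A + emeasure \<nu> A)"
  have s\<mu>: "sets \<mu> = sets borel" "sets \<nu> = sets borel" "space \<mu> = UNIV" by (auto simp: \<mu>_def \<nu>_def)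
  have s\<rho>: "sets \<rho> = sets borel" "space \<rho> = UNIV"
  proof -
    show "sets \<rho> = sets borel" unfolding \<rho>_def by (simp add: sets.sigma_sets_eq s\<mu>(1)[symmetric])
    then show "space \<rho> = UNIV" by (metis sets_eq_imp_space_eq space_borel)
  qed
  have e\<rho>: "emeasure \<rho> A = emeasure \<mu> A + emeasure \<nu> A" if "A \<in> sets borel" for A
    unfolding \<rho>_def using that s\<mu> by (intro emeasure_measure_sum) auto
  have Ioc: "emeasure \<mu> {a<..b} = ennreal (F b - F a)" "emeasure \<nu> {a<..b} = ennreal (G b - G a)" if "a \<le> b" for a b
    unfolding \<mu>_def \<nu>_def using that mono mono' right by (auto intro!: emeasure_interval_measure_Ioc)
  have \<rho>: "\<rho> = lborel"
  proof (rule measure_eqI_generator_eq[where E = "range (\<lambda>(a, b). {a<..b::real})" and \<Omega> = UNIV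
        and A = "\<lambda>n. {- real n<..real n}"])
    show "Int_stable (range (\<lambda>(a, b). {a<..b::real}))"
    proof (rule Int_stableI)
      fix A B :: "real set" assume "A \<in> range (\<lambda>(a, b). {a<..b})" "B \<in> range (\<lambda>(a, b). {a<..b})"
      then obtain a b c d where "A = {a<..b}" "B = {c<..d}" by auto
      then have "A \<inter> B = {max a c<..min b d}" by auto
      then show "A \<inter> B \<in> range (\<lambda>(a, b). {a<..b})" by auto
    qed
    fix A assume "A \<in> range (\<lambda>(a, b). {a<..b::real})"
    then obtain a b where A: "A = {a<..b}" by auto
    show "emeasure \<rho> A = emeasure lborel A"
    proof (cases "a \<le> b")
      case True
      then have "emeasure \<rho> A = ennreal (F b - F a) + ennreal (G b - G a)" unfolding A by (simp add: e\<rho> Ioc)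
      also have "\<dots> = ennreal ((F b - F a) + (G b - G a))"
        using mono[OF True] mono'[OF True] by (intro ennreal_plus[symmetric]) auto
      also have "\<dots> = emeasure lborel A" using True by (simp add: A G_def)
      finally show ?thesis .
    qed (simp add: A)
  next
    have "borel = sigma UNIV (range (\<lambda>(a, b). {a<..b::real}))" by (rule borel_sigma_sets_Ioc)
    then have "sets (borel :: real measure) = sigma_sets UNIV (range (\<lambda>(a, b). {a<..b::real}))"
      by (metis sets_measure_of subset_UNIV Pow_UNIV)
    then show "sets \<rho> = sigma_sets UNIV (range (\<lambda>(a, b). {a<..b::real}))"
      "sets lborel = sigma_sets UNIV (range (\<lambda>(a, b). {a<..b::real}))" using s\<rho> by auto
    show "(\<Union>i. {- real i<..real i}) = UNIV"
    proof -
      have "x \<in> (\<Union>i. {- real i<..real i})" for x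
      proof -
        obtain n where "\<bar>x\<bar> < real n" using reals_Archimedean2 by blast
        then show ?thesis by (auto intro!: exI[of _ n])
      qed
      then show ?thesis by blast
    qed
    show "emeasure \<rho> {- real i<..real i} \<noteq> \<infinity>" for i by (simp add: e\<rho> Ioc)
  qed auto
  have ac: "absolutely_continuous lborel M" if "sets M = sets borel" "\<And>A. A \<in> sets borel \<Longrightarrow> emeasure M A \<le> emeasure \<rho> A" for M
    unfolding absolutely_continuous_def
  proof
    fix A :: "real set" assume "A \<in> null_sets lborel"
    then have "A \<in> sets borel" "emeasure \<rho> A = 0" unfolding \<rho> by (auto simp: null_sets_def)
    with that(2)[of A] that(1) show "A \<in> null_sets M" by (simp add: null_sets_def)
  qed
  have le\<rho>: "emeasure \<mu> A \<le> emeasure \<rho> A" "emeasure \<nu> A \<le> emeasure \<rho> A" if "A \<in> sets borel" for A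
    using e\<rho>[OF that] by simp_all
  obtain d where d: "d \<in> borel_measurable lborel" "density lborel d = \<mu>"
    using sigma_finite_measure.Radon_Nikodym[OF sigma_finite_lborel ac[OF s\<mu>(1) le\<rho>(1)]] s\<mu> by auto
  obtain d' where d': "d' \<in> borel_measurable lborel" "density lborel d' = \<nu>"
    using sigma_finite_measure.Radon_Nikodym[OF sigma_finite_lborel ac[OF s\<mu>(2) le\<rho>(2)]] s\<mu> by auto
  have dd: "density lborel (\<lambda>x. d x + d' x) = lborel"
  proof (rule measure_eqI)
    fix A assume "A \<in> sets (density lborel (\<lambda>x. d x + d' x))"
    then have A: "A \<in> sets borel" by simp
    have "emeasure (density lborel (\<lambda>x. d x + d' x)) A = (\<integral>\<^sup>+x. d x * indicator A x + d' x * indicator A x \<partial>lborel)"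
      using d d' A by (subst emeasure_density) (auto simp: distrib_right)
    also have "\<dots> = emeasure (density lborel d) A + emeasure (density lborel d') A"
      using d d' A by (subst nn_integral_add) (auto simp: emeasure_density)
    also have "\<dots> = emeasure lborel A" using d d' e\<rho>[OF A] \<rho> by simp
    finally show "emeasure (density lborel (\<lambda>x. d x + d' x)) A = emeasure lborel A" .
  qed simp
  then have "density lborel (\<lambda>x. d x + d' x) = density lborel (\<lambda>_. 1)" by (simp add: density_1)
  then have "AE x in lborel. d x + d' x = 1"
  proof (subst (asm) sigma_finite_density_unique)
    show "sigma_finite_measure (density lborel (\<lambda>x. d x + d' x))"
      unfolding dd by (rule sigma_finite_lborel)
  qed (use d(1) d'(1) in auto)
  then have d1: "AE x in lborel. d x \<le> 1"
    by eventually_elim (metis le_iff_add)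
  define q where "q x = min 1 (enn2real (d x))" for x
  have q: "q \<in> borel_measurable borel" "\<And>x. 0 \<le> q x \<and> q x \<le> 1"
    using d(1) by (auto simp: q_def[abs_def])
  have dq: "AE x in lborel. d x = ennreal (q x)"
    using d1
  proof eventually_elim
    case (elim x)
    then have "d x < top" by (simp add: le_less_trans[OF _ ennreal_one_less_top])
    then have "ennreal (enn2real (d x)) = d x" by simp
    moreover have "enn2real (d x) \<le> 1" using elim by (metis calculation ennreal_le_1)
    ultimately show ?case by (simp add: q_def)
  qed
  have "F b - F a = (LINT x|lborel. indicator {a..b} x * q x)" if "a \<le> b" for a b
  proof -
    have int: "integrable lborel (\<lambda>x. indicator {a..b} x *\<^sub>R q x)"
      using q that by (intro integrableI_bounded_set_indicator[where B = 1]) auto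
    have "ennreal (F b - F a) = emeasure \<mu> {a..b}"
      unfolding \<mu>_def by (rule emeasure_interval_measure_Icc[OF that mono contF, symmetric])
    also have "\<dots> = (\<integral>\<^sup>+x. d x * indicator {a..b} x \<partial>lborel)"
      unfolding d(2)[symmetric] using d(1) by (intro emeasure_density) auto
    also have "\<dots> = (\<integral>\<^sup>+x. ennreal (indicator {a..b} x * q x) \<partial>lborel)"
      using dq by (intro nn_integral_cong_AE) (auto elim!: eventually_mono simp: indicator_def)
    also have "\<dots> = ennreal (LINT x|lborel. indicator {a..b} x * q x)"
      using int q by (intro nn_integral_eq_integral) auto
    finally show ?thesis
      using mono[OF that] q by (subst (asm) ennreal_inj) (auto intro!: integral_nonneg_AE)
  qed
  with q show ?thesis by (intro that) auto
qed

definition is_density :: "real \<Rightarrow> real \<Rightarrow> (real \<Rightarrow> real) \<Rightarrow> (real \<Rightarrow> real) \<Rightarrow> bool" where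
  "is_density T K F q \<longleftrightarrow> q \<in> borel_measurable borel \<and> (\<forall>x. 0 \<le> q x \<and> q x \<le> K) \<and>
     (\<forall>a b. 0 \<le> a \<longrightarrow> a \<le> b \<longrightarrow> b \<le> T \<longrightarrow> F b - F a = (LINT x|lborel. indicator {a..b} x * q x))"

lemma Lipschitz_path_density:
  assumes K: "K > 0" and T: "T > 0"
    and F: "\<forall>s t. 0 \<le> s \<longrightarrow> s \<le> t \<longrightarrow> t \<le> T \<longrightarrow> 0 \<le> F t - F s \<and> F t - F s \<le> K * (t - s)"
  shows "\<exists>q. is_density T K F q"
proof -
  define f where "f x = F (max 0 (min x T)) / K" for x
  have 1: "f x \<le> f y \<and> f y - f x \<le> y - x" if "x \<le> y" for x y
  proof -
    have *: "0 \<le> max 0 (min x T)" "max 0 (min x T) \<le> max 0 (min y T)" "max 0 (min y T) \<le> T"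
      "max 0 (min y T) - max 0 (min x T) \<le> y - x" using that T by auto
    have "0 \<le> F (max 0 (min y T)) - F (max 0 (min x T))"
      "F (max 0 (min y T)) - F (max 0 (min x T)) \<le> K * (max 0 (min y T) - max 0 (min x T))"
      using F *(1-3) by blast+
    moreover have "K * (max 0 (min y T) - max 0 (min x T)) \<le> K * (y - x)" using *(4) K by (intro mult_left_mono) auto
    ultimately show ?thesis using K by (auto simp: f_def divide_right_mono diff_divide_distrib[symmetric] field_simps)
  qed
  obtain q where q: "q \<in> borel_measurable borel" "\<And>x. 0 \<le> q x \<and> q x \<le> (1::real)"
    "\<And>a b. a \<le> b \<Longrightarrow> f b - f a = (LINT x|lborel. indicator {a..b} x * q x)"
    using nondecreasing_contraction_density[of f] 1 by blast
  have "is_density T K F (\<lambda>x. K * q x)"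
    unfolding is_density_def
  proof (intro conjI allI impI)
    show "(\<lambda>x. K * q x) \<in> borel_measurable borel" using q(1) by simp
    show "0 \<le> K * q x" "K * q x \<le> K" for x using q(2)[of x] K by auto
    fix a b assume ab: "0 \<le> a" "a \<le> b" "b \<le> T"
    have "F b - F a = K * (f b - f a)" using ab K by (simp add: f_def field_simps)
    also have "\<dots> = K * (LINT x|lborel. indicator {a..b} x * q x)" using q(3)[OF ab(2)] by simp
    also have "\<dots> = (LINT x|lborel. K * (indicator {a..b} x * q x))" by simp
    finally show "F b - F a = (LINT x|lborel. indicator {a..b} x * (K * q x))" by (simp add: mult_ac)
  qed
  then show ?thesis by blast
qed

section \<open>Time integrals along a path\<close>

lemma powr_tangent:
  fixes a x p :: real
  assumes "1 \<le> p" "0 < a" "0 \<le> x"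
  shows "a powr p + p * a powr (p - 1) * (x - a) \<le> x powr p"
proof (cases "x = 0")
  case True
  have "a powr (p - 1) * a = a powr p" using assms by (simp add: powr_diff)
  then have "a powr p + p * a powr (p - 1) * (x - a) = (1 - p) * a powr p" using True by (simp add: algebra_simps)
  also have "\<dots> \<le> 0" using assms by (intro mult_nonpos_nonneg) auto
  finally show ?thesis using True by simp
next
  case False
  then have x: "0 < x" using assms by simp
  have "convex_on {0<..} (\<lambda>x. x powr p)"
  proof (rule f''_ge0_imp_convex[where f' = "\<lambda>x. p * x powr (p - 1)" and f'' = "\<lambda>x. p * ((p - 1) * x powr (p - 2))"])
    fix y :: real assume "y \<in> {0<..}"
    then show "((\<lambda>x. x powr p) has_real_derivative p * y powr (p - 1)) (at y)"
      "((\<lambda>x. p * x powr (p - 1)) has_real_derivative p * ((p - 1) * y powr (p - 2))) (at y)"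
      "0 \<le> p * ((p - 1) * y powr (p - 2))"
      using assms by (auto intro!: derivative_eq_intros simp: algebra_simps)
  qed auto
  moreover have "((\<lambda>x. x powr p) has_real_derivative p * a powr (p - 1)) (at a within {0<..})"
    by (rule has_field_derivative_at_within[OF has_real_derivative_powr]) (rule assms)
  ultimately have "p * a powr (p - 1) * (x - a) \<le> x powr p - a powr p"
    using assms(2) x by (intro convex_on_imp_above_tangent[of "{0<..}"]) (simp_all add: interior_open)
  then show ?thesis by linarith
qed

lemma interval_step_measurable:
  "(\<lambda>s. (c::ennreal) * indicator {0..T::real} s) \<in> borel_measurable lebesgue"
  by (rule measurable_completion) simp

text \<open>
  Jensen's inequality for the mean \<open>a\<close> of \<open>|g|\<close> over \<open>[0, T]\<close>, obtained by integrating the tangent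
  inequality \<open>powr_tangent\<close> at \<open>a\<close>; in this form it applies to an arbitrary measurable majorant of \<open>|g|\<^sup>p\<close> and hence
  to the upper integral.
\<close>
lemma power_of_time_integral_le:
  fixes g :: "real \<Rightarrow> real"
  assumes T: "T > 0" and p: "1 \<le> p" and g: "set_integrable lebesgue {0..T} g"
  shows "ennreal ((LINT s:{0..T}|lebesgue. \<bar>g s\<bar>) powr p) \<le>
    ennreal (T powr (p - 1)) * time_integral T (\<lambda>s. ennreal (\<bar>g s\<bar> powr p))"
proof -
  define I where "I = (LINT s:{0..T}|lebesgue. \<bar>g s\<bar>)"
  have abs: "set_integrable lebesgue {0..T} (\<lambda>s. \<bar>g s\<bar>)" using g by (rule set_integrable_abs)
  have I0: "0 \<le> I" unfolding I_def set_lebesgue_integral_def by (intro integral_nonneg_AE) auto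
  have nnI: "(\<integral>\<^sup>+s. ennreal (indicator {0..T} s * \<bar>g s\<bar>) \<partial>lebesgue) = ennreal I"
    using abs unfolding I_def set_lebesgue_integral_def set_integrable_def
    by (subst nn_integral_eq_integral) auto
  define a where "a = I / T"
  have main: "ennreal (T * a powr p) \<le> time_integral T (\<lambda>s. ennreal (\<bar>g s\<bar> powr p))"
  proof (cases "a = 0")
    case False
    then have a: "a > 0" using I0 T by (simp add: a_def)
    show ?thesis
      unfolding time_integral_def upper_integral_eq_upper_sup
    proof (rule upper_sup_greatest)
      fix Y :: "real \<Rightarrow> ennreal"
      assume Y: "Y \<in> borel_measurable (restrict_space lborel {0..T})"
        "\<And>s. s \<in> space (restrict_space lborel {0..T}) \<Longrightarrow> ennreal (\<bar>g s\<bar> powr p) \<le> Y s"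
      have YI: "(\<integral>\<^sup>+s. Y s \<partial>restrict_space lborel {0..T}) = (\<integral>\<^sup>+s. Y s * indicator {0..T} s \<partial>lebesgue)"
        by (subst nn_integral_restrict_space) (auto simp: nn_integral_completion)
      have Ym: "(\<lambda>s. Y s * indicator {0..T} s) \<in> borel_measurable lebesgue"
        using Y(1) by (intro measurable_completion) (subst (asm) borel_measurable_restrict_space_iff_ennreal, auto)
      have gm: "(\<lambda>s. indicator {0..T} s * \<bar>g s\<bar>) \<in> borel_measurable lebesgue"
        using abs unfolding set_integrable_def by (simp add: borel_measurable_integrable)
      have "ennreal (p * a powr (p - 1)) * ennreal I
          = (\<integral>\<^sup>+s. ennreal (p * a powr (p - 1)) * ennreal (indicator {0..T} s * \<bar>g s\<bar>) \<partial>lebesgue)"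
        unfolding nnI[symmetric] using gm by (intro nn_integral_cmult[symmetric]) auto
      also have "\<dots> \<le> (\<integral>\<^sup>+s. Y s * indicator {0..T} s + ennreal ((p - 1) * a powr p) * indicator {0..T} s \<partial>lebesgue)"
      proof (rule nn_integral_mono)
        fix s :: real
        show "ennreal (p * a powr (p - 1)) * ennreal (indicator {0..T} s * \<bar>g s\<bar>)
          \<le> Y s * indicator {0..T} s + ennreal ((p - 1) * a powr p) * indicator {0..T} s"
        proof (cases "s \<in> {0..T}")
          case True
          have aa: "a powr (p - 1) * a = a powr p" using a by (simp add: powr_diff)
          have "p * a powr (p - 1) * (\<bar>g s\<bar> - a) = p * a powr (p - 1) * \<bar>g s\<bar> - p * (a powr (p - 1) * a)"
            by (simp add: algebra_simps)
          moreover have "(p - 1) * a powr p = p * (a powr (p - 1) * a) - a powr p"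
            unfolding aa by (simp add: left_diff_distrib)
          moreover have "a powr p + p * a powr (p - 1) * (\<bar>g s\<bar> - a) \<le> \<bar>g s\<bar> powr p"
            by (rule powr_tangent[OF p a]) simp
          ultimately have "p * a powr (p - 1) * \<bar>g s\<bar> \<le> \<bar>g s\<bar> powr p + (p - 1) * a powr p"
            by linarith
          then have "ennreal (p * a powr (p - 1)) * ennreal \<bar>g s\<bar> \<le> ennreal (\<bar>g s\<bar> powr p + (p - 1) * a powr p)"
            using p by (subst ennreal_mult[symmetric]) (simp_all add: ennreal_leI del: ennreal_plus)
          also have "\<dots> = ennreal (\<bar>g s\<bar> powr p) + ennreal ((p - 1) * a powr p)" using p by (intro ennreal_plus) auto
          also have "\<dots> \<le> Y s + ennreal ((p - 1) * a powr p)"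
            using Y(2)[of s] True by (intro add_right_mono) (auto simp: space_restrict_space)
          finally show ?thesis using True by simp
        qed simp
      qed
      also have "\<dots> = (\<integral>\<^sup>+s. Y s * indicator {0..T} s \<partial>lebesgue) + ennreal ((p - 1) * a powr p) * ennreal T"
        using T by (subst nn_integral_add[OF Ym interval_step_measurable]) (simp add: nn_integral_cmult_indicator)
      also have "ennreal (p * a powr (p - 1)) * ennreal I = ennreal (T * a powr p) + ennreal ((p - 1) * a powr p) * ennreal T"
      proof -
        have "I = T * a" using T by (simp add: a_def)
        moreover have "a powr (p - 1) * a = a powr p" using a by (simp add: powr_diff)
        ultimately have "p * a powr (p - 1) * I = p * (T * a powr p)" by (simp add: algebra_simps)
        also have "\<dots> = T * a powr p + (p - 1) * a powr p * T" by (simp add: algebra_simps)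
        finally have "p * a powr (p - 1) * I = T * a powr p + (p - 1) * a powr p * T" .
        then show ?thesis using p T I0 by (simp add: ennreal_mult[symmetric] ennreal_plus[symmetric] del: ennreal_plus)
      qed
      finally have le: "ennreal (T * a powr p) + ennreal ((p - 1) * a powr p) * ennreal T
          \<le> (\<integral>\<^sup>+s. Y s * indicator {0..T} s \<partial>lebesgue) + ennreal ((p - 1) * a powr p) * ennreal T" .
      have "ennreal ((p - 1) * a powr p) * ennreal T \<noteq> \<infinity>" by (simp add: ennreal_mult_eq_top_iff)
      then have "ennreal (T * a powr p) \<le> (\<integral>\<^sup>+s. Y s * indicator {0..T} s \<partial>lebesgue)"
        using le by (metis add.commute ennreal_add_left_cancel_le)
      then show "ennreal (T * a powr p) \<le> (SUP P\<in>{restrict_space lborel {0..T}}. \<integral>\<^sup>+s. Y s \<partial>P)"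
        using YI by simp
    qed
  qed simp
  have "I powr p = T powr (p - 1) * (T * a powr p)"
  proof -
    have "I powr p = T powr p * a powr p" using T I0 by (subst powr_mult[symmetric]) (auto simp: a_def)
    also have "T powr p = T powr (p - 1) * T" using T by (simp add: powr_diff)
    finally show ?thesis by simp
  qed
  then have "ennreal (I powr p) = ennreal (T powr (p - 1)) * ennreal (T * a powr p)"
    using T by (simp add: ennreal_mult[symmetric])
  also have "\<dots> \<le> ennreal (T powr (p - 1)) * time_integral T (\<lambda>s. ennreal (\<bar>g s\<bar> powr p))"
    by (rule mult_left_mono[OF main]) simp
  finally show ?thesis unfolding I_def .
qed

text \<open>
  Along a subsequence the step functions converge almost everywhere, so \<open>f\<close> is Lebesgue measurable; it is
  integrable because \<open>|y| \<le> 1 + |y|\<^sup>p\<close>.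
\<close>
lemma integrable_of_time_approximation:
  fixes f :: "real \<Rightarrow> real" and \<zeta> :: "nat \<Rightarrow> real \<Rightarrow> real"
  assumes p: "1 \<le> p" and \<zeta>: "\<And>n. \<zeta> n \<in> borel_measurable borel" and bnd: "\<And>n s. \<bar>\<zeta> n s\<bar> \<le> c n"
    and lim: "(\<lambda>n. time_integral T (\<lambda>s. ennreal (\<bar>f s - \<zeta> n s\<bar> powr p))) \<longlonglongrightarrow> 0"
  shows "set_integrable lebesgue {0..T} f"
proof -
  let ?M = "restrict_space lborel {0..T}"
  let ?X = "\<lambda>n s. ennreal (\<bar>f s - \<zeta> n s\<bar> powr p)"
  have lim': "(\<lambda>n. upper_sup ?M {?M} (?X n)) \<longlonglongrightarrow> 0"
    using lim unfolding time_integral_def upper_integral_eq_upper_sup .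
  obtain k :: "nat \<Rightarrow> nat" and N where k: "strict_mono k" and N: "N \<in> sets ?M" "emeasure ?M N = 0"
    and conv: "\<And>s. s \<in> space ?M - N \<Longrightarrow> (\<lambda>n. ?X (k n) s) \<longlonglongrightarrow> 0"
    using upper_sup_Borel_Cantelli[of "{?M}" ?M ?X] lim' by auto
  have sub: "N \<subseteq> {0..T}" using sets.sets_into_space[OF N(1)] by (simp add: space_restrict_space)
  have N': "N \<in> null_sets lborel"
    using N sub by (auto simp: null_sets_def sets_restrict_space emeasure_restrict_space)
  define F where "F s = lim (\<lambda>n. \<zeta> (k n) s)" for s
  have F: "F \<in> borel_measurable borel" unfolding F_def using \<zeta> by (intro borel_measurable_lim_metric) auto
  have Ff: "F s = f s" if s: "s \<in> {0..T}" "s \<notin> N" for s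
  proof -
    have "(\<lambda>n. \<bar>f s - \<zeta> (k n) s\<bar> powr p) \<longlonglongrightarrow> 0"
    proof (rule iffD1[OF ennreal_tendsto_0_iff])
      show "(\<lambda>n. ennreal (\<bar>f s - \<zeta> (k n) s\<bar> powr p)) \<longlonglongrightarrow> 0"
        using s by (intro conv) (auto simp: space_restrict_space)
    qed simp
    then have "(\<lambda>n. (\<bar>f s - \<zeta> (k n) s\<bar> powr p) powr (1 / p)) \<longlonglongrightarrow> 0"
      by (rule tendsto_zero_powrI[OF _ tendsto_const always_eventually]) (use p in simp_all)
    then have "(\<lambda>n. \<bar>f s - \<zeta> (k n) s\<bar>) \<longlonglongrightarrow> 0" using p by (simp add: powr_powr)
    then have "(\<lambda>n. f s - \<zeta> (k n) s) \<longlonglongrightarrow> 0" by (simp add: tendsto_rabs_zero_iff)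
    from tendsto_diff[OF tendsto_const[of "f s"] this] have "(\<lambda>n. \<zeta> (k n) s) \<longlonglongrightarrow> f s" by simp
    then show ?thesis unfolding F_def by (rule limI)
  qed
  have ae: "AE s in lebesgue. indicator {0..T} s *\<^sub>R F s = indicator {0..T} s *\<^sub>R f s"
  proof (rule AE_completion, rule AE_I'[OF N'])
    show "{s \<in> space lborel. indicator {0..T} s *\<^sub>R F s \<noteq> indicator {0..T} s *\<^sub>R f s} \<subseteq> N"
      using Ff by (auto simp: indicator_def)
  qed
  have meas: "(\<lambda>s. indicator {0..T} s *\<^sub>R f s) \<in> borel_measurable lebesgue"
    by (rule borel_measurable_AE[OF _ ae]) (use F in \<open>auto intro!: measurable_completion\<close>)
  have "\<forall>\<^sub>F n in sequentially. upper_sup ?M {?M} (?X n) < 1"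
    using lim' by (rule order_tendstoD) simp
  then obtain n where "upper_sup ?M {?M} (?X n) < 1" using eventually_happens'[OF sequentially_bot] by blast
  then obtain Y where Y: "Y \<in> borel_measurable ?M" "\<And>s. s \<in> {0..T} \<Longrightarrow> ?X n s \<le> Y s" "(\<integral>\<^sup>+s. Y s \<partial>?M) < 1"
    using upper_sup_lessD[of ?M "{?M}" "?X n" 1] by (auto simp: space_restrict_space)
  have YI: "(\<integral>\<^sup>+s. Y s \<partial>?M) = (\<integral>\<^sup>+s. Y s * indicator {0..T} s \<partial>lebesgue)"
    by (subst nn_integral_restrict_space) (auto simp: nn_integral_completion)
  have Ym: "(\<lambda>s. Y s * indicator {0..T} s) \<in> borel_measurable lebesgue"
    using Y(1) by (intro measurable_completion) (subst (asm) borel_measurable_restrict_space_iff_ennreal, auto)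
  have "(\<integral>\<^sup>+s. ennreal (norm (indicator {0..T} s *\<^sub>R f s)) \<partial>lebesgue)
      \<le> (\<integral>\<^sup>+s. Y s * indicator {0..T} s + ennreal (1 + c n) * indicator {0..T} s \<partial>lebesgue)"
  proof (rule nn_integral_mono)
    fix s
    show "ennreal (norm (indicator {0..T} s *\<^sub>R f s)) \<le> Y s * indicator {0..T} s + ennreal (1 + c n) * indicator {0..T} s"
    proof (cases "s \<in> {0..T}")
      case True
      let ?a = "\<bar>f s - \<zeta> n s\<bar>"
      have "?a \<le> 1 + ?a powr p"
      proof (cases "?a \<le> 1")
        case False
        then have "?a powr 1 \<le> ?a powr p" using p by (intro powr_mono) auto
        then show ?thesis using False by simp
      qed (auto intro: order_trans)
      then have "\<bar>f s\<bar> \<le> ?a powr p + (1 + c n)" using bnd[of n s] by linarith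
      then have "ennreal \<bar>f s\<bar> \<le> ennreal (?a powr p + (1 + c n))" by (rule ennreal_leI)
      also have "\<dots> = ?X n s + ennreal (1 + c n)"
        using bnd[of n s] by (intro ennreal_plus) auto
      also have "\<dots> \<le> Y s + ennreal (1 + c n)" using Y(2)[OF True] by (rule add_right_mono)
      finally show ?thesis using True by simp
    qed simp
  qed
  also have "\<dots> = (\<integral>\<^sup>+s. Y s \<partial>?M) + ennreal (1 + c n) * emeasure lebesgue {0..T}"
    unfolding YI by (subst nn_integral_add[OF Ym interval_step_measurable]) (simp add: nn_integral_cmult_indicator)
  also have "\<dots> < \<infinity>"
    using Y(3) by (auto simp: ennreal_add_less_top ennreal_mult_less_top less_trans[OF _ ennreal_one_less_top] emeasure_lborel_Icc_eq)
  finally show ?thesis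
    unfolding set_integrable_def by (intro integrableI_bounded meas)
qed

section \<open>Simple processes\<close>

lemma partition_mono:
  assumes "is_partition T N ts" "i \<le> j" "j \<le> N"
  shows "ts i \<le> ts j"
  using assms(2,3)
proof (induction j rule: dec_induct)
  case (step n)
  then have "ts n < ts (Suc n)" using assms(1) by (simp add: is_partition_def)
  with step show ?case by simp
qed simp

lemma partition_range: "is_partition T N ts \<Longrightarrow> j \<le> N \<Longrightarrow> 0 \<le> ts j \<and> ts j \<le> T"
  using partition_mono[of T N ts 0 j] partition_mono[of T N ts j N] by (auto simp: is_partition_def)

lemma partition_cell:
  assumes P: "is_partition T N ts" and t: "0 \<le> t" "t < T"
  obtains j where "j < N" "ts j \<le> t" "t < ts (Suc j)"
proof -
  define j where "j = Max {j. j \<le> N \<and> ts j \<le> t}"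
  have fin: "finite {j. j \<le> N \<and> ts j \<le> t}" by simp
  have "0 \<in> {j. j \<le> N \<and> ts j \<le> t}" using P t by (simp add: is_partition_def)
  then have j: "j \<in> {j. j \<le> N \<and> ts j \<le> t}" unfolding j_def using fin by (intro Max_in) auto
  have "j \<noteq> N" using j P t by (auto simp: is_partition_def)
  then have jN: "j < N" using j by auto
  have "t < ts (Suc j)"
  proof (rule ccontr)
    assume "\<not> t < ts (Suc j)"
    then have "Suc j \<in> {j. j \<le> N \<and> ts j \<le> t}" using jN by auto
    then have "Suc j \<le> j" unfolding j_def by (intro Max_ge fin)
    then show False by simp
  qed
  then show ?thesis using that jN j by blast
qed

lemma simple_process_cell:
  assumes P: "is_partition T N ts" and j: "j < N" "ts j \<le> t" "t < ts (Suc j)"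
  shows "simple_process N ts \<xi> t \<omega> = \<xi> j \<omega>"
proof -
  have "indicator {ts i..<ts (Suc i)} t = (if i = j then 1 else (0::real))" if "i < N" for i
  proof (cases "i = j")
    case False
    then consider "Suc i \<le> j" | "Suc j \<le> i" by linarith
    then show ?thesis
    proof cases
      case 1
      then have "ts (Suc i) \<le> ts j" using j by (intro partition_mono[OF P]) auto
      then show ?thesis using j False by (auto simp: indicator_def)
    next
      case 2
      then have "ts (Suc j) \<le> ts i" using that by (intro partition_mono[OF P]) auto
      then show ?thesis using j False by (auto simp: indicator_def)
    qed
  qed (use j in auto)
  then have "simple_process N ts \<xi> t \<omega> = (\<Sum>i<N. \<xi> i \<omega> * (if i = j then 1 else 0))"
    unfolding simple_process_def by (intro sum.cong) auto
  also have "\<dots> = \<xi> j \<omega>" using j by (simp add: if_distrib cong: if_cong)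
  finally show ?thesis .
qed

lemma simple_process_outside:
  assumes P: "is_partition T N ts" and t: "t < 0 \<or> T \<le> t"
  shows "simple_process N ts \<xi> t \<omega> = 0"
  unfolding simple_process_def
proof (rule sum.neutral, rule ballI)
  fix j assume "j \<in> {..<N}"
  then have "0 \<le> ts j" "ts (Suc j) \<le> T" using partition_range[OF P, of j] partition_range[OF P, of "Suc j"] by auto
  then show "\<xi> j \<omega> * indicator {ts j..<ts (Suc j)} t = 0" using t by (auto simp: indicator_def)
qed

lemma simple_process_measurable: "(\<lambda>t. simple_process N ts \<xi> t \<omega>) \<in> borel_measurable borel"
  unfolding simple_process_def by measurable

lemma simple_process_bounded: "\<bar>simple_process N ts \<xi> t \<omega>\<bar> \<le> (\<Sum>j<N. \<bar>\<xi> j \<omega>\<bar>)"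
  unfolding simple_process_def
  by (rule order_trans[OF sum_abs], rule sum_mono) (simp add: abs_mult indicator_def)

lemma simple_process_L_ip:
  assumes D: "simple_data T N ts \<xi>"
  shows "simple_process N ts \<xi> u \<in> L_ip u"
proof -
  have "(\<lambda>\<omega>. \<xi> j \<omega> * indicator {ts j..<ts (Suc j)} u) \<in> L_ip u" if "j < N" for j
  proof (cases "u \<in> {ts j..<ts (Suc j)}")
    case True
    then have "\<xi> j \<in> L_ip u" using D that L_ip_mono[of "ts j" u] by (auto simp: simple_data_def)
    then show ?thesis using True by simp
  qed (simp add: L_ip_const)
  then have "(\<lambda>\<omega>. \<Sum>j<N. \<xi> j \<omega> * indicator {ts j..<ts (Suc j)} u) \<in> L_ip u" by (intro L_ip_sum) auto
  then show ?thesis unfolding simple_process_def[abs_def] .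
qed

text \<open>
  The union of the two partitions is a common refinement, and both processes are constant on its cells.
\<close>
lemma simple_process_diff:
  assumes D: "simple_data T N ts \<xi>" and D': "simple_data T N' ts' \<xi>'" and T: "T > 0"
  shows "\<exists>M us \<zeta>. simple_data T M us \<zeta> \<and>
    (\<forall>t \<omega>. simple_process M us \<zeta> t \<omega> = simple_process N ts \<xi> t \<omega> - simple_process N' ts' \<xi>' t \<omega>)"
proof -
  have P: "is_partition T N ts" "is_partition T N' ts'" using D D' by (auto simp: simple_data_def)
  define S where "S = ts ` {..N} \<union> ts' ` {..N'}"
  define L where "L = sorted_list_of_set S"
  have fin: "finite S" by (simp add: S_def)
  have S: "S \<subseteq> {0..T}" "0 \<in> S" "T \<in> S"
    using partition_range[OF P(1)] partition_range[OF P(2)] P by (force simp: S_def is_partition_def)+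
  have setL: "set L = S" and sortedL: "sorted_wrt (<) L"
    unfolding L_def using fin strict_sorted_list_of_set[of S] by auto
  have lt: "L ! i < L ! j" if "i < j" "j < length L" for i j
    using sorted_wrt_nth_less[OF sortedL that] .
  define M where "M = length L - 1"
  have ne: "length L > 0" using S setL by (cases L) auto
  have lenL: "length L = Suc M" using ne by (simp add: M_def)
  have L0: "L ! 0 = 0"
  proof -
    obtain i where i: "i < length L" "L ! i = 0" using S setL by (metis in_set_conv_nth)
    have "L ! 0 \<in> S" using ne setL nth_mem by blast
    then have "0 \<le> L ! 0" using S by auto
    then show ?thesis using lt[of 0 i] i by (cases "i = 0") auto
  qed
  have LM: "L ! M = T"
  proof -
    obtain i where i: "i < length L" "L ! i = T" using S setL by (metis in_set_conv_nth)
    have "L ! M \<in> S" using lenL setL nth_mem by (metis lessI)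
    then have "L ! M \<le> T" using S by auto
    then show ?thesis using lt[of i M] i lenL by (cases "i = M") auto
  qed
  have PL: "is_partition T M ((!) L)"
    unfolding is_partition_def using L0 LM lt lenL by auto
  define \<zeta> where "\<zeta> j \<omega> = simple_process N ts \<xi> (L ! j) \<omega> - simple_process N' ts' \<xi>' (L ! j) \<omega>" for j \<omega>
  have "simple_data T M ((!) L) \<zeta>"
    unfolding simple_data_def \<zeta>_def[abs_def]
    using PL simple_process_L_ip[OF D] simple_process_L_ip[OF D'] by (auto intro: L_ip_diff)
  moreover have "simple_process M ((!) L) \<zeta> t \<omega> = simple_process N ts \<xi> t \<omega> - simple_process N' ts' \<xi>' t \<omega>" for t \<omega>
  proof (cases "0 \<le> t \<and> t < T")
    case False
    then show ?thesis using simple_process_outside[OF PL] simple_process_outside[OF P(1)] simple_process_outside[OF P(2)] by auto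
  next
    case True
    obtain j where j: "j < M" "L ! j \<le> t" "t < L ! Suc j" using partition_cell[OF PL] True by blast
    have same: "(s \<le> L ! j) = (s \<le> t)" if "s \<in> S" for s
    proof -
      have "s \<in> set L" using that setL by simp
      then obtain i where i: "i < length L" "s = L ! i" unfolding in_set_conv_nth by blast
      show ?thesis
      proof (cases "i \<le> j")
        case True
        then have "L ! i \<le> L ! j" using j(1) by (intro partition_mono[OF PL]) simp_all
        then show ?thesis unfolding i(2) using j(2) by linarith
      next
        case False
        then have "L ! Suc j \<le> L ! i" using i(1) lenL by (intro partition_mono[OF PL]) simp_all
        then show ?thesis unfolding i(2) using j(2,3) by linarith
      qed
    qed
    have ind: "indicator {a..<b} (L ! j) = (indicator {a..<b} t :: real)" if "a \<in> S" "b \<in> S" for a b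
      using same[OF that(1)] same[OF that(2)] by (auto simp: indicator_def not_le[symmetric])
    have "simple_process N ts \<xi> (L ! j) \<omega> = simple_process N ts \<xi> t \<omega>"
      "simple_process N' ts' \<xi>' (L ! j) \<omega> = simple_process N' ts' \<xi>' t \<omega>"
      unfolding simple_process_def by (intro sum.cong refl arg_cong2[where f = "(*)"] ind; simp add: S_def)+
    then show ?thesis using simple_process_cell[OF PL j] by (simp add: \<zeta>_def)
  qed
  ultimately show ?thesis by blast
qed

section \<open>Pathwise integration against a density\<close>

lemma integrable_times_density:
  assumes f: "set_integrable lebesgue {0..T} f" and q: "is_density T K F q" and t: "t \<in> {0..T}"
  shows "set_integrable lebesgue {0..t} (\<lambda>s. f s * q s)"
  unfolding set_integrable_def
proof (rule Bochner_Integration.integrable_bound)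
  have "set_integrable lebesgue {0..t} f" using f by (rule set_integrable_subset) (use t in auto)
  then have i: "integrable lebesgue (\<lambda>s. indicator {0..t} s *\<^sub>R f s)" unfolding set_integrable_def .
  then show "integrable lebesgue (\<lambda>s. K * (indicator {0..t} s *\<^sub>R f s))" by (rule integrable_mult_right)
  have qm: "q \<in> borel_measurable lebesgue" using q by (intro measurable_completion) (auto simp: is_density_def)
  have "(\<lambda>s. (indicator {0..t} s *\<^sub>R f s) * q s) \<in> borel_measurable lebesgue"
    using borel_measurable_integrable[OF i] qm by (rule borel_measurable_times)
  then show "(\<lambda>s. indicator {0..t} s *\<^sub>R (f s * q s)) \<in> borel_measurable lebesgue" by (simp add: mult.assoc)
  show "AE s in lebesgue. norm (indicator {0..t} s *\<^sub>R (f s * q s)) \<le> norm (K * (indicator {0..t} s *\<^sub>R f s))"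
  proof (rule AE_I2)
    fix s
    have "\<bar>q s\<bar> \<le> \<bar>K\<bar>" using q unfolding is_density_def by (metis abs_of_nonneg order_trans)
    then have "\<bar>indicator {0..t} s * f s\<bar> * \<bar>q s\<bar> \<le> \<bar>indicator {0..t} s * f s\<bar> * \<bar>K\<bar>" by (rule mult_left_mono) simp
    then show "norm (indicator {0..t} s *\<^sub>R (f s * q s)) \<le> norm (K * (indicator {0..t} s *\<^sub>R f s))"
      by (simp add: abs_mult mult_ac)
  qed
qed

lemma bounded_set_integrable:
  fixes z :: "real \<Rightarrow> real"
  assumes "z \<in> borel_measurable borel" "\<And>s. \<bar>z s\<bar> \<le> c"
  shows "set_integrable lebesgue {0..T} z"
proof -
  have "integrable lborel (\<lambda>s. indicator {0..T} s *\<^sub>R z s)"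
    using assms by (intro integrableI_bounded_set_indicator[where B = c]) (auto simp: emeasure_lborel_Icc_eq)
  then show ?thesis unfolding set_integrable_def using assms(1) by (subst integrable_completion) auto
qed

lemma integral_density_estimate:
  assumes f: "set_integrable lebesgue {0..T} f" and z: "set_integrable lebesgue {0..T} z"
    and q: "is_density T K F q" and t: "t \<in> {0..T}"
  shows "\<bar>(LINT s:{0..t}|lebesgue. f s * q s) - (LINT s:{0..t}|lebesgue. z s * q s)\<bar>
    \<le> K * (LINT s:{0..T}|lebesgue. \<bar>f s - z s\<bar>)"
proof -
  have fz: "set_integrable lebesgue {0..T} (\<lambda>s. \<bar>f s - z s\<bar>)" by (intro set_integrable_abs set_integral_diff f z)
  have fzt: "set_integrable lebesgue {0..t} (\<lambda>s. (f s - z s) * q s)"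
    by (rule integrable_times_density[OF _ q t]) (intro set_integral_diff f z)
  have qK: "0 \<le> q s" "q s \<le> K" for s using q by (auto simp: is_density_def)
  have "(LINT s:{0..t}|lebesgue. f s * q s) - (LINT s:{0..t}|lebesgue. z s * q s)
      = (LINT s:{0..t}|lebesgue. (f s - z s) * q s)"
    using set_integral_diff(2)[OF integrable_times_density[OF f q t] integrable_times_density[OF z q t]]
    by (simp add: left_diff_distrib)
  also have "\<bar>\<dots>\<bar> \<le> (LINT s:{0..t}|lebesgue. \<bar>(f s - z s) * q s\<bar>)"
    using set_integral_norm_bound[OF fzt] by simp
  also have "\<dots> \<le> (LINT s:{0..T}|lebesgue. K * \<bar>f s - z s\<bar>)"
    unfolding set_lebesgue_integral_def
  proof (rule integral_mono)
    show "integrable lebesgue (\<lambda>s. indicator {0..t} s *\<^sub>R \<bar>(f s - z s) * q s\<bar>)"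
      using set_integrable_abs[OF fzt] unfolding set_integrable_def .
    show "integrable lebesgue (\<lambda>s. indicator {0..T} s *\<^sub>R (K * \<bar>f s - z s\<bar>))"
      using set_integrable_mult_right[of K, OF fz] unfolding set_integrable_def by simp
    fix s
    have "\<bar>f s - z s\<bar> * q s \<le> K * \<bar>f s - z s\<bar>" using qK[of s] by (metis abs_ge_zero mult.commute mult_left_mono)
    moreover have "0 \<le> K * \<bar>f s - z s\<bar>" using qK[of s] by simp
    ultimately show "indicator {0..t} s *\<^sub>R \<bar>(f s - z s) * q s\<bar> \<le> indicator {0..T} s *\<^sub>R (K * \<bar>f s - z s\<bar>)"
      using t qK[of s] by (auto simp: indicator_def abs_mult)
  qed
  also have "\<dots> = K * (LINT s:{0..T}|lebesgue. \<bar>f s - z s\<bar>)" by simp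
  finally show ?thesis .
qed

lemma simple_integral_eq_density_integral:
  assumes P: "is_partition T N ts" and q: "is_density T K (\<lambda>t. Z t \<omega>) q" and t: "t \<in> {0..T}"
  shows "simple_integral Z N ts \<xi> t \<omega> = (LINT s:{0..t}|lebesgue. simple_process N ts \<xi> s \<omega> * q s)"
proof -
  have qm: "q \<in> borel_measurable borel" and qK: "\<And>s. 0 \<le> q s" "\<And>s. q s \<le> K" using q by (auto simp: is_density_def)
  let ?h = "\<lambda>j s. indicator {0..t} s *\<^sub>R (indicator {ts j..<ts (Suc j)} s * q s)"
  have int: "integrable lborel (?h j)" for j
    using t qm qK order_trans[OF qK]
    by (intro integrableI_bounded_set_indicator[where B = K]) (auto simp: emeasure_lborel_Icc_eq indicator_def)
  have h: "(LINT s|lborel. ?h j s) = Z (min (ts (Suc j)) t) \<omega> - Z (min (ts j) t) \<omega>" if j: "j < N" for j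
  proof -
    have tj: "0 \<le> ts j" "ts j \<le> ts (Suc j)" "ts (Suc j) \<le> T"
      using partition_range[OF P, of j] partition_range[OF P, of "Suc j"] partition_mono[OF P, of j "Suc j"] j by auto
    have "AE s in lborel. s \<noteq> ts (Suc j) \<and> s \<noteq> t"
      using AE_lborel_singleton[of "ts (Suc j)"] AE_lborel_singleton[of t] by eventually_elim auto
    then have "AE s in lborel. ?h j s = indicator {min (ts j) t..min (ts (Suc j)) t} s * q s"
      by eventually_elim (use tj t in \<open>auto simp: indicator_def min_def\<close>)
    then have "(LINT s|lborel. ?h j s) = (LINT s|lborel. indicator {min (ts j) t..min (ts (Suc j)) t} s * q s)"
      using qm by (intro integral_cong_AE) auto
    also have "\<dots> = Z (min (ts (Suc j)) t) \<omega> - Z (min (ts j) t) \<omega>"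
    proof -
      have "0 \<le> min (ts j) t" "min (ts j) t \<le> min (ts (Suc j)) t" "min (ts (Suc j)) t \<le> T" using tj t by auto
      then show ?thesis using q unfolding is_density_def by simp
    qed
    finally show ?thesis .
  qed
  have "(LINT s:{0..t}|lebesgue. simple_process N ts \<xi> s \<omega> * q s)
      = (LINT s|lborel. indicator {0..t} s *\<^sub>R (simple_process N ts \<xi> s \<omega> * q s))"
    unfolding set_lebesgue_integral_def using qm simple_process_measurable by (intro integral_completion) auto
  also have "\<dots> = (LINT s|lborel. (\<Sum>j<N. \<xi> j \<omega> * ?h j s))"
    unfolding simple_process_def real_scaleR_def sum_distrib_right sum_distrib_left
    by (intro Bochner_Integration.integral_cong refl sum.cong) (simp_all only: mult_ac)
  also have "\<dots> = (\<Sum>j<N. \<xi> j \<omega> * (LINT s|lborel. ?h j s))"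
  proof (subst Bochner_Integration.integral_sum)
    show "integrable lborel (\<lambda>s. \<xi> j \<omega> * ?h j s)" for j by (rule integrable_mult_right[OF int])
  qed (simp only: integral_mult_right_zero)
  also have "\<dots> = simple_integral Z N ts \<xi> t \<omega>"
    unfolding simple_integral_def using h by (intro sum.cong) auto
  finally show ?thesis by simp
qed

section \<open>Path regularity in the process spaces\<close>

lemma S_G0_continuous:
  assumes "\<eta> \<in> S_G0 T" shows "continuous_on UNIV (\<lambda>t. \<eta> t \<omega>)"
proof -
  obtain \<theta> ts where \<eta>: "\<eta> = (\<lambda>t \<omega>. \<theta> (t # map (\<lambda>s. canonical (min s t) \<omega>) ts))" and \<theta>: "\<theta> \<in> C_b_Lip (Suc (length ts))"
    using assms unfolding S_G0_def by blast
  have "\<theta> \<in> C_l_Lip (Suc (length ts))" using \<theta> C_b_Lip_subset by blast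
  then show ?thesis
    unfolding \<eta>
  proof (rule C_l_Lip_continuous_comp)
    fix i assume i: "i < Suc (length ts)"
    show "continuous_on UNIV (\<lambda>t. (t # map (\<lambda>s. canonical (min s t) \<omega>) ts) ! i)"
    proof (cases i)
      case (Suc j)
      have "continuous_on UNIV (\<lambda>t. apply_bcontfun \<omega> (min (ts ! j) t))"
        by (rule continuous_on_compose2[of UNIV "apply_bcontfun \<omega>"]) (auto intro!: continuous_intros)
      then show ?thesis using Suc i by (simp add: canonical_def)
    qed simp
  qed simp
qed

lemma powr_add_le:
  fixes a b p :: real
  assumes "0 \<le> p"
  shows "\<bar>a + b\<bar> powr p \<le> 2 powr p * (\<bar>a\<bar> powr p + \<bar>b\<bar> powr p)"
proof -
  have "\<bar>a + b\<bar> powr p \<le> (2 * max \<bar>a\<bar> \<bar>b\<bar>) powr p" using assms by (intro powr_mono2) auto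
  also have "\<dots> = 2 powr p * max \<bar>a\<bar> \<bar>b\<bar> powr p" by (subst powr_mult) auto
  also have "\<dots> \<le> 2 powr p * (\<bar>a\<bar> powr p + \<bar>b\<bar> powr p)"
    by (intro mult_left_mono) (auto simp: max_def)
  finally show ?thesis .
qed

lemma ennreal_powr_add_le:
  assumes "0 \<le> p"
  shows "ennreal (\<bar>a + b\<bar> powr p) \<le> ennreal (2 powr p) * (ennreal (\<bar>a\<bar> powr p) + ennreal (\<bar>b\<bar> powr p))"
  using ennreal_leI[OF powr_add_le[OF assms, of a b]] by (simp add: ennreal_mult)

lemma time_integral_mono: "(\<And>s. s \<in> {0..T} \<Longrightarrow> \<phi> s \<le> \<psi> s) \<Longrightarrow> time_integral T \<phi> \<le> time_integral T \<psi>"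
  unfolding time_integral_def upper_integral_eq_upper_sup
  by (rule upper_sup_mono_off_null[where N = "{}"]) (auto simp: space_restrict_space)

lemma time_integral_cong: "(\<And>s. s \<in> {0..T} \<Longrightarrow> \<phi> s = \<psi> s) \<Longrightarrow> time_integral T \<phi> = time_integral T \<psi>"
  by (intro antisym time_integral_mono) auto

lemma time_integral_add: "time_integral T (\<lambda>s. \<phi> s + \<psi> s) \<le> time_integral T \<phi> + time_integral T \<psi>"
  unfolding time_integral_def upper_integral_eq_upper_sup by (rule upper_sup_add) auto

lemma time_integral_cmult: "c > 0 \<Longrightarrow> time_integral T (\<lambda>s. ennreal c * \<phi> s) \<le> ennreal c * time_integral T \<phi>"
  unfolding time_integral_def upper_integral_eq_upper_sup by (rule upper_sup_cmult) auto

context path_probabilities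
begin

text \<open>
  Along a subsequence the approximating continuous processes converge uniformly on quasi every path.
\<close>
lemma S_G_continuous:
  assumes \<eta>: "\<eta> \<in> S_G T PP p" and p: "p > 0"
  shows "qs (\<lambda>\<omega>. continuous_on {0..T} (\<lambda>t. \<eta> t \<omega>))"
proof -
  obtain \<zeta> where \<zeta>: "\<And>n. \<zeta> n \<in> S_G0 T" and lim: "(\<lambda>n. S_normp T PP p (\<lambda>t \<omega>. \<eta> t \<omega> - \<zeta> n t \<omega>)) \<longlonglongrightarrow> 0"
    using \<eta> unfolding S_G_def norm_completion_def by blast
  obtain k :: "nat \<Rightarrow> nat" where
    "qs (\<lambda>\<omega>. (\<lambda>n. SUP t\<in>{0..T}. ennreal (\<bar>\<eta> t \<omega> - \<zeta> (k n) t \<omega>\<bar> powr p)) \<longlonglongrightarrow> 0)"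
    using UE_Borel_Cantelli[OF lim[unfolded S_normp_def]] by blast
  then show ?thesis
  proof (rule qs_mono)
    fix \<omega>
    assume L: "(\<lambda>n. SUP t\<in>{0..T}. ennreal (\<bar>\<eta> t \<omega> - \<zeta> (k n) t \<omega>\<bar> powr p)) \<longlonglongrightarrow> 0"
    have "uniform_limit {0..T} (\<lambda>n t. \<zeta> (k n) t \<omega>) (\<lambda>t. \<eta> t \<omega>) sequentially"
      unfolding uniform_limit_iff
    proof (intro allI impI)
      fix e :: real assume e: "e > 0"
      have "\<forall>\<^sub>F n in sequentially. (SUP t\<in>{0..T}. ennreal (\<bar>\<eta> t \<omega> - \<zeta> (k n) t \<omega>\<bar> powr p)) < ennreal (e powr p)"
        using L by (rule order_tendstoD) (use e in simp)
      then show "\<forall>\<^sub>F n in sequentially. \<forall>t\<in>{0..T}. dist (\<zeta> (k n) t \<omega>) (\<eta> t \<omega>) < e"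
      proof eventually_elim
        case (elim n)
        show ?case
        proof
          fix t assume "t \<in> {0..T}"
          then have "ennreal (\<bar>\<eta> t \<omega> - \<zeta> (k n) t \<omega>\<bar> powr p)
              \<le> (SUP t\<in>{0..T}. ennreal (\<bar>\<eta> t \<omega> - \<zeta> (k n) t \<omega>\<bar> powr p))" by (rule SUP_upper)
          with elim have "ennreal (\<bar>\<eta> t \<omega> - \<zeta> (k n) t \<omega>\<bar> powr p) < ennreal (e powr p)"
            by (rule order.strict_trans1[rotated])
          then have "\<bar>\<eta> t \<omega> - \<zeta> (k n) t \<omega>\<bar> powr p < e powr p" by (simp add: ennreal_less_iff)
          then have "\<bar>\<eta> t \<omega> - \<zeta> (k n) t \<omega>\<bar> < e" using e p powr_mono2[of p e "\<bar>\<eta> t \<omega> - \<zeta> (k n) t \<omega>\<bar>"] by fastforce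
          then show "dist (\<zeta> (k n) t \<omega>) (\<eta> t \<omega>) < e" by (simp add: dist_real_def abs_minus_commute)
        qed
      qed
    qed
    then show "continuous_on {0..T} (\<lambda>t. \<eta> t \<omega>)"
    proof (rule uniform_limit_theorem[rotated])
      show "\<forall>\<^sub>F n in sequentially. continuous_on {0..T} (\<lambda>t. \<zeta> (k n) t \<omega>)"
        using S_G0_continuous[OF \<zeta>] by (intro always_eventually allI) (rule continuous_on_subset, auto)
    qed simp
  qed
qed

lemma M_G_approximation:
  assumes "\<eta> \<in> M_G T PP p"
  shows "\<exists>N ts \<xi>. (\<forall>n::nat. simple_data T (N n) (ts n) (\<xi> n)) \<and>
    (\<lambda>n. M_normp T PP p (\<lambda>t \<omega>. \<eta> t \<omega> - simple_process (N n) (ts n) (\<xi> n) t \<omega>)) \<longlonglongrightarrow> 0"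
proof -
  obtain \<zeta> where \<zeta>: "\<And>n::nat. \<zeta> n \<in> M_G0 T" and lim: "(\<lambda>n. M_normp T PP p (\<lambda>t \<omega>. \<eta> t \<omega> - \<zeta> n t \<omega>)) \<longlonglongrightarrow> 0"
    using assms unfolding M_G_def norm_completion_def by blast
  have "\<forall>n. \<exists>N ts \<xi>. \<zeta> n = simple_process N ts \<xi> \<and> simple_data T N ts \<xi>"
    using \<zeta> unfolding M_G0_def by blast
  then obtain N ts \<xi> where *: "\<And>n. \<zeta> n = simple_process (N n) (ts n) (\<xi> n)" "\<And>n. simple_data T (N n) (ts n) (\<xi> n)"
    by metis
  show ?thesis using *(2) lim unfolding *(1) by blast
qed

lemma M_G_integrable:
  assumes \<eta>: "\<eta> \<in> M_G T PP p" and p: "p \<ge> 1"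
  shows "qs (\<lambda>\<omega>. set_integrable lebesgue {0..T} (\<lambda>t. \<eta> t \<omega>))"
proof -
  obtain N ts \<xi> where lim: "(\<lambda>n. M_normp T PP p (\<lambda>t \<omega>. \<eta> t \<omega> - simple_process (N n) (ts n) (\<xi> n) t \<omega>)) \<longlonglongrightarrow> 0"
    using M_G_approximation[OF \<eta>] by blast
  obtain k :: "nat \<Rightarrow> nat" where "qs (\<lambda>\<omega>. (\<lambda>n. time_integral T (\<lambda>s. ennreal
      (\<bar>\<eta> s \<omega> - simple_process (N (k n)) (ts (k n)) (\<xi> (k n)) s \<omega>\<bar> powr p))) \<longlonglongrightarrow> 0)"
    using UE_Borel_Cantelli[OF lim[unfolded M_normp_def]] by blast
  then show ?thesis
    by (rule qs_mono) (rule integrable_of_time_approximation[OF p simple_process_measurable simple_process_bounded])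
qed

lemma M_normp_diff:
  assumes p: "0 \<le> p"
  shows "M_normp T PP p (\<lambda>t \<omega>. \<eta> t \<omega> - \<eta>' t \<omega>) \<le> ennreal (2 powr p) * (M_normp T PP p \<eta> + M_normp T PP p \<eta>')"
proof -
  let ?I = "\<lambda>\<eta> \<omega>. time_integral T (\<lambda>s. ennreal (\<bar>\<eta> s \<omega>\<bar> powr p))"
  have "?I (\<lambda>t \<omega>. \<eta> t \<omega> - \<eta>' t \<omega>) \<omega> \<le> ennreal (2 powr p) * (?I \<eta> \<omega> + ?I \<eta>' \<omega>)" for \<omega>
  proof -
    have "?I (\<lambda>t \<omega>. \<eta> t \<omega> - \<eta>' t \<omega>) \<omega> \<le> time_integral T (\<lambda>s. ennreal (2 powr p) * (ennreal (\<bar>\<eta> s \<omega>\<bar> powr p) + ennreal (\<bar>\<eta>' s \<omega>\<bar> powr p)))"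
      by (intro time_integral_mono) (use ennreal_powr_add_le[OF p, of "\<eta> _ \<omega>" "- \<eta>' _ \<omega>"] in simp)
    also have "\<dots> \<le> ennreal (2 powr p) * (?I \<eta> \<omega> + ?I \<eta>' \<omega>)"
      by (rule order_trans[OF time_integral_cmult]) (auto intro: mult_left_mono time_integral_add)
    finally show ?thesis .
  qed
  then have "M_normp T PP p (\<lambda>t \<omega>. \<eta> t \<omega> - \<eta>' t \<omega>) \<le> UE (\<lambda>\<omega>. ennreal (2 powr p) * (?I \<eta> \<omega> + ?I \<eta>' \<omega>))"
    unfolding M_normp_def by (rule UE_mono)
  also have "\<dots> \<le> ennreal (2 powr p) * UE (\<lambda>\<omega>. ?I \<eta> \<omega> + ?I \<eta>' \<omega>)" by (rule UE_cmult) simp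
  also have "\<dots> \<le> ennreal (2 powr p) * (UE (?I \<eta>) + UE (?I \<eta>'))" by (intro mult_left_mono UE_add) simp
  finally show ?thesis unfolding M_normp_def .
qed

lemma M_G_diff:
  assumes \<eta>: "\<eta> \<in> M_G T PP p" and \<eta>': "\<eta>' \<in> M_G T PP p" and p: "0 \<le> p"
  shows "(\<lambda>t \<omega>. \<eta> t \<omega> - \<eta>' t \<omega>) \<in> M_G T PP p"
proof -
  obtain N ts \<xi> where D: "\<And>n::nat. simple_data T (N n) (ts n) (\<xi> n)"
    and lim: "(\<lambda>n. M_normp T PP p (\<lambda>t \<omega>. \<eta> t \<omega> - simple_process (N n) (ts n) (\<xi> n) t \<omega>)) \<longlonglongrightarrow> 0"
    using M_G_approximation[OF \<eta>] by blast
  obtain N' ts' \<xi>' where D': "\<And>n::nat. simple_data T (N' n) (ts' n) (\<xi>' n)"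
    and lim': "(\<lambda>n. M_normp T PP p (\<lambda>t \<omega>. \<eta>' t \<omega> - simple_process (N' n) (ts' n) (\<xi>' n) t \<omega>)) \<longlonglongrightarrow> 0"
    using M_G_approximation[OF \<eta>'] by blast
  define \<zeta> where "\<zeta> n t \<omega> = simple_process (N n) (ts n) (\<xi> n) t \<omega> - simple_process (N' n) (ts' n) (\<xi>' n) t \<omega>" for n t \<omega>
  have "\<zeta> n \<in> M_G0 T" for n
  proof -
    obtain M us z where *: "simple_data T M us z" "\<And>t \<omega>. simple_process M us z t \<omega> = \<zeta> n t \<omega>"
      using simple_process_diff[OF D[of n] D'[of n] T_pos] unfolding \<zeta>_def by blast
    then have "\<zeta> n = simple_process M us z" by (intro ext) simp
    then show ?thesis unfolding M_G0_def using *(1) by blast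
  qed
  moreover have "(\<lambda>n. M_normp T PP p (\<lambda>t \<omega>. (\<eta> t \<omega> - \<eta>' t \<omega>) - \<zeta> n t \<omega>)) \<longlonglongrightarrow> 0"
  proof (rule tendsto_sandwich[OF always_eventually always_eventually tendsto_const])
    let ?a = "\<lambda>n. M_normp T PP p (\<lambda>t \<omega>. \<eta> t \<omega> - simple_process (N n) (ts n) (\<xi> n) t \<omega>)"
    let ?b = "\<lambda>n. M_normp T PP p (\<lambda>t \<omega>. \<eta>' t \<omega> - simple_process (N' n) (ts' n) (\<xi>' n) t \<omega>)"
    show "\<forall>n. 0 \<le> M_normp T PP p (\<lambda>t \<omega>. (\<eta> t \<omega> - \<eta>' t \<omega>) - \<zeta> n t \<omega>)" by simp
    show "\<forall>n. M_normp T PP p (\<lambda>t \<omega>. (\<eta> t \<omega> - \<eta>' t \<omega>) - \<zeta> n t \<omega>) \<le> ennreal (2 powr p) * (?a n + ?b n)"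
    proof
      fix n
      have "(\<lambda>t \<omega>. (\<eta> t \<omega> - \<eta>' t \<omega>) - \<zeta> n t \<omega>) = (\<lambda>t \<omega>. (\<eta> t \<omega> - simple_process (N n) (ts n) (\<xi> n) t \<omega>)
          - (\<eta>' t \<omega> - simple_process (N' n) (ts' n) (\<xi>' n) t \<omega>))" by (simp add: \<zeta>_def algebra_simps)
      then show "M_normp T PP p (\<lambda>t \<omega>. (\<eta> t \<omega> - \<eta>' t \<omega>) - \<zeta> n t \<omega>) \<le> ennreal (2 powr p) * (?a n + ?b n)"
        using M_normp_diff[OF p] by simp
    qed
    have "(\<lambda>n. ennreal (2 powr p) * (?a n + ?b n)) \<longlonglongrightarrow> ennreal (2 powr p) * (0 + 0)"
      by (intro ennreal_tendsto_cmult tendsto_add lim lim') simp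
    then show "(\<lambda>n. ennreal (2 powr p) * (?a n + ?b n)) \<longlonglongrightarrow> 0" by simp
  qed
  ultimately show ?thesis unfolding M_G_def norm_completion_def by blast
qed

text \<open>
  The two integrands lie at the same distance from every simple process, so the same processes qualify as
  their integral and the same one is chosen.
\<close>
lemma dB_integral_cong:
  assumes "qs (\<lambda>\<omega>. \<forall>t\<in>{0..T}. \<eta> t \<omega> = \<eta>' t \<omega>)"
  shows "dB_integral T PP p \<eta> = dB_integral T PP p \<eta>'"
proof -
  have "H_normp T PP p (\<lambda>t \<omega>. \<eta> t \<omega> - \<zeta> t \<omega>) = H_normp T PP p (\<lambda>t \<omega>. \<eta>' t \<omega> - \<zeta> t \<omega>)" for \<zeta>
    unfolding H_normp_def using assms
    by (intro UE_cong_qs) (auto elim!: qs_mono intro!: arg_cong2[where f = ennpowr] time_integral_cong)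
  then show ?thesis unfolding dB_integral_def is_integral_process_def by simp
qed

end

section \<open>Integrals against the quadratic variation\<close>

context G_setting
begin

lemma quadratic_variation_density:
  assumes Q: "quadratic_variation T PP Q"
  obtains qd K where "K > 0" "qs (\<lambda>\<omega>. is_density T K (\<lambda>t. Q t \<omega>) (qd \<omega>))"
proof -
  define K where "K = shigh\<^sup>2 + 1"
  have K: "K > 0" unfolding K_def by (intro add_nonneg_pos) auto
  have "qs (\<lambda>\<omega>. is_density T K (\<lambda>t. Q t \<omega>) (SOME q. is_density T K (\<lambda>t. Q t \<omega>) q))"
    using quadratic_variation_Lipschitz[OF Q]
  proof (rule qs_mono)
    fix \<omega>
    assume L: "\<forall>s t. 0 \<le> s \<longrightarrow> s \<le> t \<longrightarrow> t \<le> T \<longrightarrow> 0 \<le> Q t \<omega> - Q s \<omega> \<and> Q t \<omega> - Q s \<omega> \<le> shigh\<^sup>2 * (t - s)"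
    have "\<forall>s t. 0 \<le> s \<longrightarrow> s \<le> t \<longrightarrow> t \<le> T \<longrightarrow> 0 \<le> Q t \<omega> - Q s \<omega> \<and> Q t \<omega> - Q s \<omega> \<le> K * (t - s)"
    proof (intro allI impI)
      fix s t assume st: "0 \<le> s" "s \<le> t" "t \<le> T"
      have "0 \<le> Q t \<omega> - Q s \<omega> \<and> Q t \<omega> - Q s \<omega> \<le> shigh\<^sup>2 * (t - s)" using L st by blast
      moreover have "shigh\<^sup>2 * (t - s) \<le> K * (t - s)" unfolding K_def using st by (intro mult_right_mono) auto
      ultimately show "0 \<le> Q t \<omega> - Q s \<omega> \<and> Q t \<omega> - Q s \<omega> \<le> K * (t - s)" by linarith
    qed
    then show "is_density T K (\<lambda>t. Q t \<omega>) (SOME q. is_density T K (\<lambda>t. Q t \<omega>) q)"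
      by (intro someI_ex[of "is_density T K (\<lambda>t. Q t \<omega>)"] Lipschitz_path_density[OF K T_pos])
  qed
  with K show ?thesis by (rule that)
qed

text \<open>
  On each path the error is at most \<open>K \<integral> |\<eta> - \<zeta>| ds\<close> for the simple process \<open>\<zeta>\<close>, and Jensen's inequality bounds its
  \<open>p\<close>-th power by the integral defining the norm of \<open>M_G\<close>.
\<close>
lemma S_norm_pathwise_estimate:
  assumes \<eta>: "\<eta> \<in> M_G T PP p" and p: "p \<ge> 1" and D: "simple_data T N ts \<xi>"
    and K: "K > 0" and qd: "qs (\<lambda>\<omega>. is_density T K (\<lambda>t. Q t \<omega>) (qd \<omega>))"
  shows "S_normp T PP p (\<lambda>t \<omega>. (LINT s:{0..t}|lebesgue. \<eta> s \<omega> * qd \<omega> s) - simple_integral Q N ts \<xi> t \<omega>)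
    \<le> ennreal (K powr p * T powr (p - 1)) * M_normp T PP p (\<lambda>t \<omega>. \<eta> t \<omega> - simple_process N ts \<xi> t \<omega>)"
proof -
  have P: "is_partition T N ts" using D by (simp add: simple_data_def)
  let ?C = "K powr p * T powr (p - 1)"
  have C: "0 < ?C" using K T_pos by simp
  have "S_normp T PP p (\<lambda>t \<omega>. (LINT s:{0..t}|lebesgue. \<eta> s \<omega> * qd \<omega> s) - simple_integral Q N ts \<xi> t \<omega>)
    \<le> UE (\<lambda>\<omega>. ennreal ?C * time_integral T (\<lambda>s. ennreal (\<bar>\<eta> s \<omega> - simple_process N ts \<xi> s \<omega>\<bar> powr p)))"
    unfolding S_normp_def
  proof (rule UE_mono_qs, rule qs_mono[OF qs_conj[OF M_G_integrable[OF \<eta> p] qd]], elim conjE)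
    fix \<omega>
    assume f: "set_integrable lebesgue {0..T} (\<lambda>t. \<eta> t \<omega>)" and q: "is_density T K (\<lambda>t. Q t \<omega>) (qd \<omega>)"
    let ?z = "\<lambda>s. simple_process N ts \<xi> s \<omega>"
    have z: "set_integrable lebesgue {0..T} ?z"
      by (rule bounded_set_integrable[OF simple_process_measurable simple_process_bounded])
    define I where "I = (LINT s:{0..T}|lebesgue. \<bar>\<eta> s \<omega> - ?z s\<bar>)"
    show "(SUP t\<in>{0..T}. ennreal (\<bar>(LINT s:{0..t}|lebesgue. \<eta> s \<omega> * qd \<omega> s) - simple_integral Q N ts \<xi> t \<omega>\<bar> powr p))
      \<le> ennreal ?C * time_integral T (\<lambda>s. ennreal (\<bar>\<eta> s \<omega> - ?z s\<bar> powr p))"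
    proof (rule SUP_least)
      fix t assume t: "t \<in> {0..T}"
      have le: "\<bar>(LINT s:{0..t}|lebesgue. \<eta> s \<omega> * qd \<omega> s) - simple_integral Q N ts \<xi> t \<omega>\<bar> \<le> K * I"
        unfolding simple_integral_eq_density_integral[of T N ts K Q \<omega> "qd \<omega>" t, OF P q t] I_def by (rule integral_density_estimate[OF f z q t])
      have I: "0 \<le> I" unfolding I_def set_lebesgue_integral_def by (intro integral_nonneg_AE) auto
      have "ennreal (\<bar>(LINT s:{0..t}|lebesgue. \<eta> s \<omega> * qd \<omega> s) - simple_integral Q N ts \<xi> t \<omega>\<bar> powr p) \<le> ennreal ((K * I) powr p)"
        using le p by (intro ennreal_leI powr_mono2) auto
      also have "\<dots> = ennreal (K powr p) * ennreal (I powr p)"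
        using K I by (simp add: powr_mult ennreal_mult)
      also have "\<dots> \<le> ennreal (K powr p) * (ennreal (T powr (p - 1)) * time_integral T (\<lambda>s. ennreal (\<bar>\<eta> s \<omega> - ?z s\<bar> powr p)))"
        unfolding I_def by (intro mult_left_mono power_of_time_integral_le[OF T_pos p] set_integral_diff f z) simp
      also have "\<dots> = ennreal ?C * time_integral T (\<lambda>s. ennreal (\<bar>\<eta> s \<omega> - ?z s\<bar> powr p))"
        by (simp add: ennreal_mult mult.assoc)
      finally show "ennreal (\<bar>(LINT s:{0..t}|lebesgue. \<eta> s \<omega> * qd \<omega> s) - simple_integral Q N ts \<xi> t \<omega>\<bar> powr p)
        \<le> ennreal ?C * time_integral T (\<lambda>s. ennreal (\<bar>\<eta> s \<omega> - ?z s\<bar> powr p))" .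
    qed
  qed
  also have "\<dots> \<le> ennreal ?C * M_normp T PP p (\<lambda>t \<omega>. \<eta> t \<omega> - simple_process N ts \<xi> t \<omega>)"
    unfolding M_normp_def by (rule UE_cmult[OF C])
  finally show ?thesis .
qed

text \<open>
  By the estimate above the pathwise integral is a limit of the integrals of every approximating
  sequence. This shows at once that an integral process exists, so that the chosen version is one, and that it
  agrees with the pathwise integral quasi-surely.
\<close>
lemma dQ_integral_pathwise:
  assumes \<eta>: "\<eta> \<in> M_G T PP p" and p: "p \<ge> 1"
    and K: "K > 0" and qd: "qs (\<lambda>\<omega>. is_density T K (\<lambda>t. Q t \<omega>) (qd \<omega>))"
  shows "qs (\<lambda>\<omega>. \<forall>t\<in>{0..T}. dQ_integral T PP p Q \<eta> t \<omega> = (LINT s:{0..t}|lebesgue. \<eta> s \<omega> * qd \<omega> s))"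
proof -
  define J where "J t \<omega> = (LINT s:{0..t}|lebesgue. \<eta> s \<omega> * qd \<omega> s)" for t \<omega>
  have J: "(\<lambda>n. S_normp T PP p (\<lambda>t \<omega>. J t \<omega> - simple_integral Q (N n) (ts n) (\<xi> n) t \<omega>)) \<longlonglongrightarrow> 0"
    if D: "\<And>n::nat. simple_data T (N n) (ts n) (\<xi> n)"
      and lim: "(\<lambda>n. M_normp T PP p (\<lambda>t \<omega>. \<eta> t \<omega> - simple_process (N n) (ts n) (\<xi> n) t \<omega>)) \<longlonglongrightarrow> 0"
    for N ts \<xi>
  proof (rule tendsto_sandwich[OF always_eventually always_eventually tendsto_const])
    let ?m = "\<lambda>n. M_normp T PP p (\<lambda>t \<omega>. \<eta> t \<omega> - simple_process (N n) (ts n) (\<xi> n) t \<omega>)"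
    show "\<forall>n. 0 \<le> S_normp T PP p (\<lambda>t \<omega>. J t \<omega> - simple_integral Q (N n) (ts n) (\<xi> n) t \<omega>)" by simp
    show "\<forall>n. S_normp T PP p (\<lambda>t \<omega>. J t \<omega> - simple_integral Q (N n) (ts n) (\<xi> n) t \<omega>)
        \<le> ennreal (K powr p * T powr (p - 1)) * ?m n"
      unfolding J_def using S_norm_pathwise_estimate[OF \<eta> p D K qd] by blast
    have "(\<lambda>n. ennreal (K powr p * T powr (p - 1)) * ?m n) \<longlonglongrightarrow> ennreal (K powr p * T powr (p - 1)) * 0"
      by (intro ennreal_tendsto_cmult lim) simp
    then show "(\<lambda>n. ennreal (K powr p * T powr (p - 1)) * ?m n) \<longlonglongrightarrow> 0" by simp
  qed
  have "is_integral_process T PP p (M_normp T PP p) Q \<eta> J"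
  proof -
    obtain N ts \<xi> where *: "\<And>n::nat. simple_data T (N n) (ts n) (\<xi> n)"
      "(\<lambda>n. M_normp T PP p (\<lambda>t \<omega>. \<eta> t \<omega> - simple_process (N n) (ts n) (\<xi> n) t \<omega>)) \<longlonglongrightarrow> 0"
      using M_G_approximation[OF \<eta>] by blast
    show ?thesis unfolding is_integral_process_def using *(1) *(2) J[OF *] by blast
  qed
  then have "is_integral_process T PP p (M_normp T PP p) Q \<eta> (dQ_integral T PP p Q \<eta>)"
    unfolding dQ_integral_def by (rule someI[of "is_integral_process T PP p (M_normp T PP p) Q \<eta>"])
  then obtain N ts \<xi> where D: "\<And>n::nat. simple_data T (N n) (ts n) (\<xi> n)"
    and lim: "(\<lambda>n. M_normp T PP p (\<lambda>t \<omega>. \<eta> t \<omega> - simple_process (N n) (ts n) (\<xi> n) t \<omega>)) \<longlonglongrightarrow> 0"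
    and lim': "(\<lambda>n. S_normp T PP p (\<lambda>t \<omega>. dQ_integral T PP p Q \<eta> t \<omega> - simple_integral Q (N n) (ts n) (\<xi> n) t \<omega>)) \<longlonglongrightarrow> 0"
    unfolding is_integral_process_def by blast
  let ?I = "dQ_integral T PP p Q \<eta>"
  have "qs (\<lambda>\<omega>. (SUP t\<in>{0..T}. ennreal (\<bar>?I t \<omega> - J t \<omega>\<bar> powr p)) = 0)"
  proof (rule qs_zero_of_vanishing_bounds[OF lim'[unfolded S_normp_def] J[OF D lim, unfolded S_normp_def]])
    fix n
    let ?a = "\<lambda>t \<omega>. ?I t \<omega> - simple_integral Q (N n) (ts n) (\<xi> n) t \<omega>"
    let ?b = "\<lambda>t \<omega>. J t \<omega> - simple_integral Q (N n) (ts n) (\<xi> n) t \<omega>"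
    show "qs (\<lambda>\<omega>. (SUP t\<in>{0..T}. ennreal (\<bar>?I t \<omega> - J t \<omega>\<bar> powr p))
      \<le> ennreal (2 powr p) * ((SUP t\<in>{0..T}. ennreal (\<bar>?a t \<omega>\<bar> powr p)) + (SUP t\<in>{0..T}. ennreal (\<bar>?b t \<omega>\<bar> powr p))))"
    proof (rule qs_all, rule SUP_least)
      fix \<omega> t assume t: "t \<in> {0..T}"
      have "ennreal (\<bar>?I t \<omega> - J t \<omega>\<bar> powr p) \<le> ennreal (2 powr p) * (ennreal (\<bar>?a t \<omega>\<bar> powr p) + ennreal (\<bar>?b t \<omega>\<bar> powr p))"
      proof -
        have "?a t \<omega> + - ?b t \<omega> = ?I t \<omega> - J t \<omega>" by simp
        then show ?thesis using ennreal_powr_add_le[of p "?a t \<omega>" "- ?b t \<omega>"] p by (simp only: abs_minus_cancel)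
      qed
      also have "\<dots> \<le> ennreal (2 powr p) * ((SUP t\<in>{0..T}. ennreal (\<bar>?a t \<omega>\<bar> powr p)) + (SUP t\<in>{0..T}. ennreal (\<bar>?b t \<omega>\<bar> powr p)))"
        by (intro mult_left_mono add_mono SUP_upper t) simp
      finally show "ennreal (\<bar>?I t \<omega> - J t \<omega>\<bar> powr p) \<le> ennreal (2 powr p) * ((SUP t\<in>{0..T}. ennreal (\<bar>?a t \<omega>\<bar> powr p)) + (SUP t\<in>{0..T}. ennreal (\<bar>?b t \<omega>\<bar> powr p)))" .
    qed
  qed simp
  then show ?thesis
  proof (rule qs_mono, intro ballI)
    fix \<omega> t assume 0: "(SUP t\<in>{0..T}. ennreal (\<bar>?I t \<omega> - J t \<omega>\<bar> powr p)) = 0" and t: "t \<in> {0..T}"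
    have "ennreal (\<bar>?I t \<omega> - J t \<omega>\<bar> powr p) \<le> 0" unfolding 0[symmetric] using t by (rule SUP_upper)
    then have "\<bar>?I t \<omega> - J t \<omega>\<bar> powr p \<le> 0" by (simp add: ennreal_eq_0_iff)
    then show "?I t \<omega> = (LINT s:{0..t}|lebesgue. \<eta> s \<omega> * qd \<omega> s)" unfolding J_def[symmetric] using powr_eq_0_iff[of "\<bar>?I t \<omega> - J t \<omega>\<bar>" p] by (metis abs_ge_zero abs_eq_0 eq_iff_diff_eq_0 order_antisym powr_ge_zero)
  qed
qed

end

section \<open>Reflection along a path\<close>

lemma stieltjes_measure_Ioc:
  assumes cont: "continuous_on {0..T} a" and mono: "mono_on {0..T} a" and a0: "0 \<le> a 0" and T: "T > 0"
    and st: "s \<le> t"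
  shows "emeasure (stieltjes_measure T a) {s<..t} =
    ennreal ((if t < 0 then 0 else a (min t T)) - (if s < 0 then 0 else a (min s T)))"
  unfolding stieltjes_measure_def
proof (rule emeasure_interval_measure_Ioc[OF st])
  have a_mono: "a (min x T) \<le> a (min y T)" if "0 \<le> x" "x \<le> y" for x y
    using that T by (intro mono_onD[OF mono]) auto
  show "(if x < 0 then 0 else a (min x T)) \<le> (if y < 0 then 0 else a (min y T))" if "x \<le> y" for x y
    using a_mono[of 0 y] a_mono[of x y] a0 that T by auto
  fix x :: real
  define F where "F t = (if t < 0 then 0 else a (min t T))" for t
  define F' where "F' t = a (max 0 (min t T))" for t
  have contF': "continuous_on UNIV F'"
    unfolding F'_def by (rule continuous_on_compose2[OF cont]) (use T in \<open>auto intro!: continuous_intros\<close>)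
  have "(F \<longlongrightarrow> F x) (at_right x)"
  proof (cases "x < 0")
    case True
    have "\<forall>\<^sub>F t in at_right x. F t = 0"
      unfolding eventually_at_right_field using True by (intro exI[of _ 0]) (auto simp: F_def)
    then have "(F \<longlongrightarrow> 0) (at_right x)" by (rule tendsto_eventually)
    then show ?thesis using True by (simp add: F_def)
  next
    case False
    have "(F' \<longlongrightarrow> F' x) (at_right x)"
      using contF' unfolding continuous_on_def by (blast intro: tendsto_within_subset[OF _ subset_UNIV])
    moreover have "\<forall>\<^sub>F t in at_right x. F' t = F t"
      unfolding eventually_at_right_field using False T by (intro exI[of _ "x + 1"]) (auto simp: F_def F'_def)
    ultimately have "(F \<longlongrightarrow> F' x) (at_right x)" by (rule Lim_transform_eventually)
    then show ?thesis using False T by (simp add: F_def F'_def)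
  qed
  then show "continuous (at_right x) (\<lambda>t. if t < 0 then 0 else a (min t T))"
    unfolding continuous_within F_def[abs_def] .
qed

text \<open>
  A nonnegative function with zero integral vanishes almost everywhere, so the complement of its zero set
  carries no mass. The interval \<open>(-1, t]\<close> captures the atom at time 0, since there is no mass to the left of 0.
\<close>
lemma grows_only_on_zero_set:
  fixes k :: "real \<Rightarrow> real"
  assumes cont: "continuous_on {0..T} a" and mono: "mono_on {0..T} a" and a0: "0 \<le> a 0" and T: "T > 0"
    and int: "has_bochner_integral (stieltjes_measure T a) (\<lambda>s. indicator {0..T} s * k s) 0"
    and k: "\<And>s. s \<in> {0..T} \<Longrightarrow> 0 \<le> k s"
  shows "grows_only_on T a {s \<in> {0..T}. k s = 0}"
proof -
  let ?M = "stieltjes_measure T a"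
  have sets: "sets ?M = sets borel" "space ?M = UNIV" by (simp_all add: stieltjes_measure_def)
  have "AE s in ?M. indicator {0..T} s * k s = 0"
    using int k
    by (intro integral_nonneg_eq_0_iff_AE[THEN iffD1]) (auto simp: has_bochner_integral_iff indicator_def)
  then have ae: "AE s in ?M. s \<in> {0..T} \<longrightarrow> k s = 0" by eventually_elim (auto simp: indicator_def)
  have null: "emeasure ?M B = 0" if "B \<in> sets borel" "B \<subseteq> {0..T}" "B \<inter> {s \<in> {0..T}. k s = 0} = {}" for B
  proof -
    have "AE s in ?M. s \<notin> B" using ae by eventually_elim (use that in blast)
    then show ?thesis using that(1) by (subst (asm) AE_iff_measurable[of B]) (auto simp: sets)
  qed
  note Ioc = stieltjes_measure_Ioc[OF cont mono a0 T]
  have nn: "0 \<le> a t" if "t \<in> {0..T}" for t using mono_onD[OF mono, of 0 t] a0 that by auto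
  show ?thesis
    unfolding grows_only_on_def
  proof (intro conjI ballI allI impI)
    fix s t assume st: "0 \<le> s" "s \<le> t" "t \<le> T" and e: "{s<..t} \<inter> {s \<in> {0..T}. k s = 0} = {}"
    have "emeasure ?M {s<..t} = 0" using st by (intro null e) auto
    moreover have "a s \<le> a t" using st by (intro mono_onD[OF mono]) auto
    ultimately show "a t = a s" using Ioc[OF st(2)] st by (simp add: min_def)
  next
    fix t assume t: "t \<in> {0..T}" and e: "{0..t} \<inter> {s \<in> {0..T}. k s = 0} = {}"
    have 1: "emeasure ?M {0..t} = 0" using t by (intro null e) auto
    have 2: "emeasure ?M {-1<..<0} = 0"
    proof -
      have "emeasure ?M (\<Union>n. {-1<..- (1 / real (Suc n))}) = 0"
      proof (rule emeasure_UN_eq_0)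
        fix n
        have "- 1 \<le> - (1 / real (Suc n))" by simp
        then show "emeasure ?M {-1<..- (1 / real (Suc n))} = 0" by (subst Ioc) auto
      qed (auto simp: sets)
      moreover have "(\<Union>n. {-1<..- (1 / real (Suc n))}) \<in> sets ?M" unfolding sets by (rule sets.countable_UN') auto
      moreover have "{-1<..<0} \<subseteq> (\<Union>n. {-1<..- (1 / real (Suc n))})"
      proof
        fix x :: real assume x: "x \<in> {-1<..<0}"
        then obtain n where "inverse (real (Suc n)) < - x" using reals_Archimedean[of "- x"] by auto
        then show "x \<in> (\<Union>n. {-1<..- (1 / real (Suc n))})" using x by (auto simp: inverse_eq_divide intro!: exI[of _ n])
      qed
      ultimately show ?thesis using emeasure_eq_0 by blast
    qed
    have "emeasure ?M {-1<..t} \<le> emeasure ?M ({-1<..<0} \<union> {0..t})"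
      by (rule emeasure_mono) (auto simp: sets)
    also have "\<dots> \<le> emeasure ?M {-1<..<0} + emeasure ?M {0..t}"
      by (rule emeasure_subadditive) (auto simp: sets)
    finally have "emeasure ?M {-1<..t} = 0" using 1 2 by simp
    moreover have "emeasure ?M {-1<..t} = ennreal (a t)" using t by (subst Ioc) (auto simp: min_def)
    ultimately show "a t = 0" using nn[OF t] by simp
  qed
qed

lemma drift_lower_bound:
  fixes w :: "real \<Rightarrow> real"
  assumes w: "set_integrable lebesgue {0..T} w" and st: "0 \<le> s" "s \<le> t" "t \<le> T"
    and low: "\<And>u. u \<in> {s..t} \<Longrightarrow> - m \<le> w u"
  shows "(LINT u:{0..s}|lebesgue. w u) - (LINT u:{0..t}|lebesgue. w u) \<le> m * (t - s)"
proof -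
  have ws: "set_integrable lebesgue {0..s} w" "set_integrable lebesgue {s<..t} w"
    using st by (auto intro: set_integrable_subset[OF w])
  have "{0..t} = {0..s} \<union> {s<..t}" using st by auto
  then have "(LINT u:{0..t}|lebesgue. w u) = (LINT u:{0..s}|lebesgue. w u) + (LINT u:{s<..t}|lebesgue. w u)"
    using ws by (simp only:) (rule set_integral_Un, auto)
  moreover have "(LINT u:{s<..t}|lebesgue. - m) \<le> (LINT u:{s<..t}|lebesgue. w u)"
  proof (rule set_integral_mono)
    show "set_integrable lebesgue {s<..t} (\<lambda>u. - m)"
      by (rule set_integrable_subset[OF bounded_set_integrable[of "\<lambda>_. - m" "\<bar>m\<bar>" T]]) (use st in auto)
  qed (use ws low in auto)
  moreover have "(LINT u:{s<..t}|lebesgue. - m) = - m * (t - s)"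
    using st by (simp add: set_lebesgue_integral_def measure_completion)
  ultimately show ?thesis by simp
qed

lemma constraint_zero_iff:
  assumes "strict_mono (k::real \<Rightarrow> real)" "0 \<in> range k"
  shows "k y = 0 \<longleftrightarrow> y = inv k 0" "k y \<le> 0 \<longleftrightarrow> y \<le> inv k 0" "0 \<le> k y \<longleftrightarrow> inv k 0 \<le> y"
proof -
  have z: "k (inv k 0) = 0" using assms(2) by (rule f_inv_into_f)
  show "k y = 0 \<longleftrightarrow> y = inv k 0" using strict_mono_eq[OF assms(1), of y "inv k 0"] z by simp
  show "k y \<le> 0 \<longleftrightarrow> y \<le> inv k 0" using strict_mono_less_eq[OF assms(1), of y "inv k 0"] z by simp
  show "0 \<le> k y \<longleftrightarrow> inv k 0 \<le> y" using strict_mono_less_eq[OF assms(1), of "inv k 0" y] z by simp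
qed

text \<open>
  The two equations along one path, where \<open>q\<close> is the density of the quadratic variation and \<open>d\<close> the
  difference of the initial values. The drift \<open>w\<close> of \<open>X2 - X1\<close> is nonnegative where \<open>X1 \<le> X2\<close>, by the order
  and the monotonicity of the coefficients, and at least \<open>- L (1 + K) (X1 - X2)\<close> elsewhere.
\<close>
lemma comparison_along_path:
  fixes X1 X2 Al1 Al2 Ar1 Ar2 q :: "real \<Rightarrow> real" and f1 f2 h1 h2 l r :: "real \<Rightarrow> real \<Rightarrow> real"
  assumes T: "T > 0"
    and cont: "continuous_on {0..T} X1" "continuous_on {0..T} X2"
      "continuous_on {0..T} (\<lambda>t. inv (r t) 0)" "continuous_on {0..T} (\<lambda>t. inv (l t) 0)"
      "continuous_on {0..T} Al1" "continuous_on {0..T} Al2"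
      "continuous_on {0..T} Ar1" "continuous_on {0..T} Ar2"
    and mono: "mono_on {0..T} Al1" "mono_on {0..T} Al2" "mono_on {0..T} Ar1" "mono_on {0..T} Ar2"
    and nn: "0 \<le> Al1 0" "0 \<le> Al2 0" "0 \<le> Ar1 0" "0 \<le> Ar2 0"
    and lr: "\<And>t. t \<in> {0..T} \<Longrightarrow> strict_mono (r t) \<and> strict_mono (l t)"
      "\<And>t. t \<in> {0..T} \<Longrightarrow> 0 \<in> range (r t) \<and> 0 \<in> range (l t)"
      "\<And>t. t \<in> {0..T} \<Longrightarrow> inv (r t) 0 < inv (l t) 0"
    and constraint1: "\<And>t. t \<in> {0..T} \<Longrightarrow> l t (X1 t) \<le> 0 \<and> 0 \<le> r t (X1 t)"
    and constraint2: "\<And>t. t \<in> {0..T} \<Longrightarrow> l t (X2 t) \<le> 0 \<and> 0 \<le> r t (X2 t)"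
    and flat_l1: "has_bochner_integral (stieltjes_measure T Al1) (\<lambda>s. indicator {0..T} s * l s (X1 s)) 0"
    and flat_l2: "has_bochner_integral (stieltjes_measure T Al2) (\<lambda>s. indicator {0..T} s * l s (X2 s)) 0"
    and flat_r1: "has_bochner_integral (stieltjes_measure T Ar1) (\<lambda>s. indicator {0..T} s * r s (X1 s)) 0"
    and flat_r2: "has_bochner_integral (stieltjes_measure T Ar2) (\<lambda>s. indicator {0..T} s * r s (X2 s)) 0"
    and d: "0 \<le> d" and q: "\<And>s. 0 \<le> q s \<and> q s \<le> K"
    and int: "set_integrable lebesgue {0..T} (\<lambda>s. (f2 s (X2 s) - f1 s (X1 s)) + (h2 s (X2 s) - h1 s (X1 s)) * q s)"
    and le: "\<And>s y. s \<in> {0..T} \<Longrightarrow> f1 s y \<le> f2 s y \<and> h1 s y \<le> h2 s y"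
    and mon: "\<And>s. s \<in> {0..T} \<Longrightarrow> (mono (f1 s) \<and> mono (h1 s)) \<or> (mono (f2 s) \<and> mono (h2 s))"
    and Lip: "0 \<le> L" "\<And>s y y'. s \<in> {0..T} \<Longrightarrow> \<bar>f1 s y - f1 s y'\<bar> \<le> L * \<bar>y - y'\<bar> \<and> \<bar>h1 s y - h1 s y'\<bar> \<le> L * \<bar>y - y'\<bar>"
    and diff: "\<And>t. t \<in> {0..T} \<Longrightarrow> X2 t - X1 t =
        d + (LINT s:{0..t}|lebesgue. (f2 s (X2 s) - f1 s (X1 s)) + (h2 s (X2 s) - h1 s (X1 s)) * q s)
        - (Ar1 t - Ar2 t) - (Al2 t - Al1 t)"
    and t: "t \<in> {0..T}"
  shows "Al1 t \<le> Al2 t \<and>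
    Al2 t \<le> Al1 t + (d + (LINT s:{0..t}|lebesgue. (f2 s (X2 s) - f1 s (X1 s)) + (h2 s (X2 s) - h1 s (X1 s)) * q s)) \<and>
    Ar2 t \<le> Ar1 t \<and>
    Ar1 t \<le> Ar2 t + (d + (LINT s:{0..t}|lebesgue. (f2 s (X2 s) - f1 s (X1 s)) + (h2 s (X2 s) - h1 s (X1 s)) * q s))"
proof -
  define w where "w s = (f2 s (X2 s) - f1 s (X1 s)) + (h2 s (X2 s) - h1 s (X1 s)) * q s" for s
  define Z where "Z t = d + (LINT s:{0..t}|lebesgue. w s)" for t
  have wi: "set_integrable lebesgue {0..T} w" unfolding w_def[abs_def] by (rule int)
  note ziff = constraint_zero_iff[OF conjunct1[OF lr(1)] conjunct1[OF lr(2)]]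
    constraint_zero_iff[OF conjunct2[OF lr(1)] conjunct2[OF lr(2)]]
  have range: "inv (r t) 0 \<le> X1 t \<and> X1 t \<le> inv (l t) 0" "inv (r t) 0 \<le> X2 t \<and> X2 t \<le> inv (l t) 0"
    if "t \<in> {0..T}" for t
    using constraint1[OF that] constraint2[OF that] ziff[OF that that] by auto
  have gl: "grows_only_on T a {t \<in> {0..T}. X t = inv (l t) 0}"
    if "continuous_on {0..T} a" "mono_on {0..T} a" "0 \<le> a 0"
      "has_bochner_integral (stieltjes_measure T a) (\<lambda>s. indicator {0..T} s * l s (X s)) 0"
      "\<And>t. t \<in> {0..T} \<Longrightarrow> l t (X t) \<le> 0" for a X
  proof -
    have "has_bochner_integral (stieltjes_measure T a) (\<lambda>s. indicator {0..T} s * - l s (X s)) 0"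
      using has_bochner_integral_minus[OF that(4)] by simp
    then have "grows_only_on T a {t \<in> {0..T}. - l t (X t) = 0}"
      using that by (intro grows_only_on_zero_set T) auto
    moreover have "{t \<in> {0..T}. - l t (X t) = 0} = {t \<in> {0..T}. X t = inv (l t) 0}"
      using ziff(4) by auto
    ultimately show ?thesis by simp
  qed
  have gr: "grows_only_on T a {t \<in> {0..T}. X t = inv (r t) 0}"
    if "continuous_on {0..T} a" "mono_on {0..T} a" "0 \<le> a 0"
      "has_bochner_integral (stieltjes_measure T a) (\<lambda>s. indicator {0..T} s * r s (X s)) 0"
      "\<And>t. t \<in> {0..T} \<Longrightarrow> 0 \<le> r t (X t)" for a X
  proof -
    have "grows_only_on T a {t \<in> {0..T}. r t (X t) = 0}" by (rule grows_only_on_zero_set[OF that(1-3) T that(4,5)])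
    moreover have "{t \<in> {0..T}. r t (X t) = 0} = {t \<in> {0..T}. X t = inv (r t) 0}"
      using ziff(1) by auto
    ultimately show ?thesis by simp
  qed
  define C where "C = L * (1 + K)"
  have K: "0 \<le> K" using q[of 0] by linarith
  have C: "0 \<le> C" unfolding C_def using Lip(1) K by simp
  have wlow: "- (C * M) \<le> w s" if s: "s \<in> {0..T}" and M: "0 \<le> M" "X1 s - X2 s \<le> M" for s M
  proof (cases "X1 s \<le> X2 s")
    case True
    have "f1 s (X1 s) \<le> f2 s (X2 s) \<and> h1 s (X1 s) \<le> h2 s (X2 s)"
      using mon[OF s] le[OF s, of "X1 s"] le[OF s, of "X2 s"] True by (meson monoD order_trans)
    then have "0 \<le> w s" unfolding w_def using q[of s] by (intro add_nonneg_nonneg mult_nonneg_nonneg) auto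
    then show ?thesis using mult_nonneg_nonneg[OF C M(1)] by linarith
  next
    case False
    have LM: "L * \<bar>X2 s - X1 s\<bar> \<le> L * M" using False M Lip(1) by (intro mult_left_mono) auto
    have fl: "- (L * M) \<le> f2 s (X2 s) - f1 s (X1 s)" and hl: "- (L * M) \<le> h2 s (X2 s) - h1 s (X1 s)"
      using le[OF s, of "X2 s"] Lip(2)[OF s, of "X2 s" "X1 s"] LM by linarith+
    have "- (L * M) * q s \<le> (h2 s (X2 s) - h1 s (X1 s)) * q s" using hl q[of s] by (intro mult_right_mono) auto
    moreover have "L * M * q s \<le> L * M * K" using q[of s] Lip(1) M(1) by (intro mult_left_mono) auto
    moreover have "C * M = L * M + L * M * K" by (simp add: C_def algebra_simps)
    ultimately show ?thesis unfolding w_def using fl by simp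
  qed
  have drift: "Z s - Z t \<le> C * M * (t - s)"
    if "0 \<le> s" "s \<le> t" "t \<le> T" "0 \<le> M" "\<And>u. u \<in> {s..t} \<Longrightarrow> X1 u - X2 u \<le> M" for s t M
  proof -
    have "(LINT u:{0..s}|lebesgue. w u) - (LINT u:{0..t}|lebesgue. w u) \<le> C * M * (t - s)"
      by (rule drift_lower_bound[OF wi that(1-3)]) (use wlow that in auto)
    then show ?thesis by (simp add: Z_def)
  qed
  have Z0: "0 \<le> Z 0"
  proof -
    have "(LINT s:{0..0}|lebesgue. w s) = 0"
      unfolding set_lebesgue_integral_def
      by (rule integral_eq_zero_AE, rule AE_completion)
         (use AE_lborel_singleton[of "0::real"] in eventually_elim, auto simp: indicator_def)
    then show ?thesis using d by (simp add: Z_def)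
  qed
  have "Al1 t \<le> Al2 t \<and> Al2 t \<le> Al1 t + Z t \<and> Ar2 t \<le> Ar1 t \<and> Ar1 t \<le> Ar2 t + Z t"
  proof (rule two_sided_Skorokhod_comparison[OF cont mono nn Z0 lr(3) range(1) range(2) _ _ _ _ _ C drift t])
    show "grows_only_on T Al1 {t \<in> {0..T}. X1 t = inv (l t) 0}"
      using gl[OF cont(5) mono(1) nn(1) flat_l1] constraint1 by blast
    show "grows_only_on T Al2 {t \<in> {0..T}. X2 t = inv (l t) 0}"
      using gl[OF cont(6) mono(2) nn(2) flat_l2] constraint2 by blast
    show "grows_only_on T Ar1 {t \<in> {0..T}. X1 t = inv (r t) 0}"
      using gr[OF cont(7) mono(3) nn(3) flat_r1] constraint1 by blast
    show "grows_only_on T Ar2 {t \<in> {0..T}. X2 t = inv (r t) 0}"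
      using gr[OF cont(8) mono(4) nn(4) flat_r2] constraint2 by blast
    show "X2 t - X1 t = Z t - (Ar1 t - Ar2 t) - (Al2 t - Al1 t)" if "t \<in> {0..T}" for t
      using diff[OF that] unfolding Z_def w_def .
  qed
  then show ?thesis unfolding Z_def w_def .
qed

theorem proposition4p9:
  fixes T slow shigh p c :: real
    and E :: "rvar \<Rightarrow> real" and PP :: "path measure set" and Q :: process
    and x :: "nat \<Rightarrow> real" and f h :: "nat \<Rightarrow> field" and g l r :: field
    and la ra :: "nat \<Rightarrow> nat \<Rightarrow> field"
    and X A Al Ar :: "nat \<Rightarrow> process"
  assumes T: "T > 0" and sigma: "slow\<^sup>2 < shigh\<^sup>2"
    and E: "G_expectation T slow shigh E" and PP: "represents T PP E"
    and Q: "quadratic_variation T PP Q"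
    and p: "p \<ge> 2"
    and pair: "admissible_pair T PP p l r"
    and coeff: "\<And>i. i \<in> {1, 2} \<Longrightarrow> admissible_coefficients T PP p (f i) (h i) g"
    and H1: "x 1 \<le> x 2"
    and H2: "\<And>y. quasi_surely T PP (\<lambda>\<omega>. \<forall>t\<in>{0..T}. f 1 t \<omega> y \<le> f 2 t \<omega> y \<and> h 1 t \<omega> y \<le> h 2 t \<omega> y)"
    and H3: "c > 0" "lower_Lipschitz_pair T PP c l r"
    and H4_pair: "\<And>i n. i \<in> {1, 2} \<Longrightarrow> admissible_pair T PP p (la i n) (ra i n)"
    and H4_lower: "\<And>i n. i \<in> {1, 2} \<Longrightarrow> lower_Lipschitz_pair T PP c (la i n) (ra i n)"
    and H4_bounded: "\<And>i n. i \<in> {1, 2} \<Longrightarrow>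
          bounded_process T PP (inv0 (la i n)) \<and> bounded_process T PP (inv0 (ra i n))"
    and H4_order: "quasi_surely T PP (\<lambda>\<omega>. \<forall>n. \<forall>t\<in>{0..T}. \<forall>y.
          la 2 n t \<omega> y \<le> la 1 n t \<omega> y \<and> ra 2 n t \<omega> y \<le> ra 1 n t \<omega> y)"
    and H4_limit_l: "\<And>i. i \<in> {1, 2} \<Longrightarrow>
          (\<lambda>n. upper_expectation T PP (\<lambda>\<omega>. SUP t\<in>{0..T}.
             ennreal (\<bar>inv0 l t \<omega> - inv0 (la i n) t \<omega>\<bar> powr p))) \<longlonglongrightarrow> 0"
    and H4_limit_r: "\<And>i. i \<in> {1, 2} \<Longrightarrow>
          (\<lambda>n. upper_expectation T PP (\<lambda>\<omega>. SUP t\<in>{0..T}.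
             ennreal (\<bar>inv0 r t \<omega> - inv0 (ra i n) t \<omega>\<bar> powr p))) \<longlonglongrightarrow> 0"
    and H5_g: "quasi_surely T PP (\<lambda>\<omega>. \<forall>t\<in>{0..T}. \<forall>y y'. g t \<omega> y = g t \<omega> y')"
    and H5_mono: "quasi_surely T PP (\<lambda>\<omega>. \<forall>t\<in>{0..T}.
          (mono (f 1 t \<omega>) \<and> mono (h 1 t \<omega>)) \<or> (mono (f 2 t \<omega>) \<and> mono (h 2 t \<omega>)))"
    and sol: "\<And>i. i \<in> {1, 2} \<Longrightarrow> solution T PP p Q (x i) (f i) (h i) g l r (X i) (A i)"
    and constr: "\<And>i. i \<in> {1, 2} \<Longrightarrow> constraining_processes T PP p l r (X i) (A i) (Al i) (Ar i)"
  shows "quasi_surely T PP (\<lambda>\<omega>. \<forall>t\<in>{0..T}.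
      (Al 1 t \<omega> \<le> Al 2 t \<omega> \<and>
       Al 2 t \<omega> \<le> Al 1 t \<omega> + X_hat T PP p Q f h X t \<omega> + (x 2 - x 1)) \<and>
      (Ar 2 t \<omega> \<le> Ar 1 t \<omega> \<and>
       Ar 1 t \<omega> \<le> Ar 2 t \<omega> + X_hat T PP p Q f h X t \<omega> + (x 2 - x 1)))"
proof -
  have fam: "path_probabilities T PP"
  proof (rule path_probabilities.intro)
    have "PP \<subseteq> topspace (weak_topology T)"
      using PP compactin_subset_topspace unfolding represents_def by blast
    then have PPD: "prob_space P \<and> sets P = sets (path_space T)" if "P \<in> PP" for P
      using that unfolding weak_topology_def topology_generated_by_topspace by blast
    show "prob_space P" if "P \<in> PP" for P using PPD[OF that] ..
    show "sets P = sets (path_space T)" if "P \<in> PP" for P using PPD[OF that] ..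
  qed (use T PP in \<open>auto simp: represents_def\<close>)
  interpret G_setting T PP slow shigh E
    by (intro G_setting.intro fam G_setting_axioms.intro) (use sigma E PP in \<open>auto simp: represents_def\<close>)
  have p1: "p \<ge> 1" and p0: "p > 0" using p by auto
  have i12: "(1::nat) \<in> {1, 2}" "(2::nat) \<in> {1, 2}" by auto
  obtain qd K where K: "K > 0" and qd: "qs (\<lambda>\<omega>. is_density T K (\<lambda>t. Q t \<omega>) (qd \<omega>))"
    using quadratic_variation_density[OF Q] by blast

  have solD: "X i \<in> S_G T PP p" "compose (f i) (X i) \<in> M_G T PP p" "compose (h i) (X i) \<in> M_G T PP p"
      "qs (\<lambda>\<omega>. \<forall>t\<in>{0..T}. X i t \<omega> = x i + dt_integral (compose (f i) (X i)) t \<omega>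
         + dQ_integral T PP p Q (compose (h i) (X i)) t \<omega> + dB_integral T PP p (compose g (X i)) t \<omega> + A i t \<omega>)"
      "qs (\<lambda>\<omega>. \<forall>t\<in>{0..T}. l t \<omega> (X i t \<omega>) \<le> 0 \<and> 0 \<le> r t \<omega> (X i t \<omega>))" if "i \<in> {1, 2}" for i
    using sol[OF that] unfolding solution_def by blast+
  have conD: "qs (\<lambda>\<omega>. continuous_on {0..T} (\<lambda>t. Al i t \<omega>) \<and> mono_on {0..T} (\<lambda>t. Al i t \<omega>))"
      "qs (\<lambda>\<omega>. continuous_on {0..T} (\<lambda>t. Ar i t \<omega>) \<and> mono_on {0..T} (\<lambda>t. Ar i t \<omega>))"
      "qs (\<lambda>\<omega>. 0 \<le> Al i 0 \<omega> \<and> 0 \<le> Ar i 0 \<omega> \<and> (\<forall>t\<in>{0..T}. A i t \<omega> = Ar i t \<omega> - Al i t \<omega>))"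
      "qs (\<lambda>\<omega>. has_bochner_integral (stieltjes_measure T (\<lambda>s. Al i s \<omega>))
           (\<lambda>s. indicator {0..T} s * l s \<omega> (X i s \<omega>)) 0 \<and>
         has_bochner_integral (stieltjes_measure T (\<lambda>s. Ar i s \<omega>))
           (\<lambda>s. indicator {0..T} s * r s \<omega> (X i s \<omega>)) 0)" if "i \<in> {1, 2}" for i
    using constr[OF that] unfolding constraining_processes_def M_I_def by blast+

  define path_facts where "path_facts i \<omega> \<longleftrightarrow>
      continuous_on {0..T} (\<lambda>t. X i t \<omega>) \<and>
      set_integrable lebesgue {0..T} (\<lambda>t. compose (f i) (X i) t \<omega>) \<and>
      set_integrable lebesgue {0..T} (\<lambda>t. compose (h i) (X i) t \<omega>) \<and>
      (\<forall>t\<in>{0..T}. dQ_integral T PP p Q (compose (h i) (X i)) t \<omega>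
         = (LINT s:{0..t}|lebesgue. compose (h i) (X i) s \<omega> * qd \<omega> s)) \<and>
      (\<forall>t\<in>{0..T}. X i t \<omega> = x i + dt_integral (compose (f i) (X i)) t \<omega>
         + dQ_integral T PP p Q (compose (h i) (X i)) t \<omega> + dB_integral T PP p (compose g (X i)) t \<omega> + A i t \<omega>) \<and>
      (\<forall>t\<in>{0..T}. l t \<omega> (X i t \<omega>) \<le> 0 \<and> 0 \<le> r t \<omega> (X i t \<omega>)) \<and>
      (continuous_on {0..T} (\<lambda>t. Al i t \<omega>) \<and> mono_on {0..T} (\<lambda>t. Al i t \<omega>)) \<and>
      (continuous_on {0..T} (\<lambda>t. Ar i t \<omega>) \<and> mono_on {0..T} (\<lambda>t. Ar i t \<omega>)) \<and>
      (0 \<le> Al i 0 \<omega> \<and> 0 \<le> Ar i 0 \<omega> \<and> (\<forall>t\<in>{0..T}. A i t \<omega> = Ar i t \<omega> - Al i t \<omega>)) \<and>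
      (has_bochner_integral (stieltjes_measure T (\<lambda>s. Al i s \<omega>))
           (\<lambda>s. indicator {0..T} s * l s \<omega> (X i s \<omega>)) 0 \<and>
         has_bochner_integral (stieltjes_measure T (\<lambda>s. Ar i s \<omega>))
           (\<lambda>s. indicator {0..T} s * r s \<omega> (X i s \<omega>)) 0)" for i \<omega>
  have pathD: "continuous_on {0..T} (\<lambda>t. X i t \<omega>)"
      "set_integrable lebesgue {0..T} (\<lambda>t. f i t \<omega> (X i t \<omega>))"
      "set_integrable lebesgue {0..T} (\<lambda>t. h i t \<omega> (X i t \<omega>))"
      "\<And>t. t \<in> {0..T} \<Longrightarrow> X i t \<omega> = x i + (LINT s:{0..t}|lebesgue. f i s \<omega> (X i s \<omega>))
         + (LINT s:{0..t}|lebesgue. h i s \<omega> (X i s \<omega>) * qd \<omega> s)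
         + dB_integral T PP p (compose g (X i)) t \<omega> + (Ar i t \<omega> - Al i t \<omega>)"
      "\<And>t. t \<in> {0..T} \<Longrightarrow> l t \<omega> (X i t \<omega>) \<le> 0 \<and> 0 \<le> r t \<omega> (X i t \<omega>)"
      "continuous_on {0..T} (\<lambda>t. Al i t \<omega>)" "mono_on {0..T} (\<lambda>t. Al i t \<omega>)"
      "continuous_on {0..T} (\<lambda>t. Ar i t \<omega>)" "mono_on {0..T} (\<lambda>t. Ar i t \<omega>)"
      "0 \<le> Al i 0 \<omega>" "0 \<le> Ar i 0 \<omega>"
      "has_bochner_integral (stieltjes_measure T (\<lambda>s. Al i s \<omega>)) (\<lambda>s. indicator {0..T} s * l s \<omega> (X i s \<omega>)) 0"
      "has_bochner_integral (stieltjes_measure T (\<lambda>s. Ar i s \<omega>)) (\<lambda>s. indicator {0..T} s * r s \<omega> (X i s \<omega>)) 0"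
    if F: "path_facts i \<omega>" for i \<omega>
    using F[unfolded path_facts_def dt_integral_def compose_def[of "f i"] compose_def[of "h i"]]
    by (elim conjE; simp)+
  have pf: "qs (path_facts i)" if i: "i \<in> {1, 2}" for i
    unfolding path_facts_def[abs_def]
    by (intro qs_conj S_G_continuous[OF solD(1)[OF i] p0] M_G_integrable[OF solD(2)[OF i] p1]
        M_G_integrable[OF solD(3)[OF i] p1] dQ_integral_pathwise[OF solD(3)[OF i] p1 K qd]
        solD(4)[OF i] solD(5)[OF i] conD(1)[OF i] conD(2)[OF i] conD(3)[OF i] conD(4)[OF i])

  \<comment> \<open>The state-independence of \<open>g\<close> makes the two stochastic integrals equal, not just quasi-surely.\<close>
  have dB: "dB_integral T PP p (compose g (X 1)) = dB_integral T PP p (compose g (X 2))"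
    by (rule dB_integral_cong, rule qs_mono[OF H5_g]) (simp add: compose_def)
  let ?\<eta> = "\<lambda>s \<omega>. h 2 s \<omega> (X 2 s \<omega>) - h 1 s \<omega> (X 1 s \<omega>)"
  have "?\<eta> \<in> M_G T PP p"
    using M_G_diff[OF solD(3)[OF i12(2)] solD(3)[OF i12(1)]] p0 by (simp add: compose_def)
  then have dQ: "qs (\<lambda>\<omega>. \<forall>t\<in>{0..T}. dQ_integral T PP p Q ?\<eta> t \<omega> = (LINT s:{0..t}|lebesgue. ?\<eta> s \<omega> * qd \<omega> s))"
    by (rule dQ_integral_pathwise[OF _ p1 K qd])

  have pairD: "qs (\<lambda>\<omega>. \<forall>t\<in>{0..T}. strict_mono (r t \<omega>) \<and> strict_mono (l t \<omega>) \<and> (\<forall>x. r t \<omega> x > l t \<omega> x))"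
    "qs (\<lambda>\<omega>. \<forall>t\<in>{0..T}. 0 \<in> range (r t \<omega>) \<and> 0 \<in> range (l t \<omega>))"
    "inv0 r \<in> S_G T PP p" "inv0 l \<in> S_G T PP p"
    "\<exists>\<delta>>0. qs (\<lambda>\<omega>. \<forall>t\<in>{0..T}. inv0 l t \<omega> - inv0 r t \<omega> \<ge> \<delta>)"
    using pair unfolding admissible_pair_def by blast+
  obtain \<delta> where \<delta>: "\<delta> > 0" "qs (\<lambda>\<omega>. \<forall>t\<in>{0..T}. inv0 l t \<omega> - inv0 r t \<omega> \<ge> \<delta>)" using pairD(5) by blast

  have Lip: "\<exists>L>0. \<forall>t\<in>{0..T}. \<forall>\<omega>\<in>Omega T. \<forall>y y'.
        \<bar>f i t \<omega> y - f i t \<omega> y'\<bar> \<le> L * \<bar>y - y'\<bar> \<and> \<bar>h i t \<omega> y - h i t \<omega> y'\<bar> \<le> L * \<bar>y - y'\<bar>" if i: "i \<in> {1, 2}" for i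
  proof -
    obtain L where L: "L > 0" "\<forall>t\<in>{0..T}. \<forall>\<omega>\<in>Omega T. \<forall>x x'.
        \<bar>f i t \<omega> x - f i t \<omega> x'\<bar> + \<bar>g t \<omega> x - g t \<omega> x'\<bar> + \<bar>h i t \<omega> x - h i t \<omega> x'\<bar> \<le> L * \<bar>x - x'\<bar>"
      using coeff[OF i] unfolding admissible_coefficients_def by blast
    have "\<bar>f i t \<omega> y - f i t \<omega> y'\<bar> \<le> L * \<bar>y - y'\<bar> \<and> \<bar>h i t \<omega> y - h i t \<omega> y'\<bar> \<le> L * \<bar>y - y'\<bar>"
      if "t \<in> {0..T}" "\<omega> \<in> Omega T" for t \<omega> y y'
    proof -
      have "\<bar>f i t \<omega> y - f i t \<omega> y'\<bar> + \<bar>g t \<omega> y - g t \<omega> y'\<bar> + \<bar>h i t \<omega> y - h i t \<omega> y'\<bar> \<le> L * \<bar>y - y'\<bar>"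
        using L(2) that by blast
      then show ?thesis by linarith
    qed
    then show ?thesis using L(1) by blast
  qed
  obtain L1 where L1: "L1 > 0" "\<And>t \<omega> y y'. t \<in> {0..T} \<Longrightarrow> \<omega> \<in> Omega T \<Longrightarrow>
     \<bar>f 1 t \<omega> y - f 1 t \<omega> y'\<bar> \<le> L1 * \<bar>y - y'\<bar> \<and> \<bar>h 1 t \<omega> y - h 1 t \<omega> y'\<bar> \<le> L1 * \<bar>y - y'\<bar>"
    using Lip[OF i12(1)] by blast
  obtain L2 where L2: "L2 > 0" "\<And>t \<omega> y y'. t \<in> {0..T} \<Longrightarrow> \<omega> \<in> Omega T \<Longrightarrow>
     \<bar>f 2 t \<omega> y - f 2 t \<omega> y'\<bar> \<le> L2 * \<bar>y - y'\<bar> \<and> \<bar>h 2 t \<omega> y - h 2 t \<omega> y'\<bar> \<le> L2 * \<bar>y - y'\<bar>"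
    using Lip[OF i12(2)] by blast

  \<comment> \<open>The exceptional set depends on the state, so the order is first obtained at all rational states at once.\<close>
  have order: "qs (\<lambda>\<omega>. \<forall>t\<in>{0..T}. \<forall>y. f 1 t \<omega> y \<le> f 2 t \<omega> y \<and> h 1 t \<omega> y \<le> h 2 t \<omega> y)"
  proof -
    have "qs (\<lambda>\<omega>. \<forall>n. \<forall>t\<in>{0..T}. f 1 t \<omega> (of_rat (from_nat n)) \<le> f 2 t \<omega> (of_rat (from_nat n)) \<and>
        h 1 t \<omega> (of_rat (from_nat n)) \<le> h 2 t \<omega> (of_rat (from_nat n)))"
      by (rule qs_countable) (rule H2)
    then show ?thesis
    proof (rule qs_mono, intro ballI allI)
      fix \<omega> t y
      assume \<omega>: "\<omega> \<in> Omega T" and rat: "\<forall>n. \<forall>t\<in>{0..T}. f 1 t \<omega> (of_rat (from_nat n)) \<le> f 2 t \<omega> (of_rat (from_nat n)) \<and>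
        h 1 t \<omega> (of_rat (from_nat n)) \<le> h 2 t \<omega> (of_rat (from_nat n))" and t: "t \<in> {0..T}"
      have ratq: "f 1 t \<omega> (of_rat a) \<le> f 2 t \<omega> (of_rat a) \<and> h 1 t \<omega> (of_rat a) \<le> h 2 t \<omega> (of_rat a)" for a :: rat
        using rat t by (metis from_nat_to_nat)
      have approx: "k1 y \<le> k2 y" if 1: "\<And>y y'. \<bar>k1 y - k1 y'\<bar> \<le> L1 * \<bar>y - y'\<bar>"
        and 2: "\<And>y y'. \<bar>k2 y - k2 y'\<bar> \<le> L2 * \<bar>y - y'\<bar>" and 3: "\<And>a::rat. k1 (of_rat a) \<le> k2 (of_rat a)"
        for k1 k2 :: "real \<Rightarrow> real"
      proof (rule field_le_epsilon)
        fix e :: real assume e: "e > 0"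
        define b where "b = e / (L1 + L2)"
        have b: "b > 0" using e L1(1) L2(1) by (simp add: b_def)
        obtain a :: rat where a: "y < of_rat a" "of_rat a < y + b" using of_rat_dense[of y "y + b"] b by auto
        have "L1 * \<bar>y - of_rat a\<bar> + L2 * \<bar>y - of_rat a\<bar> = (L1 + L2) * \<bar>y - of_rat a\<bar>"
          by (simp add: distrib_right)
        also have "\<dots> \<le> (L1 + L2) * b" using a L1(1) L2(1) by (intro mult_left_mono) auto
        also have "\<dots> = e" using L1(1) L2(1) by (simp add: b_def)
        finally show "k1 y \<le> k2 y + e" using 1[of y "of_rat a"] 2[of y "of_rat a"] 3[of a] by linarith
      qed
      show "f 1 t \<omega> y \<le> f 2 t \<omega> y \<and> h 1 t \<omega> y \<le> h 2 t \<omega> y"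
        using L1(2)[OF t \<omega>] L2(2)[OF t \<omega>] ratq by (intro conjI approx[of "f 1 t \<omega>" "f 2 t \<omega>"] approx[of "h 1 t \<omega>" "h 2 t \<omega>"]) simp_all
    qed
  qed

  note all = qs_conj[OF qs_conj[OF qs_conj[OF pf[OF i12(1)] pf[OF i12(2)]] qs_conj[OF dQ qd]]
    qs_conj[OF qs_conj[OF qs_conj[OF pairD(1) pairD(2)] qs_conj[OF S_G_continuous[OF pairD(3) p0] S_G_continuous[OF pairD(4) p0]]]
      qs_conj[OF \<delta>(2) qs_conj[OF order H5_mono]]]]
  show ?thesis
  proof (rule qs_mono[OF all], elim conjE, intro ballI)
    fix \<omega> t
    assume \<omega>: "\<omega> \<in> Omega T" and F1: "path_facts 1 \<omega>" and F2: "path_facts 2 \<omega>"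
      and dQ\<omega>: "\<forall>t\<in>{0..T}. dQ_integral T PP p Q ?\<eta> t \<omega> = (LINT s:{0..t}|lebesgue. ?\<eta> s \<omega> * qd \<omega> s)"
      and dens: "is_density T K (\<lambda>t. Q t \<omega>) (qd \<omega>)"
      and sm: "\<forall>t\<in>{0..T}. strict_mono (r t \<omega>) \<and> strict_mono (l t \<omega>) \<and> (\<forall>x. r t \<omega> x > l t \<omega> x)"
      and zero: "\<forall>t\<in>{0..T}. 0 \<in> range (r t \<omega>) \<and> 0 \<in> range (l t \<omega>)"
      and cr: "continuous_on {0..T} (\<lambda>t. inv0 r t \<omega>)" and cl: "continuous_on {0..T} (\<lambda>t. inv0 l t \<omega>)"
      and gap: "\<forall>t\<in>{0..T}. inv0 l t \<omega> - inv0 r t \<omega> \<ge> \<delta>"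
      and ord: "\<forall>t\<in>{0..T}. \<forall>y. f 1 t \<omega> y \<le> f 2 t \<omega> y \<and> h 1 t \<omega> y \<le> h 2 t \<omega> y"
      and mon: "\<forall>t\<in>{0..T}. (mono (f 1 t \<omega>) \<and> mono (h 1 t \<omega>)) \<or> (mono (f 2 t \<omega>) \<and> mono (h 2 t \<omega>))"
      and t: "t \<in> {0..T}"
    note F1 = pathD[OF F1] and F2 = pathD[OF F2]
    let ?f = "\<lambda>s. f 2 s \<omega> (X 2 s \<omega>) - f 1 s \<omega> (X 1 s \<omega>)"
    let ?w = "\<lambda>s. ?f s + ?\<eta> s \<omega> * qd \<omega> s"
    have fi: "set_integrable lebesgue {0..T} (\<lambda>s. f 1 s \<omega> (X 1 s \<omega>))" "set_integrable lebesgue {0..T} (\<lambda>s. f 2 s \<omega> (X 2 s \<omega>))"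
      and hi: "set_integrable lebesgue {0..T} (\<lambda>s. h 1 s \<omega> (X 1 s \<omega>))" "set_integrable lebesgue {0..T} (\<lambda>s. h 2 s \<omega> (X 2 s \<omega>))"
      by (rule F1(2) F2(2) F1(3) F2(3))+
    have fit: "set_integrable lebesgue {0..u} (\<lambda>s. f 1 s \<omega> (X 1 s \<omega>))" "set_integrable lebesgue {0..u} (\<lambda>s. f 2 s \<omega> (X 2 s \<omega>))"
      if "u \<in> {0..T}" for u
      using that by - (rule set_integrable_subset[OF fi(1)], simp, simp, rule set_integrable_subset[OF fi(2)], simp, simp)
    note hit = integrable_times_density[OF hi(1) dens] integrable_times_density[OF hi(2) dens]
    have wint: "set_integrable lebesgue {0..u} ?w" if "u \<in> {0..T}" for u
      unfolding left_diff_distrib using that by (intro set_integral_add set_integral_diff fit hit)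
    have wsum: "(LINT s:{0..u}|lebesgue. ?w s) = (LINT s:{0..u}|lebesgue. ?f s) + (LINT s:{0..u}|lebesgue. ?\<eta> s \<omega> * qd \<omega> s)"
      if u: "u \<in> {0..T}" for u
      unfolding left_diff_distrib using u by (intro set_integral_add set_integral_diff fit hit)
    have hsum: "(LINT s:{0..u}|lebesgue. ?\<eta> s \<omega> * qd \<omega> s) =
        (LINT s:{0..u}|lebesgue. h 2 s \<omega> (X 2 s \<omega>) * qd \<omega> s) - (LINT s:{0..u}|lebesgue. h 1 s \<omega> (X 1 s \<omega>) * qd \<omega> s)"
      if u: "u \<in> {0..T}" for u
      unfolding left_diff_distrib using u by (intro set_integral_diff hit)
    have fsum: "(LINT s:{0..u}|lebesgue. ?f s) =
        (LINT s:{0..u}|lebesgue. f 2 s \<omega> (X 2 s \<omega>)) - (LINT s:{0..u}|lebesgue. f 1 s \<omega> (X 1 s \<omega>))"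
      if u: "u \<in> {0..T}" for u
      using u by (intro set_integral_diff fit)
    have diff: "X 2 u \<omega> - X 1 u \<omega> = (x 2 - x 1) + (LINT s:{0..u}|lebesgue. ?w s)
        - (Ar 1 u \<omega> - Ar 2 u \<omega>) - (Al 2 u \<omega> - Al 1 u \<omega>)" if u: "u \<in> {0..T}" for u
      using F1(4)[OF u] F2(4)[OF u] wsum[OF u] hsum[OF u] fsum[OF u] unfolding dB by linarith
    have hat: "X_hat T PP p Q f h X t \<omega> = (LINT s:{0..t}|lebesgue. ?w s)"
      using dQ\<omega> t unfolding X_hat_def dt_integral_def wsum[OF t] by simp
    have "Al 1 t \<omega> \<le> Al 2 t \<omega> \<and> Al 2 t \<omega> \<le> Al 1 t \<omega> + ((x 2 - x 1) + (LINT s:{0..t}|lebesgue. ?w s)) \<and>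
      Ar 2 t \<omega> \<le> Ar 1 t \<omega> \<and> Ar 1 t \<omega> \<le> Ar 2 t \<omega> + ((x 2 - x 1) + (LINT s:{0..t}|lebesgue. ?w s))"
    proof (rule comparison_along_path[OF T, where L = L1 and K = K and q = "qd \<omega>" and
          ?X1.0 = "\<lambda>t. X 1 t \<omega>" and ?X2.0 = "\<lambda>t. X 2 t \<omega>" and
          ?f1.0 = "\<lambda>t. f 1 t \<omega>" and ?f2.0 = "\<lambda>t. f 2 t \<omega>" and
          ?h1.0 = "\<lambda>t. h 1 t \<omega>" and ?h2.0 = "\<lambda>t. h 2 t \<omega>" and
          l = "\<lambda>t. l t \<omega>" and r = "\<lambda>t. r t \<omega>"])
      show "0 \<le> qd \<omega> s \<and> qd \<omega> s \<le> K" for s using dens unfolding is_density_def by blast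
      show "set_integrable lebesgue {0..T} ?w" using T by (intro wint) simp
      show "continuous_on {0..T} (\<lambda>t. inv (r t \<omega>) 0)" "continuous_on {0..T} (\<lambda>t. inv (l t \<omega>) 0)"
        using cr cl unfolding inv0_def .
      show "inv (r u \<omega>) 0 < inv (l u \<omega>) 0" if "u \<in> {0..T}" for u
        using bspec[OF gap that] \<delta>(1) unfolding inv0_def by linarith
      show "\<bar>f 1 s \<omega> y - f 1 s \<omega> y'\<bar> \<le> L1 * \<bar>y - y'\<bar> \<and> \<bar>h 1 s \<omega> y - h 1 s \<omega> y'\<bar> \<le> L1 * \<bar>y - y'\<bar>"
        if "s \<in> {0..T}" for s y y' using L1(2)[OF that \<omega>] .
      show "X 2 u \<omega> - X 1 u \<omega> = (x 2 - x 1) + (LINT s:{0..u}|lebesgue. ?w s)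
        - (Ar 1 u \<omega> - Ar 2 u \<omega>) - (Al 2 u \<omega> - Al 1 u \<omega>)" if "u \<in> {0..T}" for u by (rule diff[OF that])
      show "0 \<le> x 2 - x 1" "0 \<le> L1" using H1 L1(1) by auto
      show "t \<in> {0..T}" by (rule t)
      show "strict_mono (r u \<omega>) \<and> strict_mono (l u \<omega>)" "0 \<in> range (r u \<omega>) \<and> 0 \<in> range (l u \<omega>)"
        if "u \<in> {0..T}" for u using sm zero that by auto
      show "f 1 s \<omega> y \<le> f 2 s \<omega> y \<and> h 1 s \<omega> y \<le> h 2 s \<omega> y" if "s \<in> {0..T}" for s y using ord that by blast
      show "(mono (f 1 s \<omega>) \<and> mono (h 1 s \<omega>)) \<or> (mono (f 2 s \<omega>) \<and> mono (h 2 s \<omega>))"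
        if "s \<in> {0..T}" for s using mon that by blast
    qed (fact F1 F2)+
    then show "(Al 1 t \<omega> \<le> Al 2 t \<omega> \<and>
       Al 2 t \<omega> \<le> Al 1 t \<omega> + X_hat T PP p Q f h X t \<omega> + (x 2 - x 1)) \<and>
      (Ar 2 t \<omega> \<le> Ar 1 t \<omega> \<and>
       Ar 1 t \<omega> \<le> Ar 2 t \<omega> + X_hat T PP p Q f h X t \<omega> + (x 2 - x 1))"
      unfolding hat by linarith
  qed
qed

end
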